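(* The triple $(\Omega,d,\int)$ is a cycle, i.e. $\Omega=\mathcal A\oplus\Omega^1$ equipped with $d$ is a graded differential algebra (with $\Omega^0=\mathcal A$) and the functional $\int$ is a closed graded trace on $\Omega$.
   Context: Fix $q\in\,]0,1[$. The $C^*$-algebra of $SU_q(2)$ is generated by $\alpha,\beta$ with relations $\alpha^*\alpha+\beta^*\beta=1$, $\alpha\alpha^*+q^2\beta\beta^*=1$, $\alpha\beta=q\beta\alpha$, $\alpha\beta^*=q\beta^*\alpha$, $\beta\beta^*=\beta^*\beta$, and is faithfully represented in $\ell^2(\mathbb N)\otimes L^2(S^1)$ by $\pi_0(\alpha)(\varepsilon_x\otimes\xi)=(1-q^{2x})^{1/2}\varepsilon_{x-1}\otimes\xi$, $\pi_0(\beta)(\varepsilon_x\otimes\xi)=q^x\varepsilon_x\otimes v\xi$, with $v$ = multiplication by $e^{i\phi}$. Let $S\varepsilon_x=\varepsilon_{x-1}$, $S\varepsilon_0=0$ and, for $f=\sum\hat f_ku^k\in C^\infty(S^1)$ ($u=e^{i\theta}$), $T_f=\sum_{k\ge0}\hat f_kS^k+\sum_{k>0}\hat f_{-k}S^{*k}$; let $\mathcal S$ be the algebra of matrices of rapid decay on $\ell^2(\mathbb N)$. $\mathcal A=C^\infty(SU_q(2))$ is the algebra of all $a$ with $\pi_0(a)=T_f\otimes1+R$, $f\in C^\infty(S^1)$, $R\in C^\infty(S^1,\mathcal S)$. The symbol homomorphism $\sigma:\mathcal A\to C^\infty(S^1)$ is $\sigma(a)=f$; thus $\sigma(\alpha)=u$,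 $\sigma(\beta)=0$. $r_-$ is the homomorphism of $\mathcal A$ to operators on $\ell^2(\mathbb N)$ with $r_-(\alpha)\varepsilon_x=(1-q^{2x})^{1/2}\varepsilon_{x-1}$, $r_-(\beta)\varepsilon_x=-q^x\varepsilon_x$ (evaluation at $v=-1$); its range consists of the operators $T_f+R$, $R\in\mathcal S$. On such operators put $\tau_1(T_f+R)=\frac1{2\pi}\int_0^{2\pi}f\,d\theta$ and $\tau_0(a)=\lim_{N\to\infty}\big(\sum_{x=0}^N\langle a\varepsilon_x,\varepsilon_x\rangle-\tau_1(a)N\big)$. $\partial=\partial_\beta-\partial_\alpha$ is the derivation of $\mathcal A$ generating the automorphism group with $\nu_t(\alpha)=e^{-it}\alpha$, $\nu_t(\beta)=e^{it}\beta$, $\nu_t=\exp(it\partial)$; so $\partial\alpha=-\alpha$, $\partial\alpha^*=\alpha^*$, $\partial\beta=\beta$, $\partial\beta^*=-\beta^*$. For $a\in\mathcal A$ let $a^{(0)}$ be its component of degree $0$ for $\partial$ and $\tau(a)=\tau_0(r_-(a^{(0)}))$. $\Omega^1=\mathcal A\oplus\Omega^{(2)}(S^1)$, where $\Omega^{(2)}(S^1)$ is the space of differential forms $f(\theta)\,d\theta^2$ of weight $2$ on $S^1$ (identified with $f\in C^\infty(S^1)$). Bimodule structure: $a(\xi,f)=(a\xi,\sigma(a)f)$, $(\xi,f)b=(\xi b,\,-i\,\sigma(\xi)\sigma(b)'+f\sigma(b))$, for $a,b\in\mathcal A$, $'=d/d\theta$. $\Omega=\mathcal A\oplus\Omega^1$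 has the product given by that of $\mathcal A$, the bimodule structure, and $\Omega^1\cdot\Omega^1=0$. The differential is $da=(\partial a,\tfrac12\sigma(a)''\,d\theta^2)$ for $a\in\mathcal A$, $d=0$ on $\Omega^1$. The functional on $\Omega^1$ is $\int(\xi,f)=\tau(\xi)+\frac1{2\pi}\int_{S^1}f\,d\theta$. A closed graded trace means $\int da=0$ for all $a\in\mathcal A$ and $\int a\omega=\int\omega a$ for all $a\in\mathcal A$, $\omega\in\Omega^1$. *)

theory Defs
  imports "HOL-Algebra.Module" "HOL-Analysis.Analysis"
begin

section \<open>Cycles\<close>

definition complex_ring :: "complex ring" where
  "complex_ring =
     \<lparr>carrier = UNIV, monoid.mult = (*), one = 1, ring.zero = 0, add = (+)\<rparr>"

locale complex_algebra = Module.module complex_ring W + Ring.ring W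
  for W :: "(complex, 'w) module" (structure) +
  assumes smult_mult_left:
    "\<lbrakk>x \<in> carrier W; y \<in> carrier W\<rbrakk>
       \<Longrightarrow> (c \<odot>\<^bsub>W\<^esub> x) \<otimes>\<^bsub>W\<^esub> y = c \<odot>\<^bsub>W\<^esub> (x \<otimes>\<^bsub>W\<^esub> y)"
  and smult_mult_right:
    "\<lbrakk>x \<in> carrier W; y \<in> carrier W\<rbrakk>
       \<Longrightarrow> x \<otimes>\<^bsub>W\<^esub> (c \<odot>\<^bsub>W\<^esub> y) = c \<odot>\<^bsub>W\<^esub> (x \<otimes>\<^bsub>W\<^esub> y)"

text \<open>Only the components of degree at most \<open>n\<close> of \<open>W\<close> may be nonzero, so the direct sum
  decomposition runs over \<open>{..n}\<close>.\<close>

locale graded_algebra = complex_algebra W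
  for n :: nat and W :: "(complex, 'w) module" (structure) and G :: "nat \<Rightarrow> 'w set" +
  assumes degree_submodule: "submodule (G j) complex_ring W"
  and degree_above: "j > n \<Longrightarrow> G j = {\<zero>\<^bsub>W\<^esub>}"
  and direct_sum: "x \<in> carrier W \<Longrightarrow> \<exists>!c. c \<in> (\<Pi>\<^sub>E j\<in>{..n}. G j) \<and> x = finsum W c {..n}"
  and one_degree: "\<one>\<^bsub>W\<^esub> \<in> G 0"
  and mult_degree: "\<lbrakk>x \<in> G i; y \<in> G j\<rbrakk> \<Longrightarrow> x \<otimes>\<^bsub>W\<^esub> y \<in> G (i + j)"

locale graded_differential_algebra = graded_algebra n W G
  for n :: nat and W :: "(complex, 'w) module" (structure) and G :: "nat \<Rightarrow> 'w set" +
  fixes d :: "'w \<Rightarrow> 'w"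
  assumes d_add: "\<lbrakk>x \<in> carrier W; y \<in> carrier W\<rbrakk> \<Longrightarrow> d (x \<oplus>\<^bsub>W\<^esub> y) = d x \<oplus>\<^bsub>W\<^esub> d y"
  and d_smult: "x \<in> carrier W \<Longrightarrow> d (c \<odot>\<^bsub>W\<^esub> x) = c \<odot>\<^bsub>W\<^esub> d x"
  and d_degree: "x \<in> G j \<Longrightarrow> d x \<in> G (Suc j)"
  and d_d: "x \<in> carrier W \<Longrightarrow> d (d x) = \<zero>\<^bsub>W\<^esub>"
  and d_mult: "\<lbrakk>x \<in> G j; y \<in> carrier W\<rbrakk>
    \<Longrightarrow> d (x \<otimes>\<^bsub>W\<^esub> y) = (d x \<otimes>\<^bsub>W\<^esub> y) \<oplus>\<^bsub>W\<^esub> ((-1) ^ j \<odot>\<^bsub>W\<^esub> (x \<otimes>\<^bsub>W\<^esub> d y))"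

text \<open>The functional of an \<open>n\<close>-dimensional cycle lives on the top degree \<open>n\<close>; its values
  elsewhere are irrelevant.\<close>

locale cycle = graded_differential_algebra n W G d
  for n :: nat and W :: "(complex, 'w) module" (structure) and G :: "nat \<Rightarrow> 'w set"
    and d :: "'w \<Rightarrow> 'w" +
  fixes I :: "'w \<Rightarrow> complex"
  assumes I_add: "\<lbrakk>x \<in> G n; y \<in> G n\<rbrakk> \<Longrightarrow> I (x \<oplus>\<^bsub>W\<^esub> y) = I x + I y"
  and I_smult: "x \<in> G n \<Longrightarrow> I (c \<odot>\<^bsub>W\<^esub> x) = c * I x"
  and I_closed: "\<lbrakk>x \<in> G j; Suc j = n\<rbrakk> \<Longrightarrow> I (d x) = 0"
  and I_trace: "\<lbrakk>x \<in> G i; y \<in> G j; i + j = n\<rbrakk>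
    \<Longrightarrow> I (x \<otimes>\<^bsub>W\<^esub> y) = (-1) ^ (i * j) * I (y \<otimes>\<^bsub>W\<^esub> x)"


section \<open>Operators on \<open>\<ell>\<^sup>2(\<nat>)\<close>\<close>

text \<open>An operator \<open>a\<close> on \<open>\<ell>\<^sup>2(\<nat>)\<close> is given by its matrix: the entry at \<open>x\<close>, \<open>y\<close> is the coefficient
  of \<open>\<epsilon>\<^sub>x\<close> in \<open>a \<epsilon>\<^sub>y\<close>.\<close>

type_synonym mat = "nat \<Rightarrow> nat \<Rightarrow> complex"

definition mat_mult :: "mat \<Rightarrow> mat \<Rightarrow> mat" where
  "mat_mult M N = (\<lambda>x y. \<Sum>\<^sub>\<infinity>z. M x z * N z y)"

definition mat_one :: mat where
  "mat_one = (\<lambda>x y. if x = y then 1 else 0)"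

definition mat_adj :: "mat \<Rightarrow> mat" where
  "mat_adj M = (\<lambda>x y. cnj (M y x))"

text \<open>The operator norm on \<open>\<ell>\<^sup>2(\<nat>)\<close> is at most \<open>C\<close>; testing on finitely supported vectors
  suffices.\<close>

definition opnorm_le :: "mat \<Rightarrow> real \<Rightarrow> bool" where
  "opnorm_le M C \<longleftrightarrow> (\<forall>F c d. finite F \<longrightarrow>
     cmod (\<Sum>x\<in>F. \<Sum>y\<in>F. cnj (c x) * M x y * d y)
       \<le> C * L2_set (\<lambda>x. cmod (c x)) F * L2_set (\<lambda>y. cmod (d y)) F)"

definition shift :: mat where
  "shift = (\<lambda>x y. if y = Suc x then 1 else 0)"

definition rapid_decay :: "mat set" where
  "rapid_decay = {R. \<forall>k. \<exists>C. \<forall>x y. real (1 + x + y) ^ k * cmod (R x y) \<le> C}"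


section \<open>Smooth functions on the circle, Toeplitz operators\<close>

text \<open>Functions on the circle are \<open>2 \<pi>\<close>-periodic functions of the angle.\<close>

definition smooth_circle :: "(real \<Rightarrow> complex) set" where
  "smooth_circle = {f. (\<forall>\<theta>. f (\<theta> + 2 * pi) = f \<theta>) \<and>
     (\<exists>D. D 0 = f \<and> (\<forall>n \<theta>. (D n has_vector_derivative D (Suc n) \<theta>) (at \<theta>)))}"

definition ddt :: "(real \<Rightarrow> complex) \<Rightarrow> real \<Rightarrow> complex" where
  "ddt f = (\<lambda>\<theta>. vector_derivative f (at \<theta>))"

definition circle_mean :: "(real \<Rightarrow> complex) \<Rightarrow> complex" where
  "circle_mean f = of_real (1 / (2 * pi)) * integral {0..2 * pi} f"

definition fourier_coeff :: "(real \<Rightarrow> complex) \<Rightarrow> int \<Rightarrow> complex" where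
  "fourier_coeff f k = circle_mean (\<lambda>\<theta>. f \<theta> * cis (- (of_int k * \<theta>)))"

definition toeplitz :: "(real \<Rightarrow> complex) \<Rightarrow> mat" where
  "toeplitz f = (\<lambda>x y.
     (\<Sum>\<^sub>\<infinity>k. fourier_coeff f (int k) * (mat_mult shift ^^ k) mat_one x y)
   + (\<Sum>\<^sub>\<infinity>k. fourier_coeff f (- int (Suc k)) * (mat_mult (mat_adj shift) ^^ Suc k) mat_one x y))"

text \<open>Differentiability of a curve in the Frechet space \<open>rapid_decay\<close>, whose topology is given by
  the seminorms \<open>sup\<^sub>x\<^sub>,\<^sub>y (1 + x + y)\<^sup>k |R x y|\<close>.\<close>

definition has_rapid_derivative :: "(real \<Rightarrow> mat) \<Rightarrow> mat \<Rightarrow> real \<Rightarrow> bool" where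
  "has_rapid_derivative R R' \<phi> \<longleftrightarrow> (\<forall>k. \<forall>e>0. \<forall>\<^sub>F h in at 0. \<forall>x y.
     real (1 + x + y) ^ k * cmod ((R (\<phi> + h) x y - R \<phi> x y) / of_real h - R' x y) \<le> e)"

definition smooth_circle_rapid :: "(real \<Rightarrow> mat) set" where
  "smooth_circle_rapid = {R. (\<forall>\<phi>. R (\<phi> + 2 * pi) = R \<phi>) \<and>
     (\<exists>D. D 0 = R \<and> (\<forall>n \<phi>. D n \<phi> \<in> rapid_decay \<and> has_rapid_derivative (D n) (D (Suc n) \<phi>) \<phi>))}"


section \<open>The algebra \<open>C\<^sup>\<infinity>(SU\<^sub>q(2))\<close>\<close>

text \<open>The Hilbert space of the faithful representation \<open>\<pi>\<^sub>0\<close> is \<open>\<ell>\<^sup>2(\<nat>) \<otimes> L\<^sup>2(S\<^sup>1) = L\<^sup>2(S\<^sup>1, \<ell>\<^sup>2(\<nat>))\<close>.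
  All operators \<open>\<pi>\<^sub>0(a)\<close> commute with the multiplication operators \<open>1 \<otimes> g\<close>, hence act fibrewise:
  \<open>\<pi>\<^sub>0(a)\<close> is recorded as the continuous \<open>2 \<pi>\<close>-periodic function sending the angle \<open>\<phi>\<close> of \<open>v\<close> to
  the operator of \<open>\<pi>\<^sub>0(a)\<close> on the fibre \<open>\<ell>\<^sup>2(\<nat>)\<close> over \<open>\<phi>\<close>. Products and adjoints are fibrewise and
  the operator norm is the supremum of the norms on the fibres. Since \<open>\<pi>\<^sub>0\<close> is faithful, \<open>a\<close> is
  identified with \<open>\<pi>\<^sub>0(a)\<close>.\<close>

type_synonym opfield = "real \<Rightarrow> mat"

definition fmult :: "opfield \<Rightarrow> opfield \<Rightarrow> opfield" where
  "fmult a b = (\<lambda>\<phi>. mat_mult (a \<phi>) (b \<phi>))"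

definition fadd :: "opfield \<Rightarrow> opfield \<Rightarrow> opfield" where
  "fadd a b = (\<lambda>\<phi> x y. a \<phi> x y + b \<phi> x y)"

definition fscale :: "complex \<Rightarrow> opfield \<Rightarrow> opfield" where
  "fscale c a = (\<lambda>\<phi> x y. c * a \<phi> x y)"

definition fone :: opfield where
  "fone = (\<lambda>\<phi>. mat_one)"

definition fzero :: opfield where
  "fzero = (\<lambda>\<phi> x y. 0)"

definition fadj :: "opfield \<Rightarrow> opfield" where
  "fadj a = (\<lambda>\<phi>. mat_adj (a \<phi>))"

definition alpha :: "real \<Rightarrow> opfield" where
  "alpha q = (\<lambda>\<phi> x y. if y = Suc x then of_real (sqrt (1 - q ^ (2 * y))) else 0)"

definition beta :: "real \<Rightarrow> opfield" where
  "beta q = (\<lambda>\<phi> x y. if x = y then of_real (q ^ y) * cis \<phi> else 0)"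

inductive_set SUq_poly :: "real \<Rightarrow> opfield set" for q :: real where
  "fone \<in> SUq_poly q"
| "alpha q \<in> SUq_poly q"
| "beta q \<in> SUq_poly q"
| "a \<in> SUq_poly q \<Longrightarrow> fadj a \<in> SUq_poly q"
| "a \<in> SUq_poly q \<Longrightarrow> fscale c a \<in> SUq_poly q"
| "a \<in> SUq_poly q \<Longrightarrow> b \<in> SUq_poly q \<Longrightarrow> fadd a b \<in> SUq_poly q"
| "a \<in> SUq_poly q \<Longrightarrow> b \<in> SUq_poly q \<Longrightarrow> fmult a b \<in> SUq_poly q"

definition SUq_cstar :: "real \<Rightarrow> opfield set" where
  "SUq_cstar q = {a. \<forall>e>0. \<exists>p\<in>SUq_poly q. \<forall>\<phi>. opnorm_le (\<lambda>x y. a \<phi> x y - p \<phi> x y) e}"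

definition SUq_smooth :: "real \<Rightarrow> opfield set" where
  "SUq_smooth q = {a \<in> SUq_cstar q.
     \<exists>f\<in>smooth_circle. \<exists>R\<in>smooth_circle_rapid. a = (\<lambda>\<phi> x y. toeplitz f x y + R \<phi> x y)}"

definition symbol :: "opfield \<Rightarrow> real \<Rightarrow> complex" where
  "symbol a = (THE f. f \<in> smooth_circle \<and>
     (\<exists>R\<in>smooth_circle_rapid. a = (\<lambda>\<phi> x y. toeplitz f x y + R \<phi> x y)))"


section \<open>The functional \<open>\<tau>\<close>\<close>

definition r_minus :: "opfield \<Rightarrow> mat" where
  "r_minus a = a pi"

definition mat_symbol :: "mat \<Rightarrow> real \<Rightarrow> complex" where
  "mat_symbol M = (THE f. f \<in> smooth_circle \<and>
     (\<exists>R\<in>rapid_decay. M = (\<lambda>x y. toeplitz f x y + R x y)))"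

definition tau1 :: "mat \<Rightarrow> complex" where
  "tau1 M = circle_mean (mat_symbol M)"

definition tau0 :: "mat \<Rightarrow> complex" where
  "tau0 M = lim (\<lambda>N. (\<Sum>x\<le>N. M x x) - tau1 M * of_nat N)"

text \<open>The automorphism group \<open>\<nu>\<close> is implemented by the unitaries sending \<open>\<epsilon>\<^sub>x \<otimes> \<xi>\<close> to
  \<open>e\<^sup>i\<^sup>t\<^sup>x \<epsilon>\<^sub>x \<otimes> \<xi>(\<cdot> + t)\<close>. The lemmas at the end of this theory show that it is multiplicative and
  has the prescribed values on the generators.\<close>

definition nu :: "real \<Rightarrow> opfield \<Rightarrow> opfield" where
  "nu t a = (\<lambda>\<phi> x y. cis (t * (real x - real y)) * a (\<phi> + t) x y)"

text \<open>From \<open>\<nu>\<^sub>t = exp (i t \<partial>)\<close>: \<open>\<partial> a\<close> is \<open>-i\<close> times the derivative of \<open>\<nu>\<^sub>t(a)\<close> at \<open>t = 0\<close>.\<close>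

definition partial :: "opfield \<Rightarrow> opfield" where
  "partial a = (\<lambda>\<phi> x y. - \<i> * vector_derivative (\<lambda>t. nu t a \<phi> x y) (at 0))"

text \<open>The component of degree \<open>0\<close> for \<open>\<partial>\<close> is the average over the \<open>2 \<pi>\<close>-periodic group \<open>\<nu>\<close>.\<close>

definition degree0 :: "opfield \<Rightarrow> opfield" where
  "degree0 a = (\<lambda>\<phi> x y. circle_mean (\<lambda>t. nu t a \<phi> x y))"

definition tau :: "opfield \<Rightarrow> complex" where
  "tau a = tau0 (r_minus (degree0 a))"


section \<open>The differential graded algebra \<open>\<Omega>\<close>\<close>

text \<open>The triple \<open>(a, \<xi>, f)\<close> stands for \<open>a + (\<xi>, f d\<theta>\<^sup>2)\<close> with \<open>a\<close> of degree \<open>0\<close> and \<open>(\<xi>, f d\<theta>\<^sup>2)\<close>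
  of degree \<open>1\<close>.\<close>

type_synonym oneform = "opfield \<times> (real \<Rightarrow> complex)"
type_synonym form = "opfield \<times> oneform"

definition oneform_add :: "oneform \<Rightarrow> oneform \<Rightarrow> oneform" where
  "oneform_add = (\<lambda>(\<xi>, f) (\<eta>, g). (fadd \<xi> \<eta>, \<lambda>\<theta>. f \<theta> + g \<theta>))"

definition oneform_scale :: "complex \<Rightarrow> oneform \<Rightarrow> oneform" where
  "oneform_scale c = (\<lambda>(\<xi>, f). (fscale c \<xi>, \<lambda>\<theta>. c * f \<theta>))"

definition left_act :: "opfield \<Rightarrow> oneform \<Rightarrow> oneform" where
  "left_act a = (\<lambda>(\<xi>, f). (fmult a \<xi>, \<lambda>\<theta>. symbol a \<theta> * f \<theta>))"

definition right_act :: "oneform \<Rightarrow> opfield \<Rightarrow> oneform" where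
  "right_act = (\<lambda>(\<xi>, f) b.
     (fmult \<xi> b, \<lambda>\<theta>. - \<i> * symbol \<xi> \<theta> * ddt (symbol b) \<theta> + f \<theta> * symbol b \<theta>))"

definition oneform_zero :: oneform where
  "oneform_zero = (fzero, \<lambda>\<theta>. 0)"

definition Omega1 :: "real \<Rightarrow> oneform set" where
  "Omega1 q = SUq_smooth q \<times> smooth_circle"

definition Omega :: "real \<Rightarrow> (complex, form) module" where
  "Omega q = \<lparr>carrier = SUq_smooth q \<times> Omega1 q,
     monoid.mult = (\<lambda>(a, \<omega>) (b, \<eta>). (fmult a b, oneform_add (left_act a \<eta>) (right_act \<omega> b))),
     one = (fone, oneform_zero),
     ring.zero = (fzero, oneform_zero),
     add = (\<lambda>(a, \<omega>) (b, \<eta>). (fadd a b, oneform_add \<omega> \<eta>)),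
     module.smult = (\<lambda>c (a, \<omega>). (fscale c a, oneform_scale c \<omega>))\<rparr>"

fun Omega_degree :: "real \<Rightarrow> nat \<Rightarrow> form set" where
  "Omega_degree q 0 = SUq_smooth q \<times> {oneform_zero}"
| "Omega_degree q (Suc 0) = {fzero} \<times> Omega1 q"
| "Omega_degree q (Suc (Suc j)) = {(fzero, oneform_zero)}"

definition d_Omega :: "form \<Rightarrow> form" where
  "d_Omega = (\<lambda>(a, \<omega>). (fzero, (partial a, \<lambda>\<theta>. 1 / 2 * ddt (ddt (symbol a)) \<theta>)))"

definition form_integral :: "form \<Rightarrow> complex" where
  "form_integral = (\<lambda>(a, (\<xi>, f)). tau \<xi> + circle_mean f)"


section \<open>Agreement with the description by generators\<close>

lemma infsum_single_index:
  fixes c :: "nat \<Rightarrow> complex"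
  assumes "\<And>k. k \<noteq> m \<Longrightarrow> c k = 0"
  shows "(\<Sum>\<^sub>\<infinity>k. c k) = c m"
  using infsum_cong_neutral[of UNIV "{m}" c c] assms by simp

lemma shift_power:
  "(mat_mult shift ^^ k) mat_one x y = (if y = x + k then 1 else 0)"
proof (induction k arbitrary: x y)
  case 0 show ?case by (auto simp: mat_one_def)
next
  case (Suc k)
  have "(mat_mult shift ^^ Suc k) mat_one x y
      = (\<Sum>\<^sub>\<infinity>z. shift x z * (mat_mult shift ^^ k) mat_one z y)"
    by (simp add: mat_mult_def)
  also have "\<dots> = shift x (Suc x) * (mat_mult shift ^^ k) mat_one (Suc x) y"
    by (rule infsum_single_index) (simp add: shift_def)
  finally show ?case using Suc by (simp add: shift_def)
qed

lemma adj_shift_power: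
  "(mat_mult (mat_adj shift) ^^ k) mat_one x y = (if x = y + k then 1 else 0)"
proof (induction k arbitrary: x y)
  case 0 show ?case by (auto simp: mat_one_def)
next
  case (Suc k)
  have "(mat_mult (mat_adj shift) ^^ Suc k) mat_one x y
      = (\<Sum>\<^sub>\<infinity>z. mat_adj shift x z * (mat_mult (mat_adj shift) ^^ k) mat_one z y)"
    by (simp add: mat_mult_def)
  also have "\<dots> = mat_adj shift x (x - 1) * (mat_mult (mat_adj shift) ^^ k) mat_one (x - 1) y"
    by (rule infsum_single_index) (auto simp: shift_def mat_adj_def)
  finally show ?case using Suc by (auto simp: shift_def mat_adj_def)
qed

lemma toeplitz_entry: "toeplitz f x y = fourier_coeff f (int y - int x)"
proof -
  have 1: "(\<Sum>\<^sub>\<infinity>k. fourier_coeff f (int k) * (mat_mult shift ^^ k) mat_one x y)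
      = (if x \<le> y then fourier_coeff f (int y - int x) else 0)"
    by (subst infsum_single_index[of "y - x"]) (auto simp: shift_power of_nat_diff)
  have 2: "(\<Sum>\<^sub>\<infinity>k. fourier_coeff f (- int (Suc k)) * (mat_mult (mat_adj shift) ^^ Suc k) mat_one x y)
      = (if y < x then fourier_coeff f (int y - int x) else 0)"
    by (subst infsum_single_index[of "x - y - 1"])
      (auto simp del: funpow.simps simp: adj_shift_power of_nat_diff)
  show ?thesis unfolding toeplitz_def 1 2 by auto
qed

lemma mult_alpha_left:
  "fmult (alpha q) a \<phi> x y = of_real (sqrt (1 - q ^ (2 * Suc x))) * a \<phi> (Suc x) y"
  unfolding fmult_def mat_mult_def
  by (subst infsum_single_index[of "Suc x"]) (auto simp: alpha_def)

lemma mult_adj_alpha_left: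
  "fmult (fadj (alpha q)) a \<phi> x y
     = (if x = 0 then 0 else of_real (sqrt (1 - q ^ (2 * x))) * a \<phi> (x - 1) y)"
  unfolding fmult_def mat_mult_def
  by (subst infsum_single_index[of "x - 1"]) (auto simp: alpha_def fadj_def mat_adj_def)

lemma mult_beta_left:
  "fmult (beta q) a \<phi> x y = of_real (q ^ x) * cis \<phi> * a \<phi> x y"
  unfolding fmult_def mat_mult_def
  by (subst infsum_single_index[of x]) (auto simp: beta_def)

lemma mult_adj_beta_left:
  "fmult (fadj (beta q)) a \<phi> x y = of_real (q ^ x) * cis (- \<phi>) * a \<phi> x y"
  unfolding fmult_def mat_mult_def
  by (subst infsum_single_index[of x]) (auto simp: beta_def fadj_def mat_adj_def cis_cnj)

lemma SUq_relations:
  assumes "0 < q" "q < 1"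
  shows "fadd (fmult (fadj (alpha q)) (alpha q)) (fmult (fadj (beta q)) (beta q)) = fone"
    and "fadd (fmult (alpha q) (fadj (alpha q)))
           (fscale (of_real (q\<^sup>2)) (fmult (beta q) (fadj (beta q)))) = fone"
    and "fmult (alpha q) (beta q) = fscale (of_real q) (fmult (beta q) (alpha q))"
    and "fmult (alpha q) (fadj (beta q)) = fscale (of_real q) (fmult (fadj (beta q)) (alpha q))"
    and "fmult (beta q) (fadj (beta q)) = fmult (fadj (beta q)) (beta q)"
proof -
  have sq: "complex_of_real (sqrt (1 - q ^ (2 * m))) * of_real (sqrt (1 - q ^ (2 * m)))
      = 1 - of_real q ^ (2 * m)" for m
  proof -
    have "q ^ (2 * m) \<le> 1" using assms by (intro power_le_one) auto
    then show ?thesis by (simp flip: of_real_mult of_real_power)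
  qed
  have qm: "cis \<phi> * (cis (- \<phi>) * z) = z" for \<phi> z
    by (simp add: cis_mult flip: mult.assoc)
  have qq: "cis \<phi> * cis (- \<phi>) = 1" "cis (- \<phi>) * cis \<phi> = 1" for \<phi>
    by (simp_all add: cis_mult)
  show "fadd (fmult (fadj (alpha q)) (alpha q)) (fmult (fadj (beta q)) (beta q)) = fone"
  proof (intro ext)
    fix \<phi> x y
    show "fadd (fmult (fadj (alpha q)) (alpha q)) (fmult (fadj (beta q)) (beta q)) \<phi> x y
        = fone \<phi> x y"
      using sq[of x] qq[of \<phi>]
      unfolding fadd_def mult_adj_alpha_left mult_adj_beta_left
      by (cases x) (auto simp: fone_def mat_one_def
          alpha_def beta_def power_add mult_2 mult_2_right power_Suc qm ac_simps)
  qed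
  show "fadd (fmult (alpha q) (fadj (alpha q)))
      (fscale (of_real (q\<^sup>2)) (fmult (beta q) (fadj (beta q)))) = fone"
  proof (intro ext)
    fix \<phi> x y
    show "fadd (fmult (alpha q) (fadj (alpha q)))
        (fscale (of_real (q\<^sup>2)) (fmult (beta q) (fadj (beta q)))) \<phi> x y = fone \<phi> x y"
      using sq[of "Suc x"] qq[of \<phi>]
      unfolding fadd_def fscale_def mult_alpha_left mult_beta_left
      by (auto simp: fone_def mat_one_def
          fadj_def mat_adj_def alpha_def beta_def cis_cnj power_add mult_2 mult_2_right power2_eq_square qm ac_simps)
  qed
  show "fmult (alpha q) (beta q) = fscale (of_real q) (fmult (beta q) (alpha q))"
    by (intro ext) (unfold mult_alpha_left mult_beta_left fscale_def, auto simp: alpha_def beta_def)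
  show "fmult (alpha q) (fadj (beta q)) = fscale (of_real q) (fmult (fadj (beta q)) (alpha q))"
    by (intro ext) (unfold mult_alpha_left mult_adj_beta_left fscale_def, auto simp: fadj_def mat_adj_def
        alpha_def beta_def cis_cnj)
  show "fmult (beta q) (fadj (beta q)) = fmult (fadj (beta q)) (beta q)"
    by (intro ext) (unfold mult_beta_left mult_adj_beta_left, auto simp: fadj_def mat_adj_def
        beta_def cis_cnj)
qed

lemma nu_mult: "nu t (fmult a b) = fmult (nu t a) (nu t b)"
proof (intro ext)
  fix \<phi> x y
  have "fmult (nu t a) (nu t b) \<phi> x y
      = (\<Sum>\<^sub>\<infinity>z. cis (t * (real x - real y)) * (a (\<phi> + t) x z * b (\<phi> + t) z y))"
    unfolding fmult_def mat_mult_def nu_def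
    by (intro infsum_cong)
      (simp add: cis_mult[symmetric] ac_simps right_diff_distrib flip: cis_divide)
  also have "\<dots> = cis (t * (real x - real y)) * (\<Sum>\<^sub>\<infinity>z. a (\<phi> + t) x z * b (\<phi> + t) z y)"
    by (rule infsum_cmult_right')
  finally show "nu t (fmult a b) \<phi> x y = fmult (nu t a) (nu t b) \<phi> x y"
    by (simp add: nu_def fmult_def mat_mult_def)
qed

lemma nu_fadd: "nu t (fadd a b) = fadd (nu t a) (nu t b)"
  by (intro ext) (simp add: nu_def fadd_def algebra_simps)

lemma nu_fscale: "nu t (fscale c a) = fscale c (nu t a)"
  by (intro ext) (simp add: nu_def fscale_def)

lemma nu_fadj: "nu t (fadj a) = fadj (nu t a)"
  by (intro ext) (simp add: nu_def fadj_def mat_adj_def cis_cnj algebra_simps)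

lemma nu_nu: "nu s (nu t a) = nu (s + t) a"
  by (intro ext) (simp add: nu_def cis_mult algebra_simps)

lemma nu_alpha: "nu t (alpha q) = fscale (cis (- t)) (alpha q)"
  by (intro ext) (simp add: nu_def alpha_def fscale_def algebra_simps)

lemma nu_beta: "nu t (beta q) = fscale (cis t) (beta q)"
  by (intro ext) (simp add: nu_def beta_def fscale_def cis_mult algebra_simps)

lemma partial_eigenvector:
  assumes "\<And>t. nu t a = fscale (cis (of_int k * t)) a"
  shows "partial a = fscale (of_int k) a"
proof (intro ext)
  fix \<phi> x y
  have "((\<lambda>t. cis (of_int k * t)) has_vector_derivative of_int k *\<^sub>R (\<i> * cis (of_int k * 0))) (at 0)"
    unfolding has_vector_derivative_def
    by (auto intro!: derivative_eq_intros simp: fun_eq_iff)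
  then have "((\<lambda>t. cis (of_int k * t) * a \<phi> x y) has_vector_derivative
      \<i> * of_int k * a \<phi> x y) (at 0)"
    by (auto intro!: derivative_eq_intros simp: scaleR_conv_of_real mult.commute)
  then show "partial a \<phi> x y = fscale (of_int k) a \<phi> x y"
    unfolding partial_def assms fscale_def by (simp add: vector_derivative_at flip: mult.assoc)
qed

lemma partial_generators:
  "partial (alpha q) = fscale (- 1) (alpha q)"
  "partial (fadj (alpha q)) = fadj (alpha q)"
  "partial (beta q) = beta q"
  "partial (fadj (beta q)) = fscale (- 1) (fadj (beta q))"
proof -
  have adj: "fadj (fscale c a) = fscale (cnj c) (fadj a)" for c a
    by (intro ext) (simp add: fadj_def fscale_def mat_adj_def)
  have one: "fscale 1 a = a" for a by (intro ext) (simp add: fscale_def)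
  show "partial (alpha q) = fscale (- 1) (alpha q)"
    using partial_eigenvector[of "alpha q" "- 1"] by (simp add: nu_alpha)
  show "partial (fadj (alpha q)) = fadj (alpha q)"
    using partial_eigenvector[of "fadj (alpha q)" 1] by (simp add: nu_fadj nu_alpha adj cis_cnj one)
  show "partial (beta q) = beta q"
    using partial_eigenvector[of "beta q" 1] by (simp add: nu_beta one)
  show "partial (fadj (beta q)) = fscale (- 1) (fadj (beta q))"
    using partial_eigenvector[of "fadj (beta q)" "- 1"] by (simp add: nu_fadj nu_beta adj cis_cnj)
qed

lemma r_minus_generators:
  "r_minus (alpha q) = (\<lambda>x y. if y = Suc x then of_real (sqrt (1 - q ^ (2 * y))) else 0)"
  "r_minus (beta q) = (\<lambda>x y. if x = y then - of_real (q ^ y) else 0)"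
  by (auto simp: r_minus_def alpha_def beta_def fun_eq_iff)

end

theory Submission
  imports Defs
begin

text \<open>Every \<open>T\<^sub>f \<otimes> 1 + R\<close> with \<open>f\<close> smooth and \<open>R\<close> a smooth curve of matrices of rapid decay lies in the
  C*-algebra: \<open>(\<beta>\<beta>*)\<^sup>n\<close> tends to the rank one projection on \<open>\<epsilon>\<^sub>0\<close>, so products with powers of \<open>\<alpha>\<close>, \<open>\<beta>\<close>
  and their adjoints give the matrix units with coefficients \<open>e\<^sup>i\<^sup>k\<^sup>\<phi>\<close>, and \<open>\<alpha>\<^sup>k\<close> differs from \<open>S\<^sup>k\<close> by a
  norm limit of these. The algebra is therefore described by symbols modulo rapid decay, on which
  \<open>\<sigma>(\<partial>a) = i \<sigma>(a)'\<close>; this turns the twisted right action into a bimodule structure and makes \<open>d\<close> a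
  derivation.

  For \<open>a = T\<^sub>f + R\<close> the functional \<open>\<tau>\<close> is the mean of \<open>f\<close> plus the mean over the circle of the trace of
  \<open>R\<close>. The only contribution to \<open>\<tau>(ab) - \<tau>(ba)\<close> comes from the commutator of the Toeplitz operators
  of the symbols \<open>f\<close> and \<open>g\<close>. Its trace is the sum of \<open>k f\<^sub>k g\<^sub>-\<^sub>k\<close> over all integers \<open>k\<close>, that is, the mean
  of \<open>- i f' g\<close>, which is exactly the defect of the trace property caused by the right action.\<close>

text \<open>The definition of the algebra intersects a norm closure with an explicit normal form.
  The closure alone gives no hold on \<open>partial\<close>, which is unbounded, or on symbols; once
  the normal form is known to imply membership in the closure, all algebra can be done on a symbol
  together with a rapidly decaying remainder. Two notions of decay are involved: Toeplitz matrices
  decay only away from the diagonal, remainders in both indices. Multiplying a remainder by a matrix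
  of the first kind gives a remainder again, and the difference of T_f T_g and T_(fg) is a
  remainder.

  The constants of the calculus hang together. If a and b have symbols f and g, then \<partial>a has
  symbol i f', so the right action contributes -i (i f') g' = f' g' to (da) b. The second derivative
  of f g has the cross term 2 f' g', and the factor 1/2 in d matches the two.

  The trace of a commutator is first computed in a single fibre. There it does not depend on the
  angle: commutators with a rapidly decaying factor are traceless, and the Toeplitz part is the same
  in all fibres. The averaging in \<tau> therefore leaves it unchanged.\<close>

definition inv_sq :: "int \<Rightarrow> real" where
  "inv_sq j = 1 / (1 + \<bar>real_of_int j\<bar>)\<^sup>2"

lemma inv_sq_nonneg: "0 \<le> inv_sq j"
  by (simp add: inv_sq_def)

lemma inv_sq_summable: "inv_sq summable_on A"
proof -
  have s: "(\<lambda>n. 1 / (1 + real n)\<^sup>2) summable_on UNIV"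
  proof (rule summable_nonneg_imp_summable_on)
    have "summable (\<lambda>n. inverse (real (Suc n) ^ 2))"
      using inverse_power_summable[of 2, where 'a=real] by (subst summable_Suc_iff) auto
    then show "summable (\<lambda>n. 1 / (1 + real n)\<^sup>2)" by (simp add: field_simps)
  qed simp
  have "inv_sq summable_on range int"
    by (subst summable_on_reindex) (use s in \<open>auto simp: inv_sq_def o_def\<close>)
  moreover have "inv_sq summable_on range (\<lambda>n. - int n)"
    by (subst summable_on_reindex) (use s in \<open>auto simp: inv_sq_def o_def inj_on_def\<close>)
  ultimately have "inv_sq summable_on (range int \<union> range (\<lambda>n. - int n))"
    by (rule summable_on_union)
  moreover have "range int \<union> range (\<lambda>n. - int n) = UNIV"
    by (auto intro: int_cases2)
  ultimately have "inv_sq summable_on UNIV" by simp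
  then show ?thesis by (rule summable_on_subset) auto
qed

text \<open>The one constant behind all row and column estimates: every translate of
  \<open>inv_sq\<close>, summed over any set of integers, is bounded by it.\<close>

definition inv_sq_total :: real where "inv_sq_total = infsum inv_sq UNIV"

section \<open>Periodic functions on one period\<close>

lemma periodic_reduce:
  fixes f :: "real \<Rightarrow> 'a"
  assumes "\<And>\<theta>. f (\<theta> + 2 * pi) = f \<theta>"
  obtains t where "0 \<le> t" "t < 2 * pi" "f \<theta> = f t" "cis \<theta> = cis t"
proof -
  interpret periodic_fun_simple f "2 * pi" by unfold_locales (rule assms)
  define k where "k = \<lfloor>\<theta> / (2 * pi)\<rfloor>"
  have k: "of_int k \<le> \<theta> / (2 * pi)" "\<theta> / (2 * pi) < of_int k + 1"
    unfolding k_def by linarith+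
  have "f (\<theta> - of_int k * (2 * pi)) = f \<theta>" by (rule minus_of_int)
  moreover have "cis (\<theta> - of_int k * (2 * pi)) = cis \<theta>"
    using cis_multiple_2pi[of "of_int k"] by (simp add: mult.commute flip: cis_divide)
  ultimately show ?thesis
    using k by (intro that[of "\<theta> - of_int k * (2 * pi)"]) (auto simp: field_simps)
qed

lemma periodic_bounded:
  fixes f :: "real \<Rightarrow> complex"
  assumes "\<And>\<theta>. f (\<theta> + 2 * pi) = f \<theta>" "continuous_on UNIV f"
  obtains B where "\<And>\<theta>. cmod (f \<theta>) \<le> B"
proof -
  have "compact (f ` {0..2 * pi})"
    by (intro compact_continuous_image continuous_on_subset[OF assms(2)]) auto
  then obtain B where B: "\<And>t. t \<in> {0..2 * pi} \<Longrightarrow> cmod (f t) \<le> B"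
    by (force dest!: compact_imp_bounded simp: bounded_iff)
  have "cmod (f \<theta>) \<le> B" for \<theta>
    by (rule periodic_reduce[of f \<theta>, OF assms(1)]) (use B in auto)
  then show ?thesis by (rule that)
qed

section \<open>Means over the circle\<close>

lemma integrable_circle [simp]:
  fixes f :: "real \<Rightarrow> complex"
  assumes "continuous_on UNIV f"
  shows "f integrable_on {0..2 * pi}"
  by (rule integrable_continuous_real) (rule continuous_on_subset[OF assms], simp)

lemma circle_mean_add:
  assumes "continuous_on UNIV f" "continuous_on UNIV g"
  shows "circle_mean (\<lambda>t. f t + g t) = circle_mean f + circle_mean g"
  unfolding circle_mean_def using assms by (simp add: integral_add ring_distribs)

lemma circle_mean_cmult: "circle_mean (\<lambda>t. c * f t) = c * circle_mean f"
  by (simp add: circle_mean_def)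

lemma circle_mean_diff:
  assumes "continuous_on UNIV f" "continuous_on UNIV g"
  shows "circle_mean (\<lambda>t. f t - g t) = circle_mean f - circle_mean g"
  unfolding circle_mean_def using assms
  by (simp add: integral_diff[OF integrable_circle integrable_circle] right_diff_distrib diff_divide_distrib)

lemma circle_mean_sum:
  assumes "finite F" "\<And>i. i \<in> F \<Longrightarrow> continuous_on UNIV (f i)"
  shows "circle_mean (\<lambda>t. \<Sum>i\<in>F. f i t) = (\<Sum>i\<in>F. circle_mean (f i))"
  unfolding circle_mean_def using assms by (simp add: integral_sum sum_distrib_left)

lemma circle_mean_const [simp]: "circle_mean (\<lambda>t. c) = c"
  by (simp add: circle_mean_def scaleR_conv_of_real)

lemma circle_mean_cnj:
  assumes "continuous_on UNIV f"
  shows "circle_mean (\<lambda>t. cnj (f t)) = cnj (circle_mean f)"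
  unfolding circle_mean_def using integral_cnj[of "{0..2*pi}" f] by simp

lemma circle_mean_bound:
  assumes "continuous_on UNIV f" "\<And>t. cmod (f t) \<le> B"
  shows "cmod (circle_mean f) \<le> B"
proof -
  have "norm (integral {0..2*pi} f) \<le> B * (2 * pi - 0)"
    by (rule integral_bound) (use assms in \<open>auto intro: continuous_on_subset\<close>)
  then show ?thesis by (simp add: circle_mean_def norm_mult norm_divide field_simps)
qed

lemma circle_mean_deriv:
  fixes f :: "real \<Rightarrow> complex"
  assumes "\<And>t. (f has_vector_derivative f' t) (at t)" "f (2 * pi) = f 0"
  shows "circle_mean f' = 0"
proof -
  have "(f' has_integral (f (2 * pi) - f 0)) {0..2 * pi}"
    by (rule fundamental_theorem_of_calculus)
      (auto intro: has_vector_derivative_at_within assms(1))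
  then show ?thesis using assms(2) by (simp add: circle_mean_def integral_unique)
qed

lemma circle_mean_uniform:
  assumes "\<And>n. continuous_on UNIV (h n)" "uniform_limit UNIV h g F" "F \<noteq> bot"
  shows "((\<lambda>n. circle_mean (h n)) \<longlongrightarrow> circle_mean g) F"
proof -
  have u: "uniform_limit {0..2*pi} h g F"
    by (rule uniform_limit_on_subset[OF assms(2)]) simp
  obtain I J where IJ: "\<And>n. (h n has_integral I n) {0..2*pi}" "(g has_integral J) {0..2*pi}"
      "(I \<longlongrightarrow> J) F"
    by (rule uniform_limit_integral[OF u _ assms(3)])
      (use assms(1) in \<open>auto intro: continuous_on_subset\<close>)
  have "(\<lambda>n. circle_mean (h n)) = (\<lambda>n. of_real (1 / (2 * pi)) * I n)"
      "circle_mean g = of_real (1 / (2 * pi)) * J"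
    using IJ by (auto simp: circle_mean_def integral_unique)
  then show ?thesis using IJ(3) by (simp only:) (intro tendsto_intros)
qed

text \<open>The M-test gives uniform convergence of the net of finite partial sums, and means pass
  to uniform limits. Since no order of summation enters, the index may range over the integers
  (Fourier series) or the naturals (traces).\<close>

lemma circle_mean_infsum:
  fixes F :: "'a \<Rightarrow> real \<Rightarrow> complex"
  assumes "\<And>k. continuous_on UNIV (F k)" "\<And>k t. cmod (F k t) \<le> M k" "M summable_on UNIV"
  shows "((\<lambda>k. circle_mean (F k)) has_sum circle_mean (\<lambda>t. \<Sum>\<^sub>\<infinity>k. F k t)) UNIV"
proof -
  have "((\<lambda>X. circle_mean (\<lambda>t. \<Sum>k\<in>X. F k t)) \<longlongrightarrow> circle_mean (\<lambda>t. \<Sum>\<^sub>\<infinity>k. F k t))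
     (finite_subsets_at_top UNIV)"
    by (rule circle_mean_uniform)
      (use assms in \<open>auto intro!: continuous_on_sum Weierstrass_m_test_general\<close>)
  then show ?thesis unfolding has_sum_def
    by (rule Lim_transform_eventually)
      (auto simp: circle_mean_sum assms intro!: eventually_finite_subsets_at_top_weakI)
qed

lemma has_vector_derivative_cis:
  "((\<lambda>t. cis (c * t)) has_vector_derivative (\<i> * of_real c * cis (c * t))) (at t)"
proof -
  have "((\<lambda>t. cis (c * t)) has_vector_derivative c *\<^sub>R (\<i> * cis (c * t))) (at t)"
    unfolding has_vector_derivative_def
    by (auto intro!: derivative_eq_intros simp: fun_eq_iff)
  then show ?thesis by (simp add: scaleR_conv_of_real ac_simps)
qed

lemma continuous_cis [continuous_intros]:
  "continuous_on A f \<Longrightarrow> continuous_on A (\<lambda>t. cis (f t :: real))"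
  unfolding cis_conv_exp by (intro continuous_intros)

lemma circle_mean_cis: "circle_mean (\<lambda>t. cis (of_int k * t)) = (if k = 0 then 1 else 0)"
proof (cases "k = 0")
  case False
  have "cis (real_of_int k * (2 * pi)) = cis (real_of_int k * 0)"
    using cis_multiple_2pi[of "of_int k"] by (simp add: mult.commute)
  then have "circle_mean (\<lambda>t. \<i> * of_real (of_int k) * cis (of_int k * t)) = 0"
    by (intro circle_mean_deriv[of "\<lambda>t. cis (of_int k * t)"] has_vector_derivative_cis)
  then show ?thesis using False unfolding circle_mean_cmult by simp
qed simp

section \<open>Smooth functions on the circle\<close>

text \<open>A class of periodic functions that contains a derivative of each of its members produces
  the whole sequence of derivatives by dependent choice. No formula for higher derivatives is ever
  required.\<close>

lemma smooth_circle_coinduct: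
  assumes "P f"
    and "\<And>f. P f \<Longrightarrow> (\<forall>\<theta>. f (\<theta> + 2 * pi) = f \<theta>) \<and>
      (\<exists>f'. P f' \<and> (\<forall>\<theta>. (f has_vector_derivative f' \<theta>) (at \<theta>)))"
  shows "f \<in> smooth_circle"
proof -
  have "\<exists>D. \<forall>n. (P (D n) \<and> (n = 0 \<longrightarrow> D n = f)) \<and>
      (\<forall>\<theta>. (D n has_vector_derivative D (Suc n) \<theta>) (at \<theta>))"
    by (rule dependent_nat_choice) (use assms in auto)
  then show ?thesis using assms unfolding smooth_circle_def by blast
qed

lemma derivative_periodic:
  fixes f f' :: "real \<Rightarrow> complex"
  assumes "\<And>\<theta>. f (\<theta> + 2 * pi) = f \<theta>" "\<And>\<theta>. (f has_vector_derivative f' \<theta>) (at \<theta>)"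
  shows "f' (\<theta> + 2 * pi) = f' \<theta>"
proof -
  have "((\<lambda>t. t + 2 * pi) has_vector_derivative 1) (at \<theta>)"
    unfolding has_real_derivative_iff_has_vector_derivative[symmetric]
    by (auto intro!: derivative_eq_intros)
  then have "((\<lambda>t. f (t + 2 * pi)) has_vector_derivative f' (\<theta> + 2 * pi)) (at \<theta>)"
    using vector_diff_chain_at[of "\<lambda>t. t + 2 * pi" 1 \<theta> f "f' (\<theta> + 2 * pi)"] assms(2)
    by (simp add: o_def)
  then have "(f has_vector_derivative f' (\<theta> + 2 * pi)) (at \<theta>)" using assms(1) by simp
  then show ?thesis using assms(2) vector_derivative_unique_at by blast
qed

lemma smooth_circle_periodic: "f \<in> smooth_circle \<Longrightarrow> f (\<theta> + 2 * pi) = f \<theta>"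
  by (simp add: smooth_circle_def)

lemma smooth_circle_ddt:
  assumes "f \<in> smooth_circle"
  shows "(f has_vector_derivative ddt f \<theta>) (at \<theta>)" "ddt f \<in> smooth_circle"
proof -
  obtain D where D: "D 0 = f" "\<And>n \<theta>. (D n has_vector_derivative D (Suc n) \<theta>) (at \<theta>)"
    using assms by (auto simp: smooth_circle_def)
  have e: "ddt f = D 1"
    using D(2)[of 0] by (auto simp: ddt_def D(1) fun_eq_iff vector_derivative_at)
  show "(f has_vector_derivative ddt f \<theta>) (at \<theta>)" using D(2)[of 0] D(1) e by simp
  have "D 1 (\<theta> + 2 * pi) = D 1 \<theta>" for \<theta>
    by (rule derivative_periodic[of f]) (use D assms in \<open>auto simp: smooth_circle_def\<close>)
  then show "ddt f \<in> smooth_circle"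
    unfolding e smooth_circle_def using D(2) by (auto intro!: exI[of _ "\<lambda>n. D (Suc n)"])
qed

lemma ddt_eqI: "(\<And>\<theta>. (f has_vector_derivative f' \<theta>) (at \<theta>)) \<Longrightarrow> ddt f = f'"
  by (auto simp: ddt_def vector_derivative_at)

lemma smooth_circle_continuous: "f \<in> smooth_circle \<Longrightarrow> continuous_on A f"
  using smooth_circle_ddt(1) has_vector_derivative_continuous
  by (metis continuous_at_imp_continuous_on)

lemma smooth_circle_const: "(\<lambda>\<theta>. c) \<in> smooth_circle"
  by (rule smooth_circle_coinduct[of "\<lambda>f. \<exists>c. f = (\<lambda>\<theta>. c)"])
    (auto intro!: exI[of _ "\<lambda>_. 0"])

lemma smooth_circle_add:
  assumes "f \<in> smooth_circle" "g \<in> smooth_circle"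
  shows "(\<lambda>\<theta>. f \<theta> + g \<theta>) \<in> smooth_circle"
proof (rule smooth_circle_coinduct
    [of "\<lambda>h. \<exists>f\<in>smooth_circle. \<exists>g\<in>smooth_circle. h = (\<lambda>\<theta>. f \<theta> + g \<theta>)"])
  fix h assume "\<exists>f\<in>smooth_circle. \<exists>g\<in>smooth_circle. h = (\<lambda>\<theta>. f \<theta> + g \<theta>)"
  then obtain f g where fg: "f \<in> smooth_circle" "g \<in> smooth_circle" "h = (\<lambda>\<theta>. f \<theta> + g \<theta>)"
    by blast
  then show "(\<forall>\<theta>. h (\<theta> + 2 * pi) = h \<theta>) \<and> (\<exists>h'. (\<exists>f\<in>smooth_circle. \<exists>g\<in>smooth_circle.
      h' = (\<lambda>\<theta>. f \<theta> + g \<theta>)) \<and> (\<forall>\<theta>. (h has_vector_derivative h' \<theta>) (at \<theta>)))"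
    by (intro conjI exI[of _ "\<lambda>\<theta>. ddt f \<theta> + ddt g \<theta>"])
      (auto simp: smooth_circle_periodic intro!: has_vector_derivative_add smooth_circle_ddt)
qed (use assms in auto)

text \<open>Sums of products are closed under derivatives, so the coinduction goes through for them.\<close>

inductive circle_product :: "(real \<Rightarrow> complex) \<Rightarrow> bool" where
  "\<lbrakk>f \<in> smooth_circle; g \<in> smooth_circle\<rbrakk> \<Longrightarrow> circle_product (\<lambda>\<theta>. f \<theta> * g \<theta>)"
| "\<lbrakk>circle_product f; circle_product g\<rbrakk> \<Longrightarrow> circle_product (\<lambda>\<theta>. f \<theta> + g \<theta>)"

lemma ddt_product:
  assumes "f \<in> smooth_circle" "g \<in> smooth_circle"
  shows "((\<lambda>\<theta>. f \<theta> * g \<theta>) has_vector_derivative f \<theta> * ddt g \<theta> + ddt f \<theta> * g \<theta>) (at \<theta>)"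
  by (intro has_vector_derivative_mult smooth_circle_ddt assms)

lemma smooth_circle_mult:
  assumes "f \<in> smooth_circle" "g \<in> smooth_circle"
  shows "(\<lambda>\<theta>. f \<theta> * g \<theta>) \<in> smooth_circle"
proof (rule smooth_circle_coinduct[of circle_product])
  show "circle_product (\<lambda>\<theta>. f \<theta> * g \<theta>)" by (rule circle_product.intros assms)+
next
  fix h assume "circle_product h"
  then show "(\<forall>\<theta>. h (\<theta> + 2 * pi) = h \<theta>) \<and> (\<exists>h'. circle_product h' \<and>
      (\<forall>\<theta>. (h has_vector_derivative h' \<theta>) (at \<theta>)))"
  proof induction
    case (1 f g)
    then show ?case
      by (intro conjI exI[of _ "\<lambda>\<theta>. f \<theta> * ddt g \<theta> + ddt f \<theta> * g \<theta>"] allI ddt_product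
          circle_product.intros smooth_circle_ddt) (auto simp: smooth_circle_periodic)
  next
    case (2 f g)
    then obtain f' g' where "circle_product f'" "circle_product g'"
        "\<forall>\<theta>. (f has_vector_derivative f' \<theta>) (at \<theta>)" "\<forall>\<theta>. (g has_vector_derivative g' \<theta>) (at \<theta>)"
      by blast
    with 2 show ?case
      by (intro conjI exI[of _ "\<lambda>\<theta>. f' \<theta> + g' \<theta>"])
        (auto intro!: circle_product.intros has_vector_derivative_add)
  qed
qed

lemma smooth_circle_cmult:
  "f \<in> smooth_circle \<Longrightarrow> (\<lambda>\<theta>. c * f \<theta>) \<in> smooth_circle"
  using smooth_circle_mult[OF smooth_circle_const] .

lemma ddt_mult:
  assumes "f \<in> smooth_circle" "g \<in> smooth_circle"
  shows "ddt (\<lambda>\<theta>. f \<theta> * g \<theta>) = (\<lambda>\<theta>. f \<theta> * ddt g \<theta> + ddt f \<theta> * g \<theta>)"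
  by (rule ddt_eqI) (rule ddt_product[OF assms])

lemma ddt_add:
  assumes "f \<in> smooth_circle" "g \<in> smooth_circle"
  shows "ddt (\<lambda>\<theta>. f \<theta> + g \<theta>) = (\<lambda>\<theta>. ddt f \<theta> + ddt g \<theta>)"
  by (intro ddt_eqI has_vector_derivative_add smooth_circle_ddt assms)

lemma ddt_const: "ddt (\<lambda>\<theta>. c) = (\<lambda>\<theta>. 0)"
  by (intro ddt_eqI) simp

lemma ddt_cmult:
  assumes "f \<in> smooth_circle"
  shows "ddt (\<lambda>\<theta>. c * f \<theta>) = (\<lambda>\<theta>. c * ddt f \<theta>)"
  by (simp add: ddt_mult smooth_circle_const assms ddt_const)

section \<open>Fourier coefficients\<close>

lemma continuous_fourier [continuous_intros]:
  "continuous_on A f \<Longrightarrow> continuous_on A (\<lambda>\<theta>. f \<theta> * cis (- (of_int k * \<theta>)))"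
  by (intro continuous_intros)

lemma fourier_coeff_add:
  assumes "continuous_on UNIV f" "continuous_on UNIV g"
  shows "fourier_coeff (\<lambda>\<theta>. f \<theta> + g \<theta>) k = fourier_coeff f k + fourier_coeff g k"
  unfolding fourier_coeff_def ring_distribs
  by (intro circle_mean_add continuous_fourier assms)

lemma fourier_coeff_cmult: "fourier_coeff (\<lambda>\<theta>. c * f \<theta>) k = c * fourier_coeff f k"
  by (simp add: fourier_coeff_def circle_mean_cmult mult.assoc)

lemma fourier_coeff_const: "fourier_coeff (\<lambda>\<theta>. c) k = (if k = 0 then c else 0)"
  using circle_mean_cis[of "- k"] by (simp add: fourier_coeff_def circle_mean_cmult)

lemma fourier_coeff_0: "fourier_coeff f 0 = circle_mean f"
  by (simp add: fourier_coeff_def)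

text \<open>Integration by parts: f(\<theta>) e^(-ik\<theta>) takes the same value at 0 and 2\<pi>,
  so its derivative has mean 0.\<close>

lemma fourier_coeff_ddt:
  assumes "f \<in> smooth_circle"
  shows "fourier_coeff (ddt f) k = \<i> * of_int k * fourier_coeff f k"
proof -
  let ?e = "\<lambda>\<theta>. cis (- of_int k * \<theta>)"
  have cf: "continuous_on UNIV f" "continuous_on UNIV (ddt f)"
    using assms by (auto intro: smooth_circle_continuous smooth_circle_ddt)
  have d: "((\<lambda>\<theta>. f \<theta> * ?e \<theta>) has_vector_derivative
      f \<theta> * (\<i> * of_real (- of_int k) * ?e \<theta>) + ddt f \<theta> * ?e \<theta>) (at \<theta>)" for \<theta>
    by (intro has_vector_derivative_mult smooth_circle_ddt assms has_vector_derivative_cis)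
  have "circle_mean (\<lambda>\<theta>. f \<theta> * (\<i> * of_real (- of_int k) * ?e \<theta>) + ddt f \<theta> * ?e \<theta>) = 0"
  proof (rule circle_mean_deriv[OF d])
    have "cis (2 * pi * of_int k) = 1" by (intro cis_multiple_2pi) auto
    then have "?e (2 * pi) = 1"
      by (metis (no_types, lifting) cis_inverse inverse_1 mult.commute mult_minus_left)
    then show "f (2 * pi) * ?e (2 * pi) = f 0 * ?e 0"
      using smooth_circle_periodic[OF assms, of 0] by simp
  qed
  moreover have "(\<lambda>\<theta>. f \<theta> * (\<i> * of_real (- of_int k) * ?e \<theta>) + ddt f \<theta> * ?e \<theta>)
     = (\<lambda>\<theta>. (- (\<i> * of_int k)) * (f \<theta> * ?e \<theta>) + ddt f \<theta> * ?e \<theta>)"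
    by (simp add: algebra_simps)
  moreover have "circle_mean (\<lambda>\<theta>. (- (\<i> * of_int k)) * (f \<theta> * ?e \<theta>) + ddt f \<theta> * ?e \<theta>)
     = - (\<i> * of_int k) * fourier_coeff f k + fourier_coeff (ddt f) k"
    using circle_mean_cmult[of "- (\<i> * of_int k)" "\<lambda>\<theta>. f \<theta> * ?e \<theta>"] cf
      circle_mean_add[of "\<lambda>\<theta>. (- (\<i> * of_int k)) * (f \<theta> * ?e \<theta>)" "\<lambda>\<theta>. ddt f \<theta> * ?e \<theta>"]
    by (simp add: fourier_coeff_def continuous_intros)
  ultimately show ?thesis by simp
qed

text \<open>One more power costs one derivative: (1 + |k|) |f_k| is the sum of the absolute values
  of the k-th coefficients of f and f'. Hence the induction runs with f arbitrary.\<close>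

lemma fourier_coeff_decay:
  assumes "f \<in> smooth_circle"
  shows "\<exists>C. \<forall>k. (1 + \<bar>of_int k\<bar>) ^ m * cmod (fourier_coeff f k) \<le> C"
  using assms
proof (induction m arbitrary: f)
  case 0
  then obtain B where B: "\<And>\<theta>. cmod (f \<theta>) \<le> B"
    using periodic_bounded[of f] smooth_circle_periodic smooth_circle_continuous by metis
  have "cmod (fourier_coeff f k) \<le> B" for k
    unfolding fourier_coeff_def
    by (rule circle_mean_bound)
      (intro continuous_fourier smooth_circle_continuous 0, simp add: norm_mult B)
  then show ?case by auto
next
  case (Suc m)
  obtain C where C: "\<And>k. (1 + \<bar>of_int k\<bar>) ^ m * cmod (fourier_coeff f k) \<le> C"
    using Suc by blast
  obtain C' where C': "\<And>k. (1 + \<bar>of_int k\<bar>) ^ m * cmod (fourier_coeff (ddt f) k) \<le> C'"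
    using Suc smooth_circle_ddt(2) by blast
  have "(1 + \<bar>of_int k\<bar>) ^ Suc m * cmod (fourier_coeff f k) \<le> C + C'" for k
    using C[of k] C'[of k] Suc.prems
    by (simp add: fourier_coeff_ddt norm_mult algebra_simps)
  then show ?case by blast
qed

lemma fourier_coeff_le_inv_sq:
  assumes "f \<in> smooth_circle"
  obtains C where "0 \<le> C" "\<And>k. cmod (fourier_coeff f k) \<le> C * inv_sq k"
proof -
  obtain C where C: "\<And>k. (1 + \<bar>of_int k\<bar>)\<^sup>2 * cmod (fourier_coeff f k) \<le> C"
    using fourier_coeff_decay[OF assms] by blast
  have "0 \<le> C" using order_trans[OF _ C[of 0]] by simp
  moreover have "cmod (fourier_coeff f k) \<le> C * inv_sq k" for k
    using C[of k] by (simp add: inv_sq_def field_simps add_nonneg_eq_0_iff)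
  ultimately show ?thesis by (rule that)
qed

lemma fourier_coeff_summable:
  assumes "f \<in> smooth_circle"
  shows "(\<lambda>k. cmod (fourier_coeff f k)) summable_on A"
proof -
  obtain C where C: "\<And>k. cmod (fourier_coeff f k) \<le> C * inv_sq k"
    using fourier_coeff_le_inv_sq[OF assms] by blast
  show ?thesis
    by (rule summable_on_comparison_test[of "\<lambda>k. C * inv_sq k"])
      (auto intro!: summable_on_cmult_right inv_sq_summable C)
qed

text \<open>The mean of |g - P|^2 is nonnegative for the partial sum P of the Fourier series over K.
  The two mixed means and the mean of |P|^2 all equal \<open>S\<close>, so the expansion leaves the
  mean of |g|^2 minus \<open>S\<close>. Only continuity of g is assumed, because g will be a
  difference quotient.\<close>

lemma Bessel_inequality:
  fixes g :: "real \<Rightarrow> complex"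
  assumes g: "continuous_on UNIV g" and K: "finite K"
  shows "(\<Sum>k\<in>K. (cmod (fourier_coeff g k))\<^sup>2) \<le> Re (circle_mean (\<lambda>\<theta>. g \<theta> * cnj (g \<theta>)))"
proof -
  let ?c = "fourier_coeff g"
  define P where "P = (\<lambda>\<theta>. \<Sum>k\<in>K. ?c k * cis (of_int k * \<theta>))"
  have P: "continuous_on UNIV P" unfolding P_def by (intro continuous_intros)
  have cnjP: "cnj (P \<theta>) = (\<Sum>k\<in>K. cnj (?c k) * cis (- (of_int k * \<theta>)))" for \<theta>
    by (simp add: P_def cis_cnj)
  have pair: "circle_mean (\<lambda>\<theta>. h \<theta> * cnj (P \<theta>)) = (\<Sum>k\<in>K. cnj (?c k) * fourier_coeff h k)"
    if "continuous_on UNIV h" for h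
  proof -
    have "(\<lambda>\<theta>. h \<theta> * cnj (P \<theta>))
        = (\<lambda>\<theta>. \<Sum>k\<in>K. cnj (?c k) * (h \<theta> * cis (- (of_int k * \<theta>))))"
      by (simp add: cnjP sum_distrib_left ac_simps)
    then have "circle_mean (\<lambda>\<theta>. h \<theta> * cnj (P \<theta>))
        = (\<Sum>k\<in>K. circle_mean (\<lambda>\<theta>. cnj (?c k) * (h \<theta> * cis (- (of_int k * \<theta>)))))"
      using that K by (auto intro!: circle_mean_sum continuous_intros)
    then show ?thesis by (simp add: circle_mean_cmult fourier_coeff_def)
  qed
  have cP: "fourier_coeff P k = ?c k" if "k \<in> K" for k
  proof -
    have "fourier_coeff P k = circle_mean (\<lambda>\<theta>. \<Sum>j\<in>K. ?c j * cis (of_int (j - k) * \<theta>))"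
      unfolding fourier_coeff_def P_def sum_distrib_right mult.assoc cis_mult
      by (simp add: algebra_simps)
    also have "\<dots> = (\<Sum>j\<in>K. circle_mean (\<lambda>\<theta>. ?c j * cis (of_int (j - k) * \<theta>)))"
      using K by (intro circle_mean_sum continuous_intros)
    also have "\<dots> = (\<Sum>j\<in>K. if j = k then ?c j else 0)"
      unfolding circle_mean_cmult circle_mean_cis by (intro sum.cong) auto
    finally show ?thesis using that K by simp
  qed
  define S where "S = (\<Sum>k\<in>K. cnj (?c k) * ?c k)"
  have S: "S = of_real (\<Sum>k\<in>K. (cmod (?c k))\<^sup>2)"
    unfolding S_def by (simp add: complex_norm_square[symmetric] mult.commute)
  have m1: "circle_mean (\<lambda>\<theta>. g \<theta> * cnj (P \<theta>)) = S"
    using pair[OF g] by (simp add: S_def)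
  have m2: "circle_mean (\<lambda>\<theta>. P \<theta> * cnj (P \<theta>)) = S"
    using pair[OF P] cP by (simp add: S_def)
  have m3: "circle_mean (\<lambda>\<theta>. P \<theta> * cnj (g \<theta>)) = S"
    using circle_mean_cnj[of "\<lambda>\<theta>. g \<theta> * cnj (P \<theta>)"] m1 g P S
    by (simp add: mult.commute continuous_intros)
  let ?h = "\<lambda>\<theta>. g \<theta> - P \<theta>"
  have "(\<lambda>\<theta>. ?h \<theta> * cnj (?h \<theta>)) = (\<lambda>\<theta>. (g \<theta> * cnj (g \<theta>) - g \<theta> * cnj (P \<theta>))
      - (P \<theta> * cnj (g \<theta>) - P \<theta> * cnj (P \<theta>)))"
    by (simp add: algebra_simps)
  then have "circle_mean (\<lambda>\<theta>. ?h \<theta> * cnj (?h \<theta>)) = circle_mean (\<lambda>\<theta>. g \<theta> * cnj (g \<theta>)) - S"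
    using g P by (simp add: circle_mean_diff continuous_intros m1 m2 m3)
  moreover have "0 \<le> Re (circle_mean (\<lambda>\<theta>. ?h \<theta> * cnj (?h \<theta>)))"
  proof -
    let ?u = "\<lambda>\<theta>. ?h \<theta> * cnj (?h \<theta>)"
    have u: "?u integrable_on {0..2*pi}"
      by (rule integrable_circle) (intro continuous_intros g P)
    have "Re (integral {0..2*pi} ?u) = integral {0..2*pi} (\<lambda>\<theta>. Re (?u \<theta>))"
      using integral_linear[OF u bounded_linear_Re] by (simp add: o_def)
    also have "\<dots> \<ge> 0"
      using integrable_linear[OF u bounded_linear_Re]
      by (intro integral_nonneg) (simp_all only: o_def complex_norm_square[symmetric] Re_complex_of_real, auto)
    finally show ?thesis by (simp add: circle_mean_def Re_divide_of_real)
  qed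
  ultimately show ?thesis by (simp add: S)
qed

text \<open>By Bessel the squares of the coefficients are summable over all integers, so they tend
  to 0 along every injective sequence of indices.\<close>

lemma Riemann_Lebesgue:
  assumes "continuous_on UNIV g"
  shows "(\<lambda>n. fourier_coeff g (int n)) \<longlonglongrightarrow> 0" "(\<lambda>n. fourier_coeff g (- int n)) \<longlonglongrightarrow> 0"
proof -
  have "(\<lambda>k. (cmod (fourier_coeff g k))\<^sup>2) summable_on UNIV"
    by (rule nonneg_bdd_above_summable_on)
      (auto intro!: bdd_aboveI2 Bessel_inequality[OF assms])
  then have s: "(\<lambda>k. (cmod (fourier_coeff g k))\<^sup>2) summable_on A" for A
    by (rule summable_on_subset) simp
  have *: "(\<lambda>n. fourier_coeff g (h n)) \<longlonglongrightarrow> 0" if "inj h" for h :: "nat \<Rightarrow> int"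
  proof -
    have "(\<lambda>n. (cmod (fourier_coeff g (h n)))\<^sup>2) summable_on UNIV"
      using s[of "range h"] that by (subst (asm) summable_on_reindex) (auto simp: o_def)
    then have "(\<lambda>n. (cmod (fourier_coeff g (h n)))\<^sup>2) \<longlonglongrightarrow> 0"
      by (intro summable_LIMSEQ_zero summable_on_imp_summable)
    then have "(\<lambda>n. sqrt ((cmod (fourier_coeff g (h n)))\<^sup>2)) \<longlonglongrightarrow> sqrt 0"
      by (rule tendsto_real_sqrt)
    then show ?thesis by (simp add: tendsto_norm_zero_iff)
  qed
  show "(\<lambda>n. fourier_coeff g (int n)) \<longlonglongrightarrow> 0" by (rule *) simp
  show "(\<lambda>n. fourier_coeff g (- int n)) \<longlonglongrightarrow> 0" by (rule *) (simp add: inj_on_def)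
qed

section \<open>Pointwise convergence of Fourier series\<close>

lemma has_vector_derivative_iff_quotient:
  fixes f :: "real \<Rightarrow> complex"
  shows "(f has_vector_derivative D) (at t) \<longleftrightarrow>
    ((\<lambda>h. (f (t + h) - f t) / of_real h) \<longlongrightarrow> D) (at 0)"
proof -
  have "(f has_vector_derivative D) (at t) \<longleftrightarrow>
      ((\<lambda>h. norm (f (t + h) - f t - h *\<^sub>R D) / norm h) \<longlongrightarrow> 0) (at 0)"
    by (simp add: has_vector_derivative_def has_derivative_at bounded_linear_scaleR_left)
  also have "\<dots> \<longleftrightarrow> ((\<lambda>h. norm ((f (t + h) - f t) / of_real h - D)) \<longlongrightarrow> 0) (at 0)"
  proof (rule filterlim_cong[OF refl refl], rule eventually_at_filter[THEN iffD2], intro always_eventually allI impI)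
    fix h :: real assume "h \<noteq> 0"
    then have "(f (t + h) - f t) / of_real h - D = (f (t + h) - f t - h *\<^sub>R D) / of_real h"
      by (simp add: field_simps scaleR_conv_of_real)
    then show "norm (f (t + h) - f t - h *\<^sub>R D) / norm h = norm ((f (t + h) - f t) / of_real h - D)"
      by (simp add: norm_divide)
  qed
  also have "\<dots> \<longleftrightarrow> ((\<lambda>h. (f (t + h) - f t) / of_real h) \<longlongrightarrow> D) (at 0)"
    unfolding tendsto_norm_zero_iff by (rule LIM_zero_iff)
  finally show ?thesis .
qed

text \<open>Periodic functions factor through the circle. This controls f and f' at every zero of
  e^(it) - e^(i\<theta>), that is, at all translates of \<theta> by multiples of 2\<pi>.\<close>

lemma cis_eq_periodic:
  assumes "cis a = cis b" "\<And>\<theta>. f (\<theta> + 2 * pi) = f \<theta>"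
  shows "f a = f b"
proof -
  interpret periodic_fun_simple f "2 * pi" by unfold_locales (rule assms)
  obtain n :: int where "a = b + 2 * pi * n"
    using assms(1) sin_cos_eq_iff[of a b] by (auto simp: complex_eq_iff)
  then show ?thesis using plus_of_int[of b n] by (simp add: mult.commute)
qed

lemma sum_telescope_int:
  fixes h :: "int \<Rightarrow> 'a::ab_group_add"
  shows "(\<Sum>k=-int N..int N. h k - h (k + 1)) = h (- int N) - h (int N + 1)"
proof (induction N)
  case (Suc N)
  have "{- int (Suc N)..int (Suc N)} = insert (- int (Suc N)) (insert (int (Suc N)) {- int N..int N})"
    by auto
  then show ?case using Suc by (simp add: algebra_simps)
qed simp

text \<open>Dividing \<open>f - f \<theta>\<^sub>0\<close> by \<open>e\<^sup>i\<^sup>\<theta> - e\<^sup>i\<^sup>\<theta>\<^sup>0\<close> makes the partial sums of the Fourier series at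
  \<open>\<theta>\<^sub>0\<close> telescope.\<close>

lemma fourier_inversion:
  assumes f: "f \<in> smooth_circle"
  shows "((\<lambda>k. fourier_coeff f k * cis (of_int k * \<theta>)) has_sum f \<theta>) UNIV"
proof -
  define w where "w = cis \<theta>"
  \<comment> \<open>The value at the zeros of the denominator is the limit of the quotient there:
    the derivative of the numerator over i w, the derivative of \<open>cis\<close>. It makes g
    continuous.\<close>
  define g where "g = (\<lambda>t. if cis t = w then ddt f \<theta> / (\<i> * w) else (f t - f \<theta>) / (cis t - w))"
  have w: "w \<noteq> 0" by (simp add: w_def)
  have fw: "f t = f \<theta>" "ddt f t = ddt f \<theta>" if "cis t = w" for t
    using that f by (auto simp: w_def intro!: cis_eq_periodic smooth_circle_periodic smooth_circle_ddt)
  have eq: "(cis t - w) * g t = f t - f \<theta>" for t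
    using fw(1) by (simp add: g_def)
  have cont: "isCont g t" for t
  proof (cases "cis t = w")
    case False
    have "((\<lambda>s. cis s) \<longlongrightarrow> cis t) (at t)"
      using continuous_cis[of UNIV "\<lambda>s. s"] by (simp add: continuous_on_def)
    then have ne: "\<forall>\<^sub>F s in at t. cis s \<noteq> w" by (rule tendsto_imp_eventually_ne[OF _ False])
    have "isCont f t" "isCont cis t"
      using smooth_circle_continuous[OF f, of UNIV] continuous_cis[of UNIV "\<lambda>s. s"]
      by (auto simp: continuous_on_eq_continuous_at)
    then have "((\<lambda>s. (f s - f \<theta>) / (cis s - w)) \<longlongrightarrow> (f t - f \<theta>) / (cis t - w)) (at t)"
      using False by (intro tendsto_intros) (auto simp: isCont_def)
    then have "(g \<longlongrightarrow> (f t - f \<theta>) / (cis t - w)) (at t)"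
      by (rule Lim_transform_eventually) (rule eventually_mono[OF ne], simp add: g_def)
    then show ?thesis using False by (simp add: isCont_def g_def)
  next
    case True
    have d1: "((\<lambda>h. (f (t + h) - f t) / of_real h) \<longlongrightarrow> ddt f \<theta>) (at 0)"
      using smooth_circle_ddt(1)[OF f, of t] fw(2)[OF True]
      by (simp add: has_vector_derivative_iff_quotient)
    have d2: "((\<lambda>h. (cis (t + h) - cis t) / of_real h) \<longlongrightarrow> \<i> * w) (at 0)"
      using has_vector_derivative_cis[of 1 t] True
      by (simp add: has_vector_derivative_iff_quotient)
    have ne: "\<forall>\<^sub>F h in at 0. (cis (t + h) - cis t) / of_real h \<noteq> 0"
      by (rule tendsto_imp_eventually_ne[OF d2]) (simp add: w)
    have "((\<lambda>h. ((f (t + h) - f t) / of_real h) / ((cis (t + h) - cis t) / of_real h))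
        \<longlongrightarrow> ddt f \<theta> / (\<i> * w)) (at 0)"
      by (intro tendsto_divide d1 d2) (simp add: w)
    moreover have "\<forall>\<^sub>F h in at 0. ((f (t + h) - f t) / of_real h) / ((cis (t + h) - cis t) / of_real h) = g (t + h)"
      by (rule eventually_mono[OF ne]) (simp add: g_def True fw(1)[OF True] split: if_splits)
    ultimately have "((\<lambda>h. g (t + h)) \<longlongrightarrow> ddt f \<theta> / (\<i> * w)) (at 0)"
      by (rule Lim_transform_eventually)
    moreover have "g t = ddt f \<theta> / (\<i> * w)" by (simp add: g_def True)
    ultimately have "((\<lambda>h. g (t + h)) \<longlongrightarrow> g t) (at 0)" by simp
    then show ?thesis by (simp add: isCont_iff)
  qed
  then have g: "continuous_on UNIV g" by (simp add: continuous_on_eq_continuous_at)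
  \<comment> \<open>Coefficientwise form of f - f(\<theta>) = (u - w) g: multiplication by u shifts
    the index by one, and the constant f(\<theta>) is seen only at k = 0.\<close>
  have rec: "fourier_coeff f k - (if k = 0 then f \<theta> else 0)
      = fourier_coeff g (k - 1) - w * fourier_coeff g k" for k
  proof -
    have "fourier_coeff f k - (if k = 0 then f \<theta> else 0) = fourier_coeff f k + fourier_coeff (\<lambda>_. - f \<theta>) k"
      by (simp add: fourier_coeff_const)
    also have "\<dots> = fourier_coeff (\<lambda>t. f t - f \<theta>) k"
      using smooth_circle_continuous[OF f] by (subst fourier_coeff_add[symmetric]) auto
    also have "\<dots> = circle_mean (\<lambda>t. g t * cis (- (of_int (k - 1) * t))
         - w * (g t * cis (- (of_int k * t))))"
    proof -
      have "cis t * cis (- (of_int k * t)) = cis (- (of_int (k - 1) * t))" for t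
        by (simp add: cis_mult algebra_simps)
      then have "(f t - f \<theta>) * cis (- (of_int k * t)) = g t * cis (- (of_int (k - 1) * t))
         - w * (g t * cis (- (of_int k * t)))" for t
        by (simp only: eq[symmetric] left_diff_distrib) (simp add: mult.left_commute mult.assoc mult.commute[of "g t"])
      then show ?thesis unfolding fourier_coeff_def by simp
    qed
    also have "\<dots> = fourier_coeff g (k - 1) - w * fourier_coeff g k"
      unfolding fourier_coeff_def
      by (subst circle_mean_diff) (use g in \<open>auto intro!: continuous_intros simp: circle_mean_cmult\<close>)
    finally show ?thesis .
  qed
  let ?a = "\<lambda>k. fourier_coeff f k * cis (of_int k * \<theta>)"
  \<comment> \<open>Multiplying the recursion by w^k turns it into a difference h(k) - h(k + 1). The
    index \<open>k + 1 - 1\<close> is left as it is to display this shape for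
    \<open>sum_telescope_int\<close>.\<close>
  have "?a k - (if k = 0 then f \<theta> else 0) = cis (of_int k * \<theta>) * fourier_coeff g (k - 1)
      - cis (of_int (k + 1) * \<theta>) * fourier_coeff g (k + 1 - 1)" for k
  proof -
    have "?a k - (if k = 0 then f \<theta> else 0)
        = cis (of_int k * \<theta>) * (fourier_coeff f k - (if k = 0 then f \<theta> else 0))"
      by (simp add: algebra_simps)
    moreover have "cis (of_int (k + 1) * \<theta>) = cis (of_int k * \<theta>) * w"
      by (simp add: w_def cis_mult algebra_simps)
    ultimately show ?thesis by (simp add: rec right_diff_distrib mult.assoc)
  qed
  note step = this
  have part: "(\<Sum>k=-int N..int N. ?a k) - f \<theta>
      = cis (of_int (- int N) * \<theta>) * fourier_coeff g (- int N - 1)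
        - cis (of_int (int N + 1) * \<theta>) * fourier_coeff g (int N + 1 - 1)" for N
  proof -
    have "(\<Sum>k=-int N..int N. ?a k) - f \<theta> = (\<Sum>k=-int N..int N. ?a k - (if k = 0 then f \<theta> else 0))"
      unfolding sum_subtractf by simp
    then show ?thesis
      unfolding step sum_telescope_int[of "\<lambda>k. cis (of_int k * \<theta>) * fourier_coeff g (k - 1)" N] .
  qed
  have b: "cmod ((\<Sum>k=-int N..int N. ?a k) - f \<theta>)
      \<le> cmod (fourier_coeff g (- int (Suc N))) + cmod (fourier_coeff g (int N))" for N
  proof -
    have "- int N - 1 = - int (Suc N)" "int N + 1 - 1 = int N" by simp_all
    then show ?thesis
      unfolding part using norm_triangle_ineq4 by (metis norm_mult norm_cis mult_1)
  qed
  have "(\<lambda>N. cmod (fourier_coeff g (- int (Suc N))) + cmod (fourier_coeff g (int N))) \<longlonglongrightarrow> 0 + 0"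
    by (rule tendsto_add[OF tendsto_norm_zero[OF LIMSEQ_Suc[OF Riemann_Lebesgue(2)[OF g]]]
        tendsto_norm_zero[OF Riemann_Lebesgue(1)[OF g]]])
  then have "(\<lambda>N. (\<Sum>k=-int N..int N. ?a k) - f \<theta>) \<longlonglongrightarrow> 0"
    by (intro Lim_null_comparison[OF always_eventually[OF allI[OF b]]]) (simp only: add_0_left)
  then have l1: "(\<lambda>N. \<Sum>k=-int N..int N. ?a k) \<longlonglongrightarrow> f \<theta>"
    by (simp add: LIM_zero_iff)
  \<comment> \<open>Telescoping only treats symmetric partial sums. Absolute summability supplies an
    unordered sum, and since the symmetric intervals exhaust the integers both limits agree.\<close>
  have "?a summable_on UNIV"
    by (rule abs_summable_summable)
      (use fourier_coeff_summable[OF f] in \<open>simp add: norm_mult\<close>)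
  then have hs: "(?a has_sum infsum ?a UNIV) UNIV" by (rule has_sum_infsum)
  have "filterlim (\<lambda>N. {-int N..int N}) (finite_subsets_at_top UNIV) sequentially"
    unfolding filterlim_finite_subsets_at_top
  proof safe
    fix X :: "int set" assume "finite X"
    then have M: "\<And>k. k \<in> X \<Longrightarrow> \<bar>k\<bar> \<le> Max (abs ` X)" by simp
    show "\<forall>\<^sub>F N in sequentially. finite {-int N..int N} \<and> X \<subseteq> {-int N..int N} \<and> {-int N..int N} \<subseteq> UNIV"
      using eventually_ge_at_top[of "nat (Max (abs ` X))"]
      by eventually_elim (use M in force)
  qed
  then have "(\<lambda>N. \<Sum>k=-int N..int N. ?a k) \<longlonglongrightarrow> infsum ?a UNIV"
    using hs unfolding has_sum_def by (rule filterlim_compose[rotated])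
  then have "infsum ?a UNIV = f \<theta>" by (rule LIMSEQ_unique[OF _ l1])
  then show ?thesis using hs by simp
qed

lemma fourier_coeff_inject:
  assumes "f \<in> smooth_circle" "g \<in> smooth_circle" "\<And>k. fourier_coeff f k = fourier_coeff g k"
  shows "f = g"
proof
  fix \<theta>
  show "f \<theta> = g \<theta>"
    using fourier_inversion[OF assms(1), of \<theta>] fourier_inversion[OF assms(2), of \<theta>]
    by (simp add: assms(3) has_sum_unique)
qed

text \<open>The Fourier series of f is inserted into the mean of f g e^(-in\<theta>) and integrated
  termwise; boundedness of g and absolute summability of the coefficients of f give the
  majorant.\<close>

lemma fourier_coeff_mult:
  assumes f: "f \<in> smooth_circle" and g: "g \<in> smooth_circle"
  shows "((\<lambda>k. fourier_coeff f k * fourier_coeff g (n - k)) has_sum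
     fourier_coeff (\<lambda>\<theta>. f \<theta> * g \<theta>) n) UNIV"
proof -
  let ?F = "\<lambda>k \<theta>. fourier_coeff f k * (g \<theta> * cis (- (of_int (n - k) * \<theta>)))"
  have gc: "continuous_on UNIV g" by (rule smooth_circle_continuous[OF g])
  obtain B where B: "\<And>\<theta>. cmod (g \<theta>) \<le> B"
    using periodic_bounded[of g] smooth_circle_periodic[OF g] gc by metis
  have "((\<lambda>k. circle_mean (?F k)) has_sum circle_mean (\<lambda>\<theta>. \<Sum>\<^sub>\<infinity>k. ?F k \<theta>)) UNIV"
    by (rule circle_mean_infsum[of _ "\<lambda>k. cmod (fourier_coeff f k) * B"])
      (auto intro!: continuous_intros gc mult_left_mono B summable_on_cmult_left
        fourier_coeff_summable[OF f] simp: norm_mult)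
  moreover have "circle_mean (?F k) = fourier_coeff f k * fourier_coeff g (n - k)" for k
    by (simp add: circle_mean_cmult fourier_coeff_def)
  moreover have "(\<Sum>\<^sub>\<infinity>k. ?F k \<theta>) = f \<theta> * g \<theta> * cis (- (of_int n * \<theta>))" for \<theta>
  proof -
    have "?F k \<theta> = fourier_coeff f k * cis (of_int k * \<theta>) * (g \<theta> * cis (- (of_int n * \<theta>)))" for k
      by (simp add: algebra_simps cis_mult flip: cis_divide)
    then have "(\<Sum>\<^sub>\<infinity>k. ?F k \<theta>)
        = (\<Sum>\<^sub>\<infinity>k. fourier_coeff f k * cis (of_int k * \<theta>)) * (g \<theta> * cis (- (of_int n * \<theta>)))"
      by (simp only: infsum_cmult_left')
    then show ?thesis using infsumI[OF fourier_inversion[OF f, of \<theta>]] by simp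
  qed
  ultimately show ?thesis by (simp add: fourier_coeff_def)
qed

section \<open>Matrices with summable decay off the diagonal\<close>

lemma inv_sq_minus: "inv_sq (- j) = inv_sq j" "inv_sq (j - k) = inv_sq (k - j)"
  by (simp_all add: inv_sq_def abs_minus_commute)

lemma inv_sq_le_1: "inv_sq j \<le> 1"
  by (simp add: inv_sq_def field_simps)

lemma inv_sq_nat:
  shows "(\<lambda>z. inv_sq (int x - int z)) summable_on UNIV"
    and "(\<Sum>\<^sub>\<infinity>z. inv_sq (int x - int z)) \<le> inv_sq_total"
proof -
  have inj: "inj (\<lambda>z. int x - int z)" by (simp add: inj_on_def)
  show "(\<lambda>z. inv_sq (int x - int z)) summable_on UNIV"
    using summable_on_reindex[OF inj, of inv_sq] inv_sq_summable by (simp add: o_def)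
  have "(\<Sum>\<^sub>\<infinity>z. inv_sq (int x - int z)) = infsum inv_sq (range (\<lambda>z. int x - int z))"
    using infsum_reindex[OF inj, of inv_sq] by (simp add: o_def)
  also have "\<dots> \<le> inv_sq_total"
    unfolding inv_sq_total_def
    by (rule infsum_mono2) (auto simp: inv_sq_summable inv_sq_nonneg)
  finally show "(\<Sum>\<^sub>\<infinity>z. inv_sq (int x - int z)) \<le> inv_sq_total" .
qed

text \<open>The recurring comparison. With x a row index it sums along a row of a matrix with decay
  off the diagonal; with x = 0 it sums a sequence that decays at infinity.\<close>

lemma infsum_le_inv_sq_total:
  fixes f :: "nat \<Rightarrow> complex"
  assumes "\<And>z. cmod (f z) \<le> C * inv_sq (int x - int z)"
  shows "(\<lambda>z. cmod (f z)) summable_on UNIV" "f summable_on UNIV" "cmod (infsum f UNIV) \<le> C * inv_sq_total"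
    "(\<Sum>\<^sub>\<infinity>z. cmod (f z)) \<le> C * inv_sq_total"
proof -
  have "0 \<le> C * inv_sq (int x - int x)" by (rule order_trans[OF norm_ge_zero assms])
  then have C: "0 \<le> C" by (simp add: inv_sq_def)
  have s: "(\<lambda>z. C * inv_sq (int x - int z)) summable_on UNIV"
    by (intro summable_on_cmult_right inv_sq_nat)
  show 1: "(\<lambda>z. cmod (f z)) summable_on UNIV"
    by (rule summable_on_comparison_test[OF s]) (use assms in auto)
  then show "f summable_on UNIV" by (rule abs_summable_summable)
  have "(\<Sum>\<^sub>\<infinity>z. cmod (f z)) \<le> (\<Sum>\<^sub>\<infinity>z. C * inv_sq (int x - int z))"
    by (rule infsum_mono[OF 1 s assms])
  also have "\<dots> = C * (\<Sum>\<^sub>\<infinity>z. inv_sq (int x - int z))" by (rule infsum_cmult_right')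
  also have "\<dots> \<le> C * inv_sq_total" by (intro mult_left_mono inv_sq_nat C)
  finally show "(\<Sum>\<^sub>\<infinity>z. cmod (f z)) \<le> C * inv_sq_total" .
  with norm_infsum_bound[OF 1] show "cmod (infsum f UNIV) \<le> C * inv_sq_total" by (rule order_trans)
qed

text \<open>Not a finite band: quadratic decay away from the diagonal. This is enough to make the
  sums in matrix products absolutely convergent, so that distributivity and associativity can be
  proved for the bare matrices.\<close>

definition banded :: "mat \<Rightarrow> bool" where
  "banded M \<longleftrightarrow> (\<exists>C. \<forall>x y. cmod (M x y) \<le> C * inv_sq (int x - int y))"

lemma bandedE:
  assumes "banded M"
  obtains C where "0 \<le> C" "\<And>x y. cmod (M x y) \<le> C * inv_sq (int x - int y)" "\<And>x y. cmod (M x y) \<le> C"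
proof -
  obtain C where C: "\<And>x y. cmod (M x y) \<le> C * inv_sq (int x - int y)"
    using assms by (auto simp: banded_def)
  have "0 \<le> C * inv_sq (int 0 - int 0)" by (rule order_trans[OF norm_ge_zero C])
  then have "0 \<le> C" by (simp add: inv_sq_def)
  moreover from this have "cmod (M x y) \<le> C" for x y
    using C[of x y] mult_left_mono[OF inv_sq_le_1 \<open>0 \<le> C\<close>] by (metis mult.right_neutral order_trans)
  ultimately show ?thesis using C that by blast
qed

lemma mat_mult_summable:
  assumes "banded M" "banded N"
  shows "(\<lambda>z. cmod (M x z * N z y)) summable_on UNIV" "(\<lambda>z. M x z * N z y) summable_on UNIV"
proof -
  obtain C D where C: "\<And>x y. cmod (M x y) \<le> C * inv_sq (int x - int y)" and D: "\<And>x y. cmod (N x y) \<le> D"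
    by (metis assms bandedE)
  have "cmod (M x z * N z y) \<le> (C * D) * inv_sq (int x - int z)" for z
    using mult_mono[OF C[of x z] D[of z y]] order_trans[OF norm_ge_zero C[of x z]]
    by (simp add: norm_mult ac_simps)
  from infsum_le_inv_sq_total(1,2)[OF this]
  show "(\<lambda>z. cmod (M x z * N z y)) summable_on UNIV" "(\<lambda>z. M x z * N z y) summable_on UNIV" .
qed

lemma mat_mult_add_left:
  assumes "banded M" "banded M'" "banded N"
  shows "mat_mult (\<lambda>x y. M x y + M' x y) N = (\<lambda>x y. mat_mult M N x y + mat_mult M' N x y)"
  unfolding mat_mult_def ring_distribs
  by (intro ext infsum_add mat_mult_summable assms)

lemma mat_mult_add_right:
  assumes "banded M" "banded N" "banded N'"
  shows "mat_mult M (\<lambda>x y. N x y + N' x y) = (\<lambda>x y. mat_mult M N x y + mat_mult M N' x y)"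
  unfolding mat_mult_def ring_distribs
  by (intro ext infsum_add mat_mult_summable assms)

text \<open>Fubini for the double series over the intermediate indices u and v: the decay of M sums
  over v, that of L over u, and N enters only through a bound of its entries.\<close>

lemma mat_mult_assoc:
  assumes "banded L" "banded M" "banded N"
  shows "mat_mult (mat_mult L M) N = mat_mult L (mat_mult M N)"
proof (intro ext)
  fix x y
  obtain C D E where C: "0 \<le> C" "\<And>x y. cmod (L x y) \<le> C * inv_sq (int x - int y)"
      and D: "0 \<le> D" "\<And>x y. cmod (M x y) \<le> D * inv_sq (int x - int y)" "\<And>x y. cmod (M x y) \<le> D"
      and E: "0 \<le> E" "\<And>x y. cmod (N x y) \<le> E"
    by (metis assms bandedE)
  let ?f = "\<lambda>u v. L x u * M u v * N v y"
  have b: "cmod (?f u v) \<le> (C * inv_sq (int x - int u)) * (D * E) * inv_sq (int u - int v)" for u v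
  proof -
    have "cmod (?f u v) \<le> (C * inv_sq (int x - int u)) * (D * inv_sq (int u - int v)) * E"
      unfolding norm_mult by (intro mult_mono C D E mult_nonneg_nonneg inv_sq_nonneg norm_ge_zero)
    then show ?thesis by (simp add: ac_simps)
  qed
  have s: "(\<lambda>p. norm (case p of (u, v) \<Rightarrow> ?f u v)) summable_on (UNIV \<times> UNIV)"
  proof (rule iffD2[OF Infinite_Sum.abs_summable_on_Sigma_iff], intro conjI ballI)
    show "(\<lambda>v. norm (case (u, v) of (u, v) \<Rightarrow> ?f u v)) summable_on UNIV" for u
      using infsum_le_inv_sq_total(1)[OF b] by simp
    have "cmod (of_real (\<Sum>\<^sub>\<infinity>v. cmod (?f u v))) \<le> (C * (D * E) * inv_sq_total) * inv_sq (int x - int u)" for u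
      using infsum_le_inv_sq_total(4)[OF b, of u] infsum_nonneg[of UNIV "\<lambda>v. cmod (?f u v)"]
      by (simp add: ac_simps)
    from infsum_le_inv_sq_total(1)[OF this]
    show "(\<lambda>u. norm (\<Sum>\<^sub>\<infinity>v. norm (case (u, v) of (u, v) \<Rightarrow> ?f u v))) summable_on UNIV"
      by simp
  qed
  have "mat_mult (mat_mult L M) N x y = (\<Sum>\<^sub>\<infinity>v. \<Sum>\<^sub>\<infinity>u. ?f u v)"
    unfolding mat_mult_def by (simp flip: infsum_cmult_left')
  also have "\<dots> = (\<Sum>\<^sub>\<infinity>u. \<Sum>\<^sub>\<infinity>v. ?f u v)"
    by (rule infsum_swap_banach[symmetric]) (rule abs_summable_summable[OF s])
  also have "\<dots> = mat_mult L (mat_mult M N) x y"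
    unfolding mat_mult_def by (simp add: mult.assoc flip: infsum_cmult_right')
  finally show "mat_mult (mat_mult L M) N x y = mat_mult L (mat_mult M N) x y" .
qed

section \<open>Smooth fields of matrices\<close>

text \<open>Powers of \<open>wt_sum\<close> give the seminorms of \<open>rapid_decay\<close>. Powers
  of \<open>wt_diff\<close> measure decay away from the diagonal, the only decay that a Toeplitz
  matrix with smooth symbol has in general.\<close>

definition wt_sum :: "nat \<Rightarrow> nat \<Rightarrow> real" where "wt_sum x y = real (1 + x + y)"
definition wt_diff :: "nat \<Rightarrow> nat \<Rightarrow> real" where "wt_diff x y = 1 + \<bar>real x - real y\<bar>"

lemma wt_diff_ge_1: "1 \<le> wt_diff x y" by (simp add: wt_diff_def)
lemma wt_diff_nonneg: "0 \<le> wt_diff x y" by (simp add: wt_diff_def)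
lemma wt_diff_le_sum: "wt_diff x y \<le> wt_sum x y" by (auto simp: wt_sum_def wt_diff_def)
lemma wt_diff_inv_sq: "(wt_diff x y)\<^sup>2 * inv_sq (int x - int y) = 1"
  by (auto simp: wt_diff_def inv_sq_def add_nonneg_eq_0_iff)

text \<open>Entrywise differentiation is convenient for computation. It upgrades to
  differentiability in the Frechet topology once second derivatives are bounded uniformly in the
  angle.\<close>

definition entry_deriv :: "opfield \<Rightarrow> opfield \<Rightarrow> bool" where
  "entry_deriv A A' \<longleftrightarrow> (\<forall>\<phi> x y. ((\<lambda>\<phi>. A \<phi> x y) has_vector_derivative A' \<phi> x y) (at \<phi>))"

definition decaying :: "(nat \<Rightarrow> nat \<Rightarrow> real) \<Rightarrow> opfield \<Rightarrow> bool" where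
  "decaying w A \<longleftrightarrow> (\<forall>k. \<exists>C. \<forall>\<phi> x y. w x y ^ k * cmod (A \<phi> x y) \<le> C)"

text \<open>Coinduction avoids the Leibniz formula for higher derivatives. The bounds are uniform in the angle;
  for the weight \<open>wt_sum\<close> this is membership in \<open>smooth_circle_rapid\<close>, by compactness of the circle.\<close>

coinductive smooth_field :: "(nat \<Rightarrow> nat \<Rightarrow> real) \<Rightarrow> opfield \<Rightarrow> bool" for w where
  "\<lbrakk>\<And>\<phi>. A (\<phi> + 2 * pi) = A \<phi>; decaying w A; entry_deriv A A'; smooth_field w A'\<rbrakk> \<Longrightarrow> smooth_field w A"

lemma smooth_field_coinduct:
  assumes "P A"
    and "\<And>A. P A \<Longrightarrow> (\<forall>\<phi>. A (\<phi> + 2 * pi) = A \<phi>) \<and> decaying w A \<and> (\<exists>A'. P A' \<and> entry_deriv A A')"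
  shows "smooth_field w A"
  using assms(1) by (coinduction arbitrary: A rule: smooth_field.coinduct) (use assms(2) in blast)

lemma smooth_field_decaying: "smooth_field w A \<Longrightarrow> decaying w A"
  by (erule smooth_field.cases) simp

lemma smooth_field_periodic: "smooth_field w A \<Longrightarrow> A (\<phi> + 2 * pi) = A \<phi>"
  by (erule smooth_field.cases) simp

lemma smooth_field_deriv:
  assumes "smooth_field w A"
  obtains A' where "smooth_field w A'" "entry_deriv A A'"
  using assms by (cases rule: smooth_field.cases) blast

lemma smooth_field_mono:
  assumes "smooth_field w A" "\<And>x y. 0 \<le> w' x y" "\<And>x y. w' x y \<le> w x y"
  shows "smooth_field w' A"
proof (rule smooth_field_coinduct[of "smooth_field w"])
  fix A assume A: "smooth_field w A"
  have "w' x y ^ k * cmod (A \<phi> x y) \<le> w x y ^ k * cmod (A \<phi> x y)" for k \<phi> x y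
    by (intro mult_right_mono power_mono assms) simp
  with smooth_field_decaying[OF A] have "decaying w' A"
    unfolding decaying_def by (meson order_trans)
  then show "(\<forall>\<phi>. A (\<phi> + 2 * pi) = A \<phi>) \<and> decaying w' A \<and> (\<exists>A'. smooth_field w A' \<and> entry_deriv A A')"
    using A smooth_field_periodic smooth_field_deriv by metis
qed (rule assms)

lemma smooth_field_sum_imp_diff: "smooth_field wt_sum A \<Longrightarrow> smooth_field wt_diff A"
  by (erule smooth_field_mono) (auto simp: wt_diff_le_sum intro: order_trans[OF _ wt_diff_ge_1])

lemma decaying_add:
  assumes "decaying w A" "decaying w B" and w: "\<And>x y. 0 \<le> w x y"
  shows "decaying w (fadd A B)"
  unfolding decaying_def
proof
  fix k
  obtain C D where CD: "\<And>\<phi> x y. w x y ^ k * cmod (A \<phi> x y) \<le> C" "\<And>\<phi> x y. w x y ^ k * cmod (B \<phi> x y) \<le> D"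
    using assms unfolding decaying_def by meson
  have "w x y ^ k * cmod (fadd A B \<phi> x y) \<le> C + D" for \<phi> x y
  proof -
    have "w x y ^ k * cmod (fadd A B \<phi> x y) \<le> w x y ^ k * (cmod (A \<phi> x y) + cmod (B \<phi> x y))"
      unfolding fadd_def by (intro mult_left_mono norm_triangle_ineq zero_le_power w)
    then show ?thesis using CD[of x y \<phi>] by (simp add: ring_distribs)
  qed
  then show "\<exists>C. \<forall>\<phi> x y. w x y ^ k * cmod (fadd A B \<phi> x y) \<le> C" by blast
qed

lemma entry_deriv_add: "entry_deriv A A' \<Longrightarrow> entry_deriv B B' \<Longrightarrow> entry_deriv (fadd A B) (fadd A' B')"
  by (auto simp: entry_deriv_def fadd_def intro!: has_vector_derivative_add)

lemma smooth_field_add: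
  assumes "smooth_field w A" "smooth_field w B" and w: "\<And>x y. 0 \<le> w x y"
  shows "smooth_field w (fadd A B)"
proof (rule smooth_field_coinduct[of "\<lambda>C. \<exists>A B. smooth_field w A \<and> smooth_field w B \<and> C = fadd A B"])
  fix C assume "\<exists>A B. smooth_field w A \<and> smooth_field w B \<and> C = fadd A B"
  then obtain A B where AB: "smooth_field w A" "smooth_field w B" and C: "C = fadd A B" by blast
  obtain A' B' where "smooth_field w A'" "entry_deriv A A'" "smooth_field w B'" "entry_deriv B B'"
    using AB smooth_field_deriv by metis
  then show "(\<forall>\<phi>. C (\<phi> + 2 * pi) = C \<phi>) \<and> decaying w C \<and>
      (\<exists>C'. (\<exists>A B. smooth_field w A \<and> smooth_field w B \<and> C' = fadd A B) \<and> entry_deriv C C')"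
    unfolding C
    using AB by (auto simp: smooth_field_decaying intro!: decaying_add entry_deriv_add w)
      (simp add: fadd_def smooth_field_periodic)
qed (use assms in auto)

text \<open>A multiplier that grows at most like the weight costs one power of the weight, and all
  powers are available. It covers scalars as well as the factor x - y that the derivation
  produces.\<close>

lemma smooth_field_entry_mult:
  assumes A: "smooth_field w A" and m: "\<And>x y. cmod (m x y) \<le> K * w x y" and w: "\<And>x y. 0 \<le> w x y"
  shows "smooth_field w (\<lambda>\<phi> x y. m x y * A \<phi> x y)"
proof (rule smooth_field_coinduct[of "\<lambda>B. \<exists>A. smooth_field w A \<and> B = (\<lambda>\<phi> x y. m x y * A \<phi> x y)"])
  fix B assume "\<exists>A. smooth_field w A \<and> B = (\<lambda>\<phi> x y. m x y * A \<phi> x y)"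
  then obtain A where A: "smooth_field w A" and B: "B = (\<lambda>\<phi> x y. m x y * A \<phi> x y)" by blast
  obtain A' where A': "smooth_field w A'" "entry_deriv A A'" using A smooth_field_deriv by metis
  have "decaying w B"
    unfolding decaying_def
  proof
    fix k
    obtain C where C: "\<And>\<phi> x y. w x y ^ Suc k * cmod (A \<phi> x y) \<le> C"
      using smooth_field_decaying[OF A] unfolding decaying_def by meson
    have "w x y ^ k * cmod (B \<phi> x y) \<le> \<bar>K\<bar> * C" for \<phi> x y
    proof -
      have "w x y ^ k * cmod (B \<phi> x y) = w x y ^ k * cmod (A \<phi> x y) * cmod (m x y)"
        by (simp add: B norm_mult)
      also have "\<dots> \<le> w x y ^ k * cmod (A \<phi> x y) * (\<bar>K\<bar> * w x y)"
        using w by (intro mult_left_mono order_trans[OF m] mult_right_mono mult_nonneg_nonneg) auto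
      also have "\<dots> = \<bar>K\<bar> * (w x y ^ Suc k * cmod (A \<phi> x y))" by simp
      also have "\<dots> \<le> \<bar>K\<bar> * C" by (intro mult_left_mono C) simp
      finally show ?thesis .
    qed
    then show "\<exists>C. \<forall>\<phi> x y. w x y ^ k * cmod (B \<phi> x y) \<le> C" by blast
  qed
  moreover have "entry_deriv B (\<lambda>\<phi> x y. m x y * A' \<phi> x y)"
    using A'(2) unfolding B entry_deriv_def by (auto intro: has_vector_derivative_mult_right)
  ultimately show "(\<forall>\<phi>. B (\<phi> + 2 * pi) = B \<phi>) \<and> decaying w B \<and>
      (\<exists>B'. (\<exists>A. smooth_field w A \<and> B' = (\<lambda>\<phi> x y. m x y * A \<phi> x y)) \<and> entry_deriv B B')"
    using A A' by (auto simp: B smooth_field_periodic)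
qed (use A in auto)

lemma smooth_field_const:
  assumes "\<And>k. \<exists>C. \<forall>x y. w x y ^ k * cmod (M x y) \<le> C"
  shows "smooth_field w (\<lambda>\<phi>. M)"
proof (rule smooth_field_coinduct[of "\<lambda>A. A = (\<lambda>\<phi>. M) \<or> A = fzero"])
  fix A :: opfield assume "A = (\<lambda>\<phi>. M) \<or> A = fzero"
  then show "(\<forall>\<phi>. A (\<phi> + 2 * pi) = A \<phi>) \<and> decaying w A \<and>
      (\<exists>A'. (A' = (\<lambda>\<phi>. M) \<or> A' = fzero) \<and> entry_deriv A A')"
    using assms by (auto simp: fzero_def decaying_def entry_deriv_def)
qed simp

lemma smooth_field_entry:
  assumes "smooth_field w A"
  shows "(\<lambda>\<phi>. A \<phi> x y) \<in> smooth_circle"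
proof (rule smooth_circle_coinduct[of "\<lambda>f. \<exists>A. smooth_field w A \<and> f = (\<lambda>\<phi>. A \<phi> x y)"])
  fix f assume "\<exists>A. smooth_field w A \<and> f = (\<lambda>\<phi>. A \<phi> x y)"
  then obtain A where A: "smooth_field w A" and f: "f = (\<lambda>\<phi>. A \<phi> x y)" by blast
  obtain A' where "smooth_field w A'" "entry_deriv A A'" using A smooth_field_deriv by metis
  then show "(\<forall>\<theta>. f (\<theta> + 2 * pi) = f \<theta>) \<and>
      (\<exists>f'. (\<exists>A. smooth_field w A \<and> f' = (\<lambda>\<phi>. A \<phi> x y)) \<and> (\<forall>\<theta>. (f has_vector_derivative f' \<theta>) (at \<theta>)))"
    using smooth_field_periodic[OF A] by (auto simp: f entry_deriv_def)
qed (use assms in auto)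

lemma decaying_banded:
  assumes "decaying w A" "\<And>x y. wt_diff x y \<le> w x y"
  obtains C where "0 \<le> C" "\<And>\<phi> x y. cmod (A \<phi> x y) \<le> C * inv_sq (int x - int y)"
    "\<And>\<phi> x y. cmod (A \<phi> x y) \<le> C"
proof -
  obtain C where C: "\<And>\<phi> x y. (w x y)\<^sup>2 * cmod (A \<phi> x y) \<le> C"
    using assms(1) unfolding decaying_def by meson
  have C0: "0 \<le> C" by (rule order_trans[OF _ C[of 0 0 0]]) simp
  have le: "cmod (A \<phi> x y) \<le> C * inv_sq (int x - int y)" for \<phi> x y
  proof -
    have "(wt_diff x y)\<^sup>2 * cmod (A \<phi> x y) \<le> (w x y)\<^sup>2 * cmod (A \<phi> x y)"
      by (intro mult_right_mono power_mono assms) (auto intro: order_trans[OF _ wt_diff_ge_1])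
    also have "\<dots> \<le> C" by (rule C)
    finally have "inv_sq (int x - int y) * ((wt_diff x y)\<^sup>2 * cmod (A \<phi> x y)) \<le> inv_sq (int x - int y) * C"
      by (intro mult_left_mono inv_sq_nonneg)
    moreover have "inv_sq (int x - int y) * ((wt_diff x y)\<^sup>2 * cmod (A \<phi> x y))
        = ((wt_diff x y)\<^sup>2 * inv_sq (int x - int y)) * cmod (A \<phi> x y)"
      by (simp only: ac_simps)
    ultimately show ?thesis by (simp add: wt_diff_inv_sq mult.commute[of C])
  qed
  moreover have "cmod (A \<phi> x y) \<le> C" for \<phi> x y
    using order_trans[OF le mult_left_mono[OF inv_sq_le_1 C0]] by simp
  ultimately show ?thesis using C0 that by blast
qed

lemma smooth_field_banded: "smooth_field wt_diff A \<Longrightarrow> banded (A \<phi>)"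
  using decaying_banded[OF smooth_field_decaying] unfolding banded_def by (metis order_refl)

text \<open>Termwise differentiation, with one majorant for the terms and for their derivatives. The
  uniform convergence of the derivatives comes from the M-test.\<close>

lemma has_vector_derivative_infsum:
  fixes F :: "nat \<Rightarrow> real \<Rightarrow> complex"
  assumes d: "\<And>z t. (F z has_vector_derivative F' z t) (at t)"
    and b: "\<And>z t. cmod (F z t) \<le> M z" "\<And>z t. cmod (F' z t) \<le> M z" and M: "M summable_on UNIV"
  shows "((\<lambda>t. \<Sum>\<^sub>\<infinity>z. F z t) has_vector_derivative (\<Sum>\<^sub>\<infinity>z. F' z t)) (at t)"
proof -
  have sM: "summable M" by (rule summable_on_imp_summable[OF M])
  have s: "f sums (\<Sum>\<^sub>\<infinity>z. f z)" if "\<And>z. cmod (f z) \<le> M z" for f :: "nat \<Rightarrow> complex"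
  proof -
    have "(\<lambda>z. norm (f z)) summable_on UNIV"
      by (rule summable_on_comparison_test[OF M]) (use that in auto)
    then have "f summable_on UNIV" by (rule abs_summable_summable)
    then show ?thesis by (intro has_sum_imp_sums has_sum_infsum)
  qed
  have s1: "(\<lambda>z. F z t) sums (\<Sum>\<^sub>\<infinity>z. F z t)" for t by (rule s) (rule b)
  have s2: "(\<Sum>\<^sub>\<infinity>z. F' z t) = (\<Sum>z. F' z t)" for t by (rule sums_unique, rule s) (rule b)
  have "\<exists>g. \<forall>x\<in>UNIV. (\<lambda>n. F n x) sums (g x) \<and> (g has_derivative (\<lambda>h. h *\<^sub>R (\<Sum>\<^sub>\<infinity>z. F' z x))) (at x within UNIV)"
  proof (rule has_derivative_series)
    show "(F n has_derivative (\<lambda>h. h *\<^sub>R F' n x)) (at x within UNIV)" for n x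
      using d by (simp add: has_vector_derivative_def)
    fix e :: real assume e: "e > 0"
    have "uniform_limit UNIV (\<lambda>n t. \<Sum>z<n. F' z t) (\<lambda>t. \<Sum>z. F' z t) sequentially"
      by (rule Weierstrass_m_test[OF b(2) sM])
    then have "\<forall>\<^sub>F n in sequentially. \<forall>x\<in>UNIV. dist (\<Sum>z<n. F' z x) (\<Sum>z. F' z x) < e"
      using e by (auto dest: uniform_limitD)
    then show "\<forall>\<^sub>F n in sequentially. \<forall>x\<in>UNIV. \<forall>h. norm ((\<Sum>i<n. h *\<^sub>R F' i x) - h *\<^sub>R (\<Sum>\<^sub>\<infinity>z. F' z x)) \<le> e * norm h"
    proof eventually_elim
      case (elim n)
      have "norm ((\<Sum>i<n. h *\<^sub>R F' i x) - h *\<^sub>R (\<Sum>z. F' z x)) \<le> e * norm h" for x h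
      proof -
        have "(\<Sum>i<n. h *\<^sub>R F' i x) - h *\<^sub>R (\<Sum>z. F' z x) = h *\<^sub>R ((\<Sum>i<n. F' i x) - (\<Sum>z. F' z x))"
          by (simp add: scaleR_sum_right scaleR_diff_right)
        moreover have "cmod ((\<Sum>i<n. F' i x) - (\<Sum>z. F' z x)) \<le> e"
          using elim by (auto simp: dist_norm less_imp_le)
        ultimately show ?thesis by (simp add: mult.commute[of e] mult_left_mono)
      qed
      then show ?case by (simp add: s2)
    qed
  qed (use s1 in auto)
  then obtain g where g: "\<And>x. (\<lambda>n. F n x) sums (g x)"
      "\<And>x. (g has_vector_derivative (\<Sum>\<^sub>\<infinity>z. F' z x)) (at x)"
    by (auto simp: has_vector_derivative_def)
  \<comment> \<open>The theorem on differentiation of series only yields some limit function with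
    the right derivative; uniqueness of sums identifies it.\<close>
  have "g = (\<lambda>t. \<Sum>\<^sub>\<infinity>z. F z t)" using g(1) s1 sums_unique2 by blast
  then show ?thesis using g(2) by simp
qed

text \<open>Product rule under the sum over the intermediate index. The majorant uses the decay of
  the left factor and only the boundedness of the right one, both uniform in the angle.\<close>

lemma entry_deriv_mult:
  assumes A: "decaying wt_diff A" "decaying wt_diff A'" "entry_deriv A A'"
    and B: "decaying wt_diff B" "decaying wt_diff B'" "entry_deriv B B'"
  shows "entry_deriv (fmult A B) (fadd (fmult A' B) (fmult A B'))"
  unfolding entry_deriv_def
proof (intro allI)
  fix \<phi> x y
  obtain a a' where a: "0 \<le> a" "\<And>\<phi> x y. cmod (A \<phi> x y) \<le> a * inv_sq (int x - int y)"
      and a': "0 \<le> a'" "\<And>\<phi> x y. cmod (A' \<phi> x y) \<le> a' * inv_sq (int x - int y)"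
    by (metis decaying_banded A order_refl)
  obtain b b' where b: "0 \<le> b" "\<And>\<phi> x y. cmod (B \<phi> x y) \<le> b"
      and b': "0 \<le> b'" "\<And>\<phi> x y. cmod (B' \<phi> x y) \<le> b'"
    by (metis decaying_banded B order_refl)
  have l: "cmod (A \<phi> x z * B \<phi> z y) \<le> (a * b) * inv_sq (int x - int z)"
     "cmod (A' \<phi> x z * B \<phi> z y) \<le> (a' * b) * inv_sq (int x - int z)"
     "cmod (A \<phi> x z * B' \<phi> z y) \<le> (a * b') * inv_sq (int x - int z)" for \<phi> z
    using mult_mono[OF a(2)[of \<phi> x z] b(2)[of \<phi> z y]] mult_mono[OF a'(2)[of \<phi> x z] b(2)[of \<phi> z y]]
      mult_mono[OF a(2)[of \<phi> x z] b'(2)[of \<phi> z y]] a(1) a'(1) inv_sq_nonneg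
    by (simp_all add: norm_mult ac_simps)
  have "((\<lambda>\<phi>. \<Sum>\<^sub>\<infinity>z. A \<phi> x z * B \<phi> z y) has_vector_derivative
      (\<Sum>\<^sub>\<infinity>z. A \<phi> x z * B' \<phi> z y + A' \<phi> x z * B \<phi> z y)) (at \<phi>)"
  proof (rule has_vector_derivative_infsum[where M = "\<lambda>z. (a * b + a' * b + a * b') * inv_sq (int x - int z)"])
    show "((\<lambda>\<phi>. A \<phi> x z * B \<phi> z y) has_vector_derivative A t x z * B' t z y + A' t x z * B t z y) (at t)" for z t
      using A(3) B(3) by (intro has_vector_derivative_mult) (auto simp: entry_deriv_def)
    have nn: "0 \<le> a * b * inv_sq k" "0 \<le> a' * b * inv_sq k" "0 \<le> a * b' * inv_sq k" for k
      using a a' b b' inv_sq_nonneg by simp_all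
    show "cmod (A t x z * B t z y) \<le> (a * b + a' * b + a * b') * inv_sq (int x - int z)" for z t
      using l(1)[of t z] nn(2,3)[of "int x - int z"] by (simp add: ring_distribs)
    show "cmod (A t x z * B' t z y + A' t x z * B t z y) \<le> (a * b + a' * b + a * b') * inv_sq (int x - int z)" for z t
      using order_trans[OF norm_triangle_ineq add_mono[OF l(3) l(2)], of t z t z] nn(1)[of "int x - int z"]
      by (simp add: ring_distribs)
    show "(\<lambda>z. (a * b + a' * b + a * b') * inv_sq (int x - int z)) summable_on UNIV"
      by (intro summable_on_cmult_right inv_sq_nat)
  qed
  also have "(\<Sum>\<^sub>\<infinity>z. A \<phi> x z * B' \<phi> z y + A' \<phi> x z * B \<phi> z y)
      = (\<Sum>\<^sub>\<infinity>z. A \<phi> x z * B' \<phi> z y) + (\<Sum>\<^sub>\<infinity>z. A' \<phi> x z * B \<phi> z y)"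
    by (intro infsum_add infsum_le_inv_sq_total(2)[OF l(2)] infsum_le_inv_sq_total(2)[OF l(3)])
  finally show "((\<lambda>\<phi>. fmult A B \<phi> x y) has_vector_derivative fadd (fmult A' B) (fmult A B') \<phi> x y) (at \<phi>)"
    by (simp add: fmult_def mat_mult_def fadd_def add.commute)
qed

section \<open>Products of smooth fields\<close>

inductive field_product :: "(nat \<Rightarrow> nat \<Rightarrow> real) \<Rightarrow> (nat \<Rightarrow> nat \<Rightarrow> real) \<Rightarrow> opfield \<Rightarrow> bool" for w1 w2 where
  "\<lbrakk>smooth_field w1 A; smooth_field w2 B\<rbrakk> \<Longrightarrow> field_product w1 w2 (fmult A B)"
| "\<lbrakk>field_product w1 w2 A; field_product w1 w2 B\<rbrakk> \<Longrightarrow> field_product w1 w2 (fadd A B)"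

lemma decaying_mono:
  assumes "decaying w A" "\<And>x y. 0 \<le> w' x y" "\<And>x y. w' x y \<le> w x y"
  shows "decaying w' A"
proof -
  have "w' x y ^ k * cmod (A \<phi> x y) \<le> w x y ^ k * cmod (A \<phi> x y)" for k \<phi> x y
    by (intro mult_right_mono power_mono assms) simp
  with assms(1) show ?thesis unfolding decaying_def by (meson order_trans)
qed

text \<open>The inequality between the weights distributes the k-th power of \<open>w3\<close> over
  the two factors. The sum over the intermediate index is paid for by two extra powers of
  \<open>w1\<close>, since the square of \<open>wt_diff\<close> times \<open>inv_sq\<close> is 1;
  hence the exponent \<open>k + 2\<close> for the left factor.\<close>

lemma decaying_mult:
  assumes A: "decaying w1 A" and B: "decaying w2 B"
    and w: "\<And>x y. wt_diff x y \<le> w1 x y" "\<And>x y. wt_diff x y \<le> w2 x y"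
      "\<And>x y. 0 \<le> w3 x y" "\<And>x y z. w3 x y \<le> w1 x z * w2 z y"
  shows "decaying w3 (fmult A B)"
  unfolding decaying_def
proof
  fix k
  obtain a b where a: "\<And>\<phi> x y. w1 x y ^ (k + 2) * cmod (A \<phi> x y) \<le> a"
      and b: "\<And>\<phi> x y. w2 x y ^ k * cmod (B \<phi> x y) \<le> b"
    using A B unfolding decaying_def by meson
  have nn: "0 \<le> w1 x y" "0 \<le> w2 x y" for x y
    using w(1,2)[of x y] wt_diff_ge_1[of x y] by linarith+
  have "w3 x y ^ k * cmod (fmult A B \<phi> x y) \<le> (a * b) * inv_sq_total" for \<phi> x y
  proof -
    have "cmod (of_real (w3 x y) ^ k * (A \<phi> x z * B \<phi> z y)) \<le> (a * b) * inv_sq (int x - int z)" for z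
    proof -
      let ?i = "inv_sq (int x - int z)"
      have 1: "w1 x z ^ k * cmod (A \<phi> x z) \<le> a * ?i"
      proof -
        have "w1 x z ^ k * cmod (A \<phi> x z) = (wt_diff x z)\<^sup>2 * ?i * (w1 x z ^ k * cmod (A \<phi> x z))"
          by (simp add: wt_diff_inv_sq)
        also have "\<dots> \<le> (w1 x z)\<^sup>2 * ?i * (w1 x z ^ k * cmod (A \<phi> x z))"
          using wt_diff_ge_1[of x z] nn inv_sq_nonneg
          by (intro mult_right_mono power_mono w mult_nonneg_nonneg) auto
        also have "\<dots> = ?i * (w1 x z ^ (k + 2) * cmod (A \<phi> x z))" by (simp add: power_add power2_eq_square)
        also have "\<dots> \<le> ?i * a" by (intro mult_left_mono a inv_sq_nonneg)
        finally show ?thesis by (simp add: mult.commute)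
      qed
      have "w3 x y ^ k * (cmod (A \<phi> x z) * cmod (B \<phi> z y))
          \<le> (w1 x z * w2 z y) ^ k * (cmod (A \<phi> x z) * cmod (B \<phi> z y))"
        by (intro mult_right_mono power_mono w) auto
      also have "\<dots> = (w1 x z ^ k * cmod (A \<phi> x z)) * (w2 z y ^ k * cmod (B \<phi> z y))"
        by (simp add: power_mult_distrib ac_simps)
      also have "\<dots> \<le> (a * ?i) * b"
        using order_trans[OF _ 1] nn by (intro mult_mono 1 b) auto
      finally show ?thesis using w(3)[of x y] by (simp add: norm_mult norm_power ac_simps)
    qed
    from infsum_le_inv_sq_total(3)[OF this] show ?thesis
      using w(3)[of x y] by (simp add: fmult_def mat_mult_def infsum_cmult_right' norm_mult norm_power)
  qed
  then show "\<exists>C. \<forall>\<phi> x y. w3 x y ^ k * cmod (fmult A B \<phi> x y) \<le> C" by blast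
qed

text \<open>Independent weights let one proof serve both orders of the factors when a rapidly
  decaying field is multiplied by a field that decays only off the diagonal.\<close>

lemma smooth_field_mult:
  assumes A: "smooth_field w1 A" and B: "smooth_field w2 B"
    and w: "\<And>x y. wt_diff x y \<le> w1 x y" "\<And>x y. wt_diff x y \<le> w2 x y"
      "\<And>x y. 0 \<le> w3 x y" "\<And>x y z. w3 x y \<le> w1 x z * w2 z y"
  shows "smooth_field w3 (fmult A B)"
proof (rule smooth_field_coinduct[of "field_product w1 w2"])
  show "field_product w1 w2 (fmult A B)" by (rule field_product.intros assms)+
next
  fix C assume "field_product w1 w2 C"
  then show "(\<forall>\<phi>. C (\<phi> + 2 * pi) = C \<phi>) \<and> decaying w3 C \<and> (\<exists>C'. field_product w1 w2 C' \<and> entry_deriv C C')"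
  proof induction
    case (1 A B)
    obtain A' B' where A': "smooth_field w1 A'" "entry_deriv A A'" and B': "smooth_field w2 B'" "entry_deriv B B'"
      using 1 smooth_field_deriv by metis
    have "entry_deriv (fmult A B) (fadd (fmult A' B) (fmult A B'))"
      using decaying_mono[OF smooth_field_decaying[OF 1(1)] wt_diff_nonneg w(1)]
        decaying_mono[OF smooth_field_decaying[OF A'(1)] wt_diff_nonneg w(1)]
        decaying_mono[OF smooth_field_decaying[OF 1(2)] wt_diff_nonneg w(2)]
        decaying_mono[OF smooth_field_decaying[OF B'(1)] wt_diff_nonneg w(2)]
      by (intro entry_deriv_mult A' B')
    moreover have "field_product w1 w2 (fadd (fmult A' B) (fmult A B'))"
      by (intro field_product.intros 1 A' B')
    moreover have "decaying w3 (fmult A B)"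
      by (rule decaying_mult[OF smooth_field_decaying[OF 1(1)] smooth_field_decaying[OF 1(2)] w])
    ultimately show ?case
      using smooth_field_periodic[OF 1(1)] smooth_field_periodic[OF 1(2)] by (auto simp: fmult_def)
  next
    case (2 A B)
    then obtain A' B' where "field_product w1 w2 A'" "entry_deriv A A'" "field_product w1 w2 B'" "entry_deriv B B'"
      by blast
    with 2 show ?case
      by (auto simp: fadd_def[of A B, symmetric] intro!: decaying_add w(3) entry_deriv_add field_product.intros)
        (simp add: fadd_def)
  qed
qed

lemma wt_sum_nonneg: "0 \<le> wt_sum x y"
  by (simp add: wt_sum_def)

section \<open>Curves of matrices of rapid decay\<close>

text \<open>The mean value inequality is used twice: on f', which moves by at most B |h| on the ball
  of radius |h|, and on f minus its linear part at \<phi>. The explicit rate is what can be made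
  uniform over matrix entries.\<close>

lemma difference_quotient_bound:
  fixes f :: "real \<Rightarrow> complex"
  assumes f: "\<And>t. (f has_vector_derivative f' t) (at t)"
    and f': "\<And>t. (f' has_vector_derivative f'' t) (at t)"
    and B: "\<And>t. cmod (f'' t) \<le> B" and h: "h \<noteq> 0"
  shows "cmod ((f (\<phi> + h) - f \<phi>) / of_real h - f' \<phi>) \<le> B * \<bar>h\<bar>"
proof -
  let ?S = "cball \<phi> \<bar>h\<bar>"
  have on: "onorm (\<lambda>s. s *\<^sub>R c) \<le> cmod c" for c
    by (rule onorm_le) (simp add: mult.commute)
  have B0: "0 \<le> B" using order_trans[OF norm_ge_zero B] .
  have 1: "cmod (f' t - f' \<phi>) \<le> B * \<bar>h\<bar>" if "t \<in> ?S" for t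
  proof -
    have "norm (f' t - f' \<phi>) \<le> B * norm (t - \<phi>)"
      using f' on order_trans[OF on B]
      by (intro differentiable_bound[of UNIV f' "\<lambda>t s. s *\<^sub>R f'' t"])
        (auto simp: has_vector_derivative_def)
    also have "\<dots> \<le> B * \<bar>h\<bar>"
      using that B0 by (intro mult_left_mono) (auto simp: dist_norm)
    finally show ?thesis .
  qed
  let ?g = "\<lambda>t. f t - t *\<^sub>R f' \<phi>"
  have "norm (?g (\<phi> + h) - ?g \<phi>) \<le> (B * \<bar>h\<bar>) * norm (\<phi> + h - \<phi>)"
  proof (rule differentiable_bound[of ?S ?g "\<lambda>t s. s *\<^sub>R (f' t - f' \<phi>)"])
    fix t assume t: "t \<in> ?S"
    have "(?g has_vector_derivative f' t - 1 *\<^sub>R f' \<phi>) (at t)"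
      by (intro has_vector_derivative_diff f)
        (auto intro!: derivative_eq_intros simp: has_vector_derivative_def)
    then show "(?g has_derivative (\<lambda>s. s *\<^sub>R (f' t - f' \<phi>))) (at t within ?S)"
      by (auto simp: has_vector_derivative_def intro: has_derivative_at_withinI)
    show "onorm (\<lambda>s. s *\<^sub>R (f' t - f' \<phi>)) \<le> B * \<bar>h\<bar>"
      by (rule order_trans[OF on 1[OF t]])
  qed (auto simp: dist_norm)
  moreover have "?g (\<phi> + h) - ?g \<phi> = f (\<phi> + h) - f \<phi> - h *\<^sub>R f' \<phi>"
    by (simp add: algebra_simps)
  moreover have "(f (\<phi> + h) - f \<phi>) / of_real h - f' \<phi> = (f (\<phi> + h) - f \<phi> - h *\<^sub>R f' \<phi>) / of_real h"
    using h by (simp add: field_simps scaleR_conv_of_real)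
  ultimately show ?thesis using h by (simp add: norm_divide field_simps)
qed

text \<open>The bound C divided by the k-th power of the weight for the second derivative goes into
  \<open>difference_quotient_bound\<close>; the weight cancels and every entry gets the same rate C
  |h|. Using C + 1 in the radius avoids division by zero.\<close>

lemma entry_deriv_imp_rapid:
  assumes "entry_deriv A A'" "entry_deriv A' A''" "decaying wt_sum A''"
  shows "has_rapid_derivative A (A' \<phi>) \<phi>"
  unfolding has_rapid_derivative_def
proof (intro allI impI)
  fix k and e :: real assume e: "e > 0"
  obtain C where C: "\<And>\<phi> x y. wt_sum x y ^ k * cmod (A'' \<phi> x y) \<le> C"
    using assms(3) unfolding decaying_def by meson
  have C0: "0 \<le> C" by (rule order_trans[OF _ C[of 0 0 0]]) (simp add: wt_sum_def)
  have "\<forall>\<^sub>F h in at (0::real). h \<noteq> 0 \<and> \<bar>h\<bar> < e / (C + 1)"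
    unfolding eventually_at using e C0 by (intro exI[of _ "e / (C + 1)"]) auto
  then show "\<forall>\<^sub>F h in at 0. \<forall>x y. real (1 + x + y) ^ k *
      cmod ((A (\<phi> + h) x y - A \<phi> x y) / of_real h - A' \<phi> x y) \<le> e"
  proof eventually_elim
    case (elim h)
    show ?case
    proof (intro allI)
      fix x y
      have w: "0 < wt_sum x y ^ k" by (simp add: wt_sum_def)
      have "cmod ((A (\<phi> + h) x y - A \<phi> x y) / of_real h - A' \<phi> x y) \<le> (C / wt_sum x y ^ k) * \<bar>h\<bar>"
        using assms(1,2) C w elim
        by (intro difference_quotient_bound[of "\<lambda>t. A t x y" "\<lambda>t. A' t x y" "\<lambda>t. A'' t x y"])
          (auto simp: entry_deriv_def field_simps)
      then have "wt_sum x y ^ k * cmod ((A (\<phi> + h) x y - A \<phi> x y) / of_real h - A' \<phi> x y) \<le> C * \<bar>h\<bar>"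
        using w by (simp add: field_simps)
      also have "\<dots> \<le> (C + 1) * \<bar>h\<bar>" by (simp add: mult_right_mono)
      also have "\<dots> \<le> e" using elim C0 by (simp add: field_simps)
      finally show "real (1 + x + y) ^ k * cmod ((A (\<phi> + h) x y - A \<phi> x y) / of_real h - A' \<phi> x y) \<le> e"
        by (simp add: wt_sum_def)
    qed
  qed
qed

lemma rapid_derivative_entry:
  assumes "has_rapid_derivative R R' \<phi>"
  shows "((\<lambda>\<phi>. R \<phi> x y) has_vector_derivative R' x y) (at \<phi>)"
  unfolding has_vector_derivative_iff_quotient tendsto_iff
proof (intro allI impI)
  fix e :: real assume "e > 0"
  then have "e / 2 > 0" by simp
  then have "\<forall>\<^sub>F h in at 0. \<forall>x y. real (1 + x + y) ^ 0 *
      cmod ((R (\<phi> + h) x y - R \<phi> x y) / of_real h - R' x y) \<le> e / 2"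
    using assms unfolding has_rapid_derivative_def by blast
  then show "\<forall>\<^sub>F h in at 0. dist ((R (\<phi> + h) x y - R \<phi> x y) / of_real h) (R' x y) < e"
  proof eventually_elim
    case (elim h)
    then have "cmod ((R (\<phi> + h) x y - R \<phi> x y) / of_real h - R' x y) \<le> e / 2" by simp
    with \<open>e > 0\<close> show ?case unfolding dist_norm by linarith
  qed
qed

text \<open>Decay in each fibre becomes uniform by compactness. Near each angle the
  differentiability estimate with tolerance 1 bounds a given seminorm, the bisection principle
  patches these local bounds over one period, and periodicity does the rest.\<close>

lemma rapid_derivative_decaying:
  assumes per: "\<And>\<phi>. R (\<phi> + 2 * pi) = R \<phi>"
    and R: "\<And>\<phi>. R \<phi> \<in> rapid_decay" and R': "\<And>\<phi>. R' \<phi> \<in> rapid_decay"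
    and d: "\<And>\<phi>. has_rapid_derivative R (R' \<phi>) \<phi>"
  shows "decaying wt_sum R"
  unfolding decaying_def
proof
  fix k
  let ?P = "\<lambda>a b. \<exists>C. \<forall>\<phi>\<in>{a..b}. \<forall>x y. wt_sum x y ^ k * cmod (R \<phi> x y) \<le> C"
  have w: "0 \<le> wt_sum x y ^ k" for x y by (simp add: wt_sum_def)
  have "?P 0 (2 * pi)"
  proof (rule Bolzano[where P = ?P])
    show "(0::real) \<le> 2 * pi" by simp
  next
    fix a b c :: real assume "?P a b" "?P b c" "a \<le> b" "b \<le> c"
    then obtain C D where "\<And>\<phi> x y. \<phi> \<in> {a..b} \<Longrightarrow> wt_sum x y ^ k * cmod (R \<phi> x y) \<le> C"
        "\<And>\<phi> x y. \<phi> \<in> {b..c} \<Longrightarrow> wt_sum x y ^ k * cmod (R \<phi> x y) \<le> D"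
      by blast
    then have "\<forall>\<phi>\<in>{a..c}. \<forall>x y. wt_sum x y ^ k * cmod (R \<phi> x y) \<le> max C D"
      by (metis atLeastAtMost_iff linear max.coboundedI1 max.coboundedI2)
    then show "?P a c" by blast
  next
    fix \<phi> :: real
    obtain C where C: "\<And>x y. wt_sum x y ^ k * cmod (R \<phi> x y) \<le> C"
      using R[of \<phi>] unfolding rapid_decay_def wt_sum_def by blast
    obtain C' where C': "\<And>x y. wt_sum x y ^ k * cmod (R' \<phi> x y) \<le> C'"
      using R'[of \<phi>] unfolding rapid_decay_def wt_sum_def by blast
    have "C' \<ge> 0" by (rule order_trans[OF _ C'[of 0 0]]) (simp add: wt_sum_def)
    have "\<forall>\<^sub>F h in at 0. \<forall>x y. wt_sum x y ^ k * cmod ((R (\<phi> + h) x y - R \<phi> x y) / of_real h - R' \<phi> x y) \<le> 1"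
      using d[of \<phi>] unfolding has_rapid_derivative_def wt_sum_def by (meson zero_less_one)
    then obtain \<delta> where \<delta>: "\<delta> > 0" "\<And>h x y. h \<noteq> 0 \<Longrightarrow> \<bar>h\<bar> < \<delta> \<Longrightarrow>
        wt_sum x y ^ k * cmod ((R (\<phi> + h) x y - R \<phi> x y) / of_real h - R' \<phi> x y) \<le> 1"
      unfolding eventually_at by (auto simp: dist_norm)
    have bd: "wt_sum x y ^ k * cmod (R (\<phi> + h) x y) \<le> C + \<delta> * (1 + C')" if "\<bar>h\<bar> < \<delta>" for h x y
    proof (cases "h = 0")
      case True
      then show ?thesis using C[of x y] \<open>C' \<ge> 0\<close> \<delta>(1) by (simp add: add_increasing2)
    next
      case False
      define q where "q = (R (\<phi> + h) x y - R \<phi> x y) / of_real h - R' \<phi> x y"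
      have "R (\<phi> + h) x y = R \<phi> x y + of_real h * (q + R' \<phi> x y)"
        unfolding q_def using False by (simp add: field_simps)
      then have "cmod (R (\<phi> + h) x y) \<le> cmod (R \<phi> x y) + cmod (of_real h * (q + R' \<phi> x y))"
        using norm_triangle_ineq[of "R \<phi> x y" "of_real h * (q + R' \<phi> x y)"] by simp
      also have "cmod (of_real h * (q + R' \<phi> x y)) \<le> \<bar>h\<bar> * (cmod q + cmod (R' \<phi> x y))"
        unfolding norm_mult norm_of_real by (intro mult_left_mono norm_triangle_ineq abs_ge_zero)
      finally have "cmod (R (\<phi> + h) x y) \<le> cmod (R \<phi> x y) + \<bar>h\<bar> * (cmod q + cmod (R' \<phi> x y))"
        by simp
      then have "wt_sum x y ^ k * cmod (R (\<phi> + h) x y)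
          \<le> wt_sum x y ^ k * (cmod (R \<phi> x y) + \<bar>h\<bar> * (cmod q + cmod (R' \<phi> x y)))"
        by (intro mult_left_mono w)
      also have "\<dots> = wt_sum x y ^ k * cmod (R \<phi> x y)
          + \<bar>h\<bar> * (wt_sum x y ^ k * cmod q + wt_sum x y ^ k * cmod (R' \<phi> x y))"
        by (simp add: algebra_simps)
      also have "\<dots> \<le> C + \<delta> * (1 + C')"
        using that \<delta>(2)[OF False that, of x y, folded q_def] C'[of x y] C[of x y] w[of x y]
        by (intro add_mono mult_mono) auto
      finally show ?thesis .
    qed
    have "?P a b" if "a \<le> \<phi> \<and> \<phi> \<le> b \<and> b - a < \<delta>" for a b
    proof (intro exI ballI allI)
      fix t x y assume "t \<in> {a..b}"
      then have "\<bar>t - \<phi>\<bar> < \<delta>" using that by auto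
      from bd[OF this] show "wt_sum x y ^ k * cmod (R t x y) \<le> C + \<delta> * (1 + C')" by simp
    qed
    then show "\<exists>d>0. \<forall>a b. a \<le> \<phi> \<and> \<phi> \<le> b \<and> b - a < d \<longrightarrow> ?P a b"
      using \<delta>(1) by blast
  qed
  then obtain C where C: "\<And>\<phi> x y. \<phi> \<in> {0..2 * pi} \<Longrightarrow> wt_sum x y ^ k * cmod (R \<phi> x y) \<le> C" by blast
  have "wt_sum x y ^ k * cmod (R \<phi> x y) \<le> C" for \<phi> x y
    by (rule periodic_reduce[of R \<phi>, OF per]) (use C in auto)
  then show "\<exists>C. \<forall>\<phi> x y. wt_sum x y ^ k * cmod (R \<phi> x y) \<le> C" by blast
qed

lemma entry_deriv_periodic:
  assumes "\<And>\<phi>. A (\<phi> + 2 * pi) = A \<phi>" "entry_deriv A A'"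
  shows "A' (\<phi> + 2 * pi) = A' \<phi>"
proof (intro ext)
  fix x y
  show "A' (\<phi> + 2 * pi) x y = A' \<phi> x y"
    by (rule derivative_periodic[of "\<lambda>t. A t x y"]) (use assms in \<open>auto simp: entry_deriv_def\<close>)
qed

text \<open>The bridge to the coinductive description. The definition asks for periodicity of R
  alone and for decay fibre by fibre, so from left to right the periodicity of the derivatives and
  the uniform bounds have to be derived. From right to left the sequence of derivatives comes from
  dependent choice.\<close>

lemma smooth_circle_rapid_iff: "R \<in> smooth_circle_rapid \<longleftrightarrow> smooth_field wt_sum R"
proof
  assume "R \<in> smooth_circle_rapid"
  then obtain D where per: "\<And>\<phi>. R (\<phi> + 2 * pi) = R \<phi>" and D: "D 0 = R" "\<And>n \<phi>. D n \<phi> \<in> rapid_decay"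
      "\<And>n \<phi>. has_rapid_derivative (D n) (D (Suc n) \<phi>) \<phi>"
    unfolding smooth_circle_rapid_def by blast
  have ed: "entry_deriv (D n) (D (Suc n))" for n
    unfolding entry_deriv_def using rapid_derivative_entry[OF D(3)] by blast
  have pd: "D n (\<phi> + 2 * pi) = D n \<phi>" for n \<phi>
    by (induction n arbitrary: \<phi>) (use per D(1) entry_deriv_periodic[OF _ ed] in auto)
  show "smooth_field wt_sum R"
  proof (rule smooth_field_coinduct[of "\<lambda>A. \<exists>n. A = D n"])
    fix A assume "\<exists>n. A = D n"
    then obtain n where A: "A = D n" by blast
    have "decaying wt_sum A" unfolding A by (rule rapid_derivative_decaying[OF pd D(2) D(2) D(3)])
    then show "(\<forall>\<phi>. A (\<phi> + 2 * pi) = A \<phi>) \<and> decaying wt_sum A \<and> (\<exists>A'. (\<exists>n. A' = D n) \<and> entry_deriv A A')"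
      using pd ed A by blast
  qed (use D(1) in auto)
next
  assume R: "smooth_field wt_sum R"
  have "\<exists>D. \<forall>n. (smooth_field wt_sum (D n) \<and> (n = 0 \<longrightarrow> D n = R)) \<and> entry_deriv (D n) (D (Suc n))"
    by (rule dependent_nat_choice) (use R in \<open>auto elim: smooth_field_deriv\<close>)
  then obtain D where D: "D 0 = R" "\<And>n. smooth_field wt_sum (D n)" "\<And>n. entry_deriv (D n) (D (Suc n))"
    by blast
  have "D n \<phi> \<in> rapid_decay" for n \<phi>
    using smooth_field_decaying[OF D(2)[of n]] unfolding decaying_def rapid_decay_def wt_sum_def by blast
  moreover have "has_rapid_derivative (D n) (D (Suc n) \<phi>) \<phi>" for n \<phi>
    by (rule entry_deriv_imp_rapid[OF D(3) D(3) smooth_field_decaying[OF D(2)]])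
  ultimately show "R \<in> smooth_circle_rapid"
    using smooth_field_periodic[OF R] D(1) unfolding smooth_circle_rapid_def by blast
qed

lemma smooth_field_rapid_decay: "smooth_field wt_sum R \<Longrightarrow> R \<phi> \<in> rapid_decay"
  using smooth_field_decaying unfolding decaying_def rapid_decay_def wt_sum_def by blast

section \<open>Toeplitz operators modulo rapid decay\<close>

lemma toeplitz_field:
  assumes "f \<in> smooth_circle"
  shows "smooth_field wt_diff (\<lambda>\<phi>. toeplitz f)"
proof (rule smooth_field_const)
  fix k
  obtain C where C: "\<And>j. (1 + \<bar>of_int j\<bar>) ^ k * cmod (fourier_coeff f j) \<le> C"
    using fourier_coeff_decay[OF assms] by blast
  have "wt_diff x y ^ k * cmod (toeplitz f x y) \<le> C" for x y
    using C[of "int y - int x"] by (simp add: wt_diff_def toeplitz_entry abs_minus_commute)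
  then show "\<exists>C. \<forall>x y. wt_diff x y ^ k * cmod (toeplitz f x y) \<le> C" by blast
qed

lemma toeplitz_add:
  assumes "f \<in> smooth_circle" "g \<in> smooth_circle"
  shows "toeplitz (\<lambda>\<theta>. f \<theta> + g \<theta>) = (\<lambda>x y. toeplitz f x y + toeplitz g x y)"
  by (intro ext) (simp add: toeplitz_entry fourier_coeff_add smooth_circle_continuous assms)

lemma toeplitz_cmult: "toeplitz (\<lambda>\<theta>. c * f \<theta>) = (\<lambda>x y. c * toeplitz f x y)"
  by (intro ext) (simp add: toeplitz_entry fourier_coeff_cmult)

lemma toeplitz_const: "toeplitz (\<lambda>\<theta>. c) x y = (if x = y then c else 0)"
  by (simp add: toeplitz_entry fourier_coeff_const)

text \<open>Along a diagonal y - x = k Toeplitz entries are constant while rapidly decaying entries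
  tend to 0, so all Fourier coefficients agree. This makes the symbol well defined.\<close>

lemma toeplitz_unique:
  assumes f: "f \<in> smooth_circle" and g: "g \<in> smooth_circle" and R: "R \<in> rapid_decay" and Q: "Q \<in> rapid_decay"
    and eq: "\<And>x y. toeplitz f x y + R x y = toeplitz g x y + Q x y"
  shows "f = g"
proof (rule fourier_coeff_inject[OF f g])
  fix k
  obtain C where C: "\<And>x y. real (1 + x + y) ^ 1 * cmod (R x y) \<le> C"
    using R unfolding rapid_decay_def by blast
  obtain D where D: "\<And>x y. real (1 + x + y) ^ 1 * cmod (Q x y) \<le> D"
    using Q unfolding rapid_decay_def by blast
  have b: "norm (fourier_coeff f k - fourier_coeff g k) \<le> (C + D) / real (Suc n)" for n
  proof -
    \<comment> \<open>The point at distance n down the k-th diagonal; one of the two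
      \<open>nat\<close> terms vanishes according to the sign of k.\<close>
    let ?x = "n + nat (- k)" and ?y = "n + nat k"
    have k: "int ?y - int ?x = k" by simp
    have "fourier_coeff f k - fourier_coeff g k = Q ?x ?y - R ?x ?y"
      using eq[of ?x ?y] unfolding toeplitz_entry k by (simp add: algebra_simps)
    then have "norm (fourier_coeff f k - fourier_coeff g k) \<le> cmod (Q ?x ?y) + cmod (R ?x ?y)"
      by (simp add: norm_triangle_ineq4)
    then have "real (Suc n) * norm (fourier_coeff f k - fourier_coeff g k)
        \<le> real (1 + ?x + ?y) * (cmod (Q ?x ?y) + cmod (R ?x ?y))"
      by (intro mult_mono) auto
    also have "\<dots> \<le> C + D" using C[of ?x ?y] D[of ?x ?y] by (simp add: ring_distribs)
    finally show ?thesis by (simp add: field_simps)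
  qed
  have "(\<lambda>n. (C + D) / real (Suc n)) \<longlonglongrightarrow> 0"
    using LIMSEQ_Suc[OF lim_const_over_n[of "C + D"]] by simp
  then have "norm (fourier_coeff f k - fourier_coeff g k) \<le> 0"
    by (rule LIMSEQ_le_const) (use b in blast)
  then show "fourier_coeff f k = fourier_coeff g k" by simp
qed

text \<open>Minus a product of two Hankel matrices: these are the terms of the convolution whose
  intermediate index is the negative integer -1 - m, which compression to the half-line
  removes.\<close>

definition toeplitz_defect :: "(real \<Rightarrow> complex) \<Rightarrow> (real \<Rightarrow> complex) \<Rightarrow> mat" where
  "toeplitz_defect f g = (\<lambda>x y. - (\<Sum>\<^sub>\<infinity>m. fourier_coeff f (- 1 - int m - int x) * fourier_coeff g (int y + 1 + int m)))"

lemma infsum_int_split: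
  fixes h :: "int \<Rightarrow> complex"
  assumes "h summable_on UNIV"
  shows "infsum h UNIV = (\<Sum>\<^sub>\<infinity>n. h (int n)) + (\<Sum>\<^sub>\<infinity>n. h (- 1 - int n))"
proof -
  have s: "h summable_on A" for A by (rule summable_on_subset[OF assms]) simp
  have "z \<in> range int \<union> range (\<lambda>n. - 1 - int n)" for z
    by (cases z rule: int_cases) auto
  then have "infsum h UNIV = infsum h (range int \<union> range (\<lambda>n. - 1 - int n))"
    by (intro arg_cong[of _ _ "infsum h"]) blast
  also have "\<dots> = infsum h (range int) + infsum h (range (\<lambda>n. - 1 - int n))"
    by (rule infsum_Un_disjoint[OF s s]) auto
  finally show ?thesis
    by (simp add: infsum_reindex inj_on_def o_def)
qed

text \<open>The entry of T_(fg) at x, y is a convolution over all integers z; the matrix product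
  sees only z \<ge> 0.\<close>

lemma toeplitz_mult:
  assumes f: "f \<in> smooth_circle" and g: "g \<in> smooth_circle"
  shows "mat_mult (toeplitz f) (toeplitz g)
    = (\<lambda>x y. toeplitz (\<lambda>\<theta>. f \<theta> * g \<theta>) x y + toeplitz_defect f g x y)"
proof (intro ext)
  fix x y
  let ?H = "\<lambda>z. fourier_coeff f (z - int x) * fourier_coeff g (int y - z)"
  have "((\<lambda>k. fourier_coeff f k * fourier_coeff g (int y - int x - k)) has_sum
      fourier_coeff (\<lambda>\<theta>. f \<theta> * g \<theta>) (int y - int x)) UNIV"
    by (rule fourier_coeff_mult[OF f g])
  moreover have "bij_betw (\<lambda>z. z - int x) UNIV UNIV"
    by (rule bij_betw_byWitness[of _ "\<lambda>z. z + int x"]) auto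
  ultimately have H: "(?H has_sum toeplitz (\<lambda>\<theta>. f \<theta> * g \<theta>) x y) UNIV"
    using has_sum_reindex_bij_betw[of "\<lambda>z. z - int x" UNIV UNIV
        "\<lambda>k. fourier_coeff f k * fourier_coeff g (int y - int x - k)"]
    by (simp add: toeplitz_entry)
  have "toeplitz (\<lambda>\<theta>. f \<theta> * g \<theta>) x y = (\<Sum>\<^sub>\<infinity>n. ?H (int n)) + (\<Sum>\<^sub>\<infinity>n. ?H (- 1 - int n))"
    using infsum_int_split[OF has_sum_imp_summable[OF H]] infsumI[OF H] by simp
  also have "(\<Sum>\<^sub>\<infinity>n. ?H (int n)) = mat_mult (toeplitz f) (toeplitz g) x y"
    by (simp add: mat_mult_def toeplitz_entry)
  also have "(\<Sum>\<^sub>\<infinity>n. ?H (- 1 - int n)) = - toeplitz_defect f g x y"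
    by (simp add: toeplitz_defect_def algebra_simps)
  finally show "mat_mult (toeplitz f) (toeplitz g) x y
      = toeplitz (\<lambda>\<theta>. f \<theta> * g \<theta>) x y + toeplitz_defect f g x y"
    by simp
qed

text \<open>In the m-th term the two Fourier indices have absolute values 1 + m + x and 1 + m + y.
  The decay of f and g thus controls a product that dominates 1 + x + y, and two further powers from
  f pay for the sum over m.\<close>

lemma toeplitz_defect_field:
  assumes f: "f \<in> smooth_circle" and g: "g \<in> smooth_circle"
  shows "smooth_field wt_sum (\<lambda>\<phi>. toeplitz_defect f g)"
proof (rule smooth_field_const)
  fix k
  obtain C where C: "\<And>j. (1 + \<bar>of_int j\<bar>) ^ (k + 2) * cmod (fourier_coeff f j) \<le> C"
    using fourier_coeff_decay[OF f] by blast
  obtain D where D: "\<And>j. (1 + \<bar>of_int j\<bar>) ^ k * cmod (fourier_coeff g j) \<le> D"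
    using fourier_coeff_decay[OF g] by blast
  have C0: "0 \<le> C" by (rule order_trans[OF _ C[of 0]]) simp
  have D0: "0 \<le> D" by (rule order_trans[OF _ D[of 0]]) simp
  have "wt_sum x y ^ k * cmod (toeplitz_defect f g x y) \<le> C * D * inv_sq_total" for x y
  proof -
    let ?t = "\<lambda>m. fourier_coeff f (- 1 - int m - int x) * fourier_coeff g (int y + 1 + int m)"
    have "cmod (of_real (wt_sum x y ^ k) * ?t m) \<le> (C * D) * inv_sq (int 0 - int m)" for m
    proof -
      let ?a = "2 + real m + real x" and ?b = "2 + real m + real y"
      let ?F = "cmod (fourier_coeff f (- 1 - int m - int x))"
      let ?G = "cmod (fourier_coeff g (int y + 1 + int m))"
      have F: "?a ^ (k + 2) * ?F \<le> C"
        using C[of "- 1 - int m - int x"] by (simp add: algebra_simps)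
      have G: "?b ^ k * ?G \<le> D"
        using D[of "int y + 1 + int m"] by (simp add: algebra_simps)
      have w: "wt_sum x y \<le> ?a * ?b"
      proof -
        have "?a * ?b = 2 * ?b + (real m + real x) * ?b" by (simp add: algebra_simps)
        also have "\<dots> \<ge> 2 * ?b + (real m + real x) * 1" by (intro add_mono mult_left_mono) auto
        finally show ?thesis by (simp add: wt_sum_def)
      qed
      have m: "(1 + real m)\<^sup>2 * inv_sq (int 0 - int m) = 1"
        by (simp add: inv_sq_def add_nonneg_eq_0_iff)
      have "wt_sum x y ^ k * (?F * ?G) \<le> (?a * ?b) ^ k * (?F * ?G)"
        by (intro mult_right_mono power_mono w) (auto simp: wt_sum_def)
      also have "\<dots> = ((1 + real m)\<^sup>2 * inv_sq (int 0 - int m)) * ((?a ^ k * ?F) * (?b ^ k * ?G))"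
        unfolding m by (simp add: power_mult_distrib ac_simps)
      also have "\<dots> \<le> (?a\<^sup>2 * inv_sq (int 0 - int m)) * ((?a ^ k * ?F) * (?b ^ k * ?G))"
        by (intro mult_right_mono power_mono mult_nonneg_nonneg inv_sq_nonneg) auto
      also have "\<dots> = inv_sq (int 0 - int m) * ((?a ^ (k + 2) * ?F) * (?b ^ k * ?G))"
        by (simp only: power_add ac_simps)
      also have "\<dots> \<le> inv_sq (int 0 - int m) * (C * D)"
        by (intro mult_left_mono mult_mono F G inv_sq_nonneg C0) auto
      finally show ?thesis
        by (simp only: norm_mult norm_of_real abs_of_nonneg[OF zero_le_power[OF wt_sum_nonneg]] mult.commute[of "C * D"])
    qed
    from infsum_le_inv_sq_total(3)[OF this] show ?thesis
      by (simp only: toeplitz_defect_def infsum_cmult_right' norm_minus_cancel norm_mult norm_of_real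
          abs_of_nonneg[OF zero_le_power[OF wt_sum_nonneg]])
  qed
  then show "\<exists>C. \<forall>x y. wt_sum x y ^ k * cmod (toeplitz_defect f g x y) \<le> C" by blast
qed

section \<open>The algebra of Toeplitz operators plus smooth fields of rapid decay\<close>

text \<open>The normal form without membership in the C*-algebra, and therefore without q. For 0 < q
  < 1 the two descriptions turn out to coincide.\<close>

definition has_symbol :: "opfield \<Rightarrow> (real \<Rightarrow> complex) \<Rightarrow> bool" where
  "has_symbol a f \<longleftrightarrow> f \<in> smooth_circle \<and>
     (\<exists>R. smooth_field wt_sum R \<and> a = fadd (\<lambda>\<phi>. toeplitz f) R)"

lemma has_symbol_smooth: "has_symbol a f \<Longrightarrow> f \<in> smooth_circle"
  by (simp add: has_symbol_def)

lemma has_symbol_field: "has_symbol a f \<Longrightarrow> smooth_field wt_diff a"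
  unfolding has_symbol_def
  using smooth_field_add[OF toeplitz_field smooth_field_sum_imp_diff wt_diff_nonneg] by blast

lemma has_symbol_banded: "has_symbol a f \<Longrightarrow> banded (a \<phi>)"
  by (intro smooth_field_banded has_symbol_field)

lemma has_symbol_unique:
  assumes "has_symbol a f" "has_symbol a g"
  shows "f = g"
proof -
  obtain R Q where R: "smooth_field wt_sum R" "a = fadd (\<lambda>\<phi>. toeplitz f) R"
      and Q: "smooth_field wt_sum Q" "a = fadd (\<lambda>\<phi>. toeplitz g) Q"
    using assms unfolding has_symbol_def by blast
  have "toeplitz f x y + R 0 x y = toeplitz g x y + Q 0 x y" for x y
    using R(2) Q(2) by (metis fadd_def)
  then show ?thesis
    using assms R(1) Q(1) unfolding has_symbol_def
    by (intro toeplitz_unique[of f g "R 0" "Q 0"]) (auto intro: smooth_field_rapid_decay)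
qed

lemma symbol_eq:
  assumes "has_symbol a f"
  shows "symbol a = f"
proof -
  have "(g \<in> smooth_circle \<and> (\<exists>R\<in>smooth_circle_rapid. a = (\<lambda>\<phi> x y. toeplitz g x y + R \<phi> x y)))
      \<longleftrightarrow> has_symbol a g" for g
    unfolding has_symbol_def fadd_def Bex_def smooth_circle_rapid_iff ..
  then show ?thesis
    unfolding symbol_def using assms has_symbol_unique[OF assms] by (intro the_equality) blast+
qed

lemma has_symbol_add:
  assumes "has_symbol a f" "has_symbol b g"
  shows "has_symbol (fadd a b) (\<lambda>\<theta>. f \<theta> + g \<theta>)"
proof -
  obtain R Q where R: "f \<in> smooth_circle" "smooth_field wt_sum R" "a = fadd (\<lambda>\<phi>. toeplitz f) R"
      and Q: "g \<in> smooth_circle" "smooth_field wt_sum Q" "b = fadd (\<lambda>\<phi>. toeplitz g) Q"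
    using assms unfolding has_symbol_def by blast
  have "fadd a b = fadd (\<lambda>\<phi>. toeplitz (\<lambda>\<theta>. f \<theta> + g \<theta>)) (fadd R Q)"
    unfolding R Q toeplitz_add[OF R(1) Q(1)] by (simp add: fadd_def algebra_simps)
  then show ?thesis
    unfolding has_symbol_def using R Q
    by (auto intro!: smooth_circle_add exI[of _ "fadd R Q"] smooth_field_add wt_sum_nonneg)
qed

lemma smooth_field_fscale:
  assumes "smooth_field w A" "\<And>x y. 1 \<le> w x y"
  shows "smooth_field w (fscale c A)"
  unfolding fscale_def
proof (rule smooth_field_entry_mult[OF assms(1), of "\<lambda>x y. c" "cmod c"])
  show "cmod c \<le> cmod c * w x y" for x y
    using mult_left_mono[OF assms(2)[of x y], of "cmod c"] by simp
  show "0 \<le> w x y" for x y using assms(2)[of x y] by linarith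
qed

lemma wt_sum_ge_1: "1 \<le> wt_sum x y"
  by (simp add: wt_sum_def)

lemma has_symbol_fscale:
  assumes "has_symbol a f"
  shows "has_symbol (fscale c a) (\<lambda>\<theta>. c * f \<theta>)"
proof -
  obtain R where R: "f \<in> smooth_circle" "smooth_field wt_sum R" "a = fadd (\<lambda>\<phi>. toeplitz f) R"
    using assms unfolding has_symbol_def by blast
  have "fscale c a = fadd (\<lambda>\<phi>. toeplitz (\<lambda>\<theta>. c * f \<theta>)) (fscale c R)"
    unfolding R toeplitz_cmult by (simp add: fadd_def fscale_def algebra_simps)
  then show ?thesis
    unfolding has_symbol_def using R
    by (auto intro!: smooth_circle_cmult exI[of _ "fscale c R"] smooth_field_fscale wt_sum_ge_1)
qed

lemma smooth_field_fzero: "smooth_field w fzero"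
  unfolding fzero_def by (rule smooth_field_const) auto

lemma has_symbol_one: "has_symbol fone (\<lambda>\<theta>. 1)"
  unfolding has_symbol_def
  by (intro conjI smooth_circle_const exI[of _ fzero] smooth_field_fzero ext)
    (auto simp: fone_def mat_one_def fadd_def fzero_def toeplitz_const)

lemma has_symbol_zero: "has_symbol fzero (\<lambda>\<theta>. 0)"
  unfolding has_symbol_def
  by (intro conjI smooth_circle_const exI[of _ fzero] smooth_field_fzero ext)
    (auto simp: fadd_def fzero_def toeplitz_const)

section \<open>Products of fields with symbols\<close>

lemma fmult_fadd_left:
  assumes "\<And>\<phi>. banded (a \<phi>)" "\<And>\<phi>. banded (b \<phi>)" "\<And>\<phi>. banded (c \<phi>)"
  shows "fmult (fadd a b) c = fadd (fmult a c) (fmult b c)"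
  unfolding fmult_def fadd_def using mat_mult_add_left[OF assms] by simp

lemma fmult_fadd_right:
  assumes "\<And>\<phi>. banded (a \<phi>)" "\<And>\<phi>. banded (b \<phi>)" "\<And>\<phi>. banded (c \<phi>)"
  shows "fmult a (fadd b c) = fadd (fmult a b) (fmult a c)"
  unfolding fmult_def fadd_def using mat_mult_add_right[OF assms] by simp

lemma fmult_assoc:
  assumes "\<And>\<phi>. banded (a \<phi>)" "\<And>\<phi>. banded (b \<phi>)" "\<And>\<phi>. banded (c \<phi>)"
  shows "fmult (fmult a b) c = fmult a (fmult b c)"
  unfolding fmult_def using mat_mult_assoc[OF assms] by simp

lemma fmult_fone: "fmult fone a = a" "fmult a fone = a"
proof -
  show "fmult fone a = a"
  proof (intro ext)
    show "fmult fone a \<phi> x y = a \<phi> x y" for \<phi> x y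
      unfolding fmult_def mat_mult_def fone_def mat_one_def
      by (subst infsum_single_index[of x]) auto
  qed
  show "fmult a fone = a"
  proof (intro ext)
    show "fmult a fone \<phi> x y = a \<phi> x y" for \<phi> x y
      unfolding fmult_def mat_mult_def fone_def mat_one_def
      by (subst infsum_single_index[of y]) auto
  qed
qed

lemma fmult_fzero: "fmult fzero a = fzero" "fmult a fzero = fzero"
  by (simp_all add: fmult_def mat_mult_def fzero_def)

lemma fmult_fscale: "fmult (fscale c a) b = fscale c (fmult a b)" "fmult a (fscale c b) = fscale c (fmult a b)"
proof -
  show "fmult (fscale c a) b = fscale c (fmult a b)"
    unfolding fmult_def mat_mult_def fscale_def by (simp add: mult.assoc infsum_cmult_right')
  have "a \<phi> x z * (c * b \<phi> z y) = c * (a \<phi> x z * b \<phi> z y)" for \<phi> x y z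
    by (rule mult.left_commute)
  then show "fmult a (fscale c b) = fscale c (fmult a b)"
    unfolding fmult_def mat_mult_def fscale_def by (simp only: infsum_cmult_right')
qed

text \<open>The triangle inequality in multiplicative form, from d + s \<le> (1 + d) s for s \<ge>
  1. It is the reason why rapid decay absorbs multiplication from either side.\<close>

lemma wt_sum_le_mult:
  "wt_sum x y \<le> wt_diff x z * wt_sum z y" "wt_sum x y \<le> wt_sum x z * wt_diff z y"
proof -
  have *: "d + s \<le> (1 + d) * s" if "0 \<le> d" "1 \<le> s" for d s :: real
    using mult_left_mono[OF that(2,1)] by (simp add: algebra_simps)
  have "wt_sum x y \<le> \<bar>real x - real z\<bar> + wt_sum z y" by (simp add: wt_sum_def)
  also have "\<dots> \<le> wt_diff x z * wt_sum z y"
    unfolding wt_diff_def by (rule *) (simp_all add: wt_sum_ge_1)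
  finally show "wt_sum x y \<le> wt_diff x z * wt_sum z y" .
  have "wt_sum x y \<le> \<bar>real z - real y\<bar> + wt_sum x z" by (simp add: wt_sum_def)
  also have "\<dots> \<le> wt_sum x z * wt_diff z y"
    unfolding wt_diff_def mult.commute[of "wt_sum x z"] by (rule *) (simp_all add: wt_sum_ge_1)
  finally show "wt_sum x y \<le> wt_sum x z * wt_diff z y" .
qed

lemma smooth_field_mult_sum:
  assumes "smooth_field wt_diff A" "smooth_field wt_sum B"
  shows "smooth_field wt_sum (fmult A B)" "smooth_field wt_sum (fmult B A)"
  by (rule smooth_field_mult[OF assms order_refl wt_diff_le_sum wt_sum_nonneg wt_sum_le_mult(1)])
    (rule smooth_field_mult[OF assms(2,1) wt_diff_le_sum order_refl wt_sum_nonneg wt_sum_le_mult(2)])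

lemma has_symbol_mult:
  assumes "has_symbol a f" "has_symbol b g"
  shows "has_symbol (fmult a b) (\<lambda>\<theta>. f \<theta> * g \<theta>)"
proof -
  obtain R Q where R: "f \<in> smooth_circle" "smooth_field wt_sum R" "a = fadd (\<lambda>\<phi>. toeplitz f) R"
      and Q: "g \<in> smooth_circle" "smooth_field wt_sum Q" "b = fadd (\<lambda>\<phi>. toeplitz g) Q"
    using assms unfolding has_symbol_def by blast
  let ?T = "\<lambda>f \<phi>. toeplitz f"
  note fields = toeplitz_field[OF R(1)] toeplitz_field[OF Q(1)]
    smooth_field_sum_imp_diff[OF R(2)] smooth_field_sum_imp_diff[OF Q(2)]
  note band = fields[THEN smooth_field_banded]
  have b: "banded (b \<phi>)" for \<phi> by (rule has_symbol_banded[OF assms(2)])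
  \<comment> \<open>With a = T_f + R and b = T_g + Q, only T_f is multiplied out against b; R stays
    in front of the whole of b. Each summand has a factor of rapid decay or is the Toeplitz
    defect.\<close>
  let ?S = "fadd (fmult R b) (fadd (fmult (?T f) Q) (\<lambda>\<phi>. toeplitz_defect f g))"
  have "fmult a b = fadd (fmult (?T f) b) (fmult R b)"
    unfolding R(3) by (rule fmult_fadd_left) (rule band b)+
  also have "fmult (?T f) b = fadd (fmult (?T f) (?T g)) (fmult (?T f) Q)"
    unfolding Q(3) by (rule fmult_fadd_right) (rule band)+
  also have "fmult (?T f) (?T g) = fadd (?T (\<lambda>\<theta>. f \<theta> * g \<theta>)) (\<lambda>\<phi>. toeplitz_defect f g)"
    unfolding fmult_def toeplitz_mult[OF R(1) Q(1)] by (simp add: fadd_def)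
  finally have "fmult a b = fadd (?T (\<lambda>\<theta>. f \<theta> * g \<theta>)) ?S"
    by (simp add: fadd_def algebra_simps)
  moreover have "smooth_field wt_sum ?S"
    by (intro smooth_field_add smooth_field_mult_sum toeplitz_defect_field R Q fields
        has_symbol_field[OF assms(2)] wt_sum_nonneg)
  ultimately show ?thesis
    unfolding has_symbol_def using smooth_circle_mult[OF R(1) Q(1)] by blast
qed

section \<open>The derivation\<close>

lemma nu_derivative:
  assumes "entry_deriv a a'"
  shows "((\<lambda>t. nu t a \<phi> x y) has_vector_derivative
    \<i> * (cis (t * (real x - real y)) * ((of_nat x - of_nat y) * a (\<phi> + t) x y - \<i> * a' (\<phi> + t) x y))) (at t)"
proof -
  let ?c = "real x - real y"
  have 1: "((\<lambda>t. cis (t * ?c)) has_vector_derivative \<i> * of_real ?c * cis (t * ?c)) (at t)"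
    using has_vector_derivative_cis[of ?c t] by (simp add: mult.commute)
  have "((\<lambda>t. \<phi> + t) has_vector_derivative 1) (at t)"
    unfolding has_real_derivative_iff_has_vector_derivative[symmetric]
    by (auto intro!: derivative_eq_intros)
  then have 2: "((\<lambda>t. a (\<phi> + t) x y) has_vector_derivative a' (\<phi> + t) x y) (at t)"
    using vector_diff_chain_at[of "\<lambda>t. \<phi> + t" 1 t "\<lambda>t. a t x y" "a' (\<phi> + t) x y"] assms
    by (simp add: o_def entry_deriv_def)
  have "((\<lambda>t. cis (t * ?c) * a (\<phi> + t) x y) has_vector_derivative
      cis (t * ?c) * a' (\<phi> + t) x y + \<i> * of_real ?c * cis (t * ?c) * a (\<phi> + t) x y) (at t)"
    by (rule has_vector_derivative_mult[OF 1 2])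
  then show ?thesis
    unfolding nu_def by (rule has_vector_derivative_eq_rhs) (simp add: algebra_simps)
qed

text \<open>The derivation is the commutator with the number operator, which acts on \<epsilon>_x by
  x, plus -i d/d\<phi>, in accordance with the unitaries that implement \<open>nu\<close>.\<close>

lemma partial_entry:
  assumes "entry_deriv a a'"
  shows "partial a = (\<lambda>\<phi> x y. (of_nat x - of_nat y) * a \<phi> x y - \<i> * a' \<phi> x y)"
proof (intro ext)
  fix \<phi> x y
  show "partial a \<phi> x y = (of_nat x - of_nat y) * a \<phi> x y - \<i> * a' \<phi> x y"
    unfolding partial_def vector_derivative_at[OF nu_derivative[OF assms]]
    by (simp add: algebra_simps)
qed

text \<open>The derivative along the whole orbit, and not only at t = 0, so that it can be
  integrated over a period.\<close>

lemma nu_has_partial_derivative: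
  assumes "entry_deriv a a'"
  shows "((\<lambda>t. nu t a \<phi> x y) has_vector_derivative \<i> * nu t (partial a) \<phi> x y) (at t)"
  using nu_derivative[OF assms, of \<phi> x y t] by (simp add: partial_entry[OF assms] nu_def)

text \<open>The entry at x, y is the coefficient of index y - x; differentiating contributes i (y -
  x), and the second i turns this into x - y. Thus the commutator with the number operator acts on
  symbols as i d/d\<theta>.\<close>

lemma toeplitz_partial:
  assumes "f \<in> smooth_circle"
  shows "toeplitz (\<lambda>\<theta>. \<i> * ddt f \<theta>) x y = (of_nat x - of_nat y) * toeplitz f x y"
  unfolding toeplitz_entry fourier_coeff_cmult fourier_coeff_ddt[OF assms]
  by (simp add: algebra_simps)

lemma has_symbol_partial:
  assumes "has_symbol a f"
  shows "has_symbol (partial a) (\<lambda>\<theta>. \<i> * ddt f \<theta>)"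
proof -
  obtain R where R: "f \<in> smooth_circle" "smooth_field wt_sum R" "a = fadd (\<lambda>\<phi>. toeplitz f) R"
    using assms unfolding has_symbol_def by blast
  obtain R' where R': "smooth_field wt_sum R'" "entry_deriv R R'"
    using smooth_field_deriv[OF R(2)] by blast
  \<comment> \<open>The Toeplitz part does not depend on the angle.\<close>
  have "entry_deriv a R'"
    using R'(2) unfolding R(3) entry_deriv_def fadd_def
    by (auto intro!: derivative_eq_intros)
  from partial_entry[OF this] have "partial a = fadd (\<lambda>\<phi>. toeplitz (\<lambda>\<theta>. \<i> * ddt f \<theta>))
      (fadd (\<lambda>\<phi> x y. (of_nat x - of_nat y) * R \<phi> x y) (fscale (- \<i>) R'))"
    by (intro ext) (simp add: R(3) toeplitz_partial[OF R(1)] fadd_def fscale_def algebra_simps)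
  moreover have "smooth_field wt_sum (\<lambda>\<phi> x y. (of_nat x - of_nat y) * R \<phi> x y)"
  proof (rule smooth_field_entry_mult[OF R(2), of _ 1])
    show "cmod (of_nat x - of_nat y) \<le> 1 * wt_sum x y" for x y
      using norm_triangle_ineq4[of "of_nat x :: complex" "of_nat y"] by (simp add: wt_sum_def)
  qed (rule wt_sum_nonneg)
  then have "smooth_field wt_sum (fadd (\<lambda>\<phi> x y. (of_nat x - of_nat y) * R \<phi> x y) (fscale (- \<i>) R'))"
    by (intro smooth_field_add smooth_field_fscale R' wt_sum_ge_1 wt_sum_nonneg)
  ultimately show ?thesis
    unfolding has_symbol_def using smooth_circle_cmult[OF smooth_circle_ddt(2)[OF R(1)]] by blast
qed

lemma has_symbol_entry_deriv:
  assumes "has_symbol a f"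
  obtains a' where "smooth_field wt_diff a'" "entry_deriv a a'"
  using smooth_field_deriv[OF has_symbol_field[OF assms]] by blast

lemma partial_fadd:
  assumes "has_symbol a f" "has_symbol b g"
  shows "partial (fadd a b) = fadd (partial a) (partial b)"
proof -
  obtain a' b' where d: "entry_deriv a a'" "entry_deriv b b'"
    using has_symbol_entry_deriv assms by metis
  show ?thesis
    unfolding partial_entry[OF d(1)] partial_entry[OF d(2)] partial_entry[OF entry_deriv_add[OF d]]
    by (simp add: fadd_def algebra_simps)
qed

lemma partial_fscale:
  assumes "has_symbol a f"
  shows "partial (fscale c a) = fscale c (partial a)"
proof -
  obtain a' where d: "entry_deriv a a'" using has_symbol_entry_deriv assms by metis
  then have "entry_deriv (fscale c a) (fscale c a')"
    by (auto simp: entry_deriv_def fscale_def intro: has_vector_derivative_mult_right)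
  from partial_entry[OF this] show ?thesis
    unfolding partial_entry[OF d] by (simp add: fscale_def algebra_simps)
qed

text \<open>Under the sum over the intermediate index z, the commutator part uses x - y = (x - z) +
  (z - y), and the angle derivative uses the product rule. Off-diagonal decay justifies the separate
  summations.\<close>

lemma partial_fmult:
  assumes a: "has_symbol a f" and b: "has_symbol b g"
  shows "partial (fmult a b) = fadd (fmult (partial a) b) (fmult a (partial b))"
proof (intro ext)
  fix \<phi> x y
  obtain a' b' where a': "smooth_field wt_diff a'" "entry_deriv a a'"
      and b': "smooth_field wt_diff b'" "entry_deriv b b'"
    using has_symbol_entry_deriv assms by metis
  note dec = smooth_field_decaying[OF has_symbol_field]
  have e: "entry_deriv (fmult a b) (fadd (fmult a' b) (fmult a b'))"
    by (rule entry_deriv_mult[OF dec[OF a] smooth_field_decaying[OF a'(1)] a'(2)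
        dec[OF b] smooth_field_decaying[OF b'(1)] b'(2)])
  note band = has_symbol_banded[OF a] has_symbol_banded[OF b]
    has_symbol_banded[OF has_symbol_partial[OF a]] has_symbol_banded[OF has_symbol_partial[OF b]]
    smooth_field_banded[OF a'(1)] smooth_field_banded[OF b'(1)]
  have s: "(\<lambda>z. a \<phi> x z * b \<phi> z y) summable_on UNIV" "(\<lambda>z. a' \<phi> x z * b \<phi> z y) summable_on UNIV"
     "(\<lambda>z. a \<phi> x z * b' \<phi> z y) summable_on UNIV"
     "(\<lambda>z. partial a \<phi> x z * b \<phi> z y) summable_on UNIV" "(\<lambda>z. a \<phi> x z * partial b \<phi> z y) summable_on UNIV"
    by (rule mat_mult_summable(2)[OF band(1,2)] mat_mult_summable(2)[OF band(5,2)] mat_mult_summable(2)[OF band(1,6)]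
        mat_mult_summable(2)[OF band(3,2)] mat_mult_summable(2)[OF band(1,4)])+
  have t: "partial a \<phi> x z * b \<phi> z y + a \<phi> x z * partial b \<phi> z y
      = (of_nat x - of_nat y) * (a \<phi> x z * b \<phi> z y) + (- \<i>) * (a' \<phi> x z * b \<phi> z y + a \<phi> x z * b' \<phi> z y)" for z
    unfolding partial_entry[OF a'(2)] partial_entry[OF b'(2)] by (simp add: algebra_simps)
  have "fadd (fmult (partial a) b) (fmult a (partial b)) \<phi> x y
      = (\<Sum>\<^sub>\<infinity>z. partial a \<phi> x z * b \<phi> z y + a \<phi> x z * partial b \<phi> z y)"
    unfolding fadd_def fmult_def mat_mult_def by (rule infsum_add[OF s(4,5), symmetric])
  also have "\<dots> = (of_nat x - of_nat y) * (\<Sum>\<^sub>\<infinity>z. a \<phi> x z * b \<phi> z y)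
      + (- \<i>) * ((\<Sum>\<^sub>\<infinity>z. a' \<phi> x z * b \<phi> z y) + (\<Sum>\<^sub>\<infinity>z. a \<phi> x z * b' \<phi> z y))"
    unfolding t
    by (subst infsum_add)
      (intro summable_on_cmult_right summable_on_add s, intro summable_on_cmult_right summable_on_add s,
        simp only: infsum_cmult_right' infsum_add[OF s(2,3)])
  finally show "partial (fmult a b) \<phi> x y = fadd (fmult (partial a) b) (fmult a (partial b)) \<phi> x y"
    unfolding partial_entry[OF e] by (simp add: fadd_def fmult_def mat_mult_def)
qed

section \<open>Membership in the C*-algebra\<close>

text \<open>Schur's test: split the kernel into a product of square roots and apply Cauchy-Schwarz.\<close>

lemma opnorm_le_convolution:
  assumes M: "\<And>x y. cmod (M x y) \<le> g (int y - int x)" and g: "g summable_on UNIV" "\<And>k. 0 \<le> g k"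
    and G: "infsum g UNIV \<le> G"
  shows "opnorm_le M G"
  unfolding opnorm_le_def
proof (intro allI impI)
  fix F :: "nat set" and c d :: "nat \<Rightarrow> complex" assume F: "finite F"
  have le_G: "sum (\<lambda>y. g (h y)) F \<le> G" if "inj h" for h :: "nat \<Rightarrow> int"
  proof -
    have "sum (\<lambda>y. g (h y)) F = sum g (h ` F)"
      using that by (subst sum.reindex) (auto intro: inj_on_subset)
    also have "\<dots> \<le> infsum g UNIV" using F g by (intro finite_sum_le_infsum) auto
    finally show ?thesis using G by simp
  qed
  let ?u = "\<lambda>(x, y). cmod (c x) * sqrt (g (int y - int x))"
  let ?v = "\<lambda>(x, y). cmod (d y) * sqrt (g (int y - int x))"
  have "cmod (\<Sum>x\<in>F. \<Sum>y\<in>F. cnj (c x) * M x y * d y)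
      \<le> (\<Sum>x\<in>F. \<Sum>y\<in>F. cmod (c x) * cmod (M x y) * cmod (d y))"
    by (intro order_trans[OF norm_sum] sum_mono order_trans[OF norm_sum]) (simp add: norm_mult)
  also have "\<dots> \<le> (\<Sum>x\<in>F. \<Sum>y\<in>F. cmod (c x) * g (int y - int x) * cmod (d y))"
    by (intro sum_mono mult_right_mono mult_left_mono M) auto
  also have "\<dots> = (\<Sum>p\<in>F \<times> F. \<bar>?u p\<bar> * \<bar>?v p\<bar>)"
  proof -
    have "cmod (c x) * g k * cmod (d y) = \<bar>cmod (c x) * sqrt (g k)\<bar> * \<bar>cmod (d y) * sqrt (g k)\<bar>" for x y k
      using real_sqrt_mult_self[of "g k"] g(2)[of k] by (simp add: abs_mult ac_simps)
    then show ?thesis unfolding sum.cartesian_product by (intro sum.cong) auto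
  qed
  also have "\<dots> \<le> L2_set ?u (F \<times> F) * L2_set ?v (F \<times> F)" by (rule L2_set_mult_ineq)
  also have "\<dots> \<le> (sqrt G * L2_set (\<lambda>x. cmod (c x)) F) * (sqrt G * L2_set (\<lambda>y. cmod (d y)) F)"
  proof (intro mult_mono)
    have "(\<Sum>p\<in>F \<times> F. (?u p)\<^sup>2) = (\<Sum>x\<in>F. (cmod (c x))\<^sup>2 * (\<Sum>y\<in>F. g (int y - int x)))"
      unfolding sum.cartesian_product[symmetric] sum_distrib_left
      using g(2) by (simp add: sum.cartesian_product split_def power_mult_distrib)
    also have "\<dots> \<le> (\<Sum>x\<in>F. (cmod (c x))\<^sup>2 * G)"
      by (intro sum_mono mult_left_mono le_G) (auto simp: inj_on_def)
    finally show "L2_set ?u (F \<times> F) \<le> sqrt G * L2_set (\<lambda>x. cmod (c x)) F"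
      unfolding L2_set_def real_sqrt_mult[symmetric] by (simp add: sum_distrib_left mult.commute)
    have "(\<Sum>p\<in>F \<times> F. (?v p)\<^sup>2) = (\<Sum>x\<in>F. \<Sum>y\<in>F. (cmod (d y))\<^sup>2 * g (int y - int x))"
      unfolding sum.cartesian_product
      using g(2) by (simp add: split_def power_mult_distrib)
    also have "\<dots> = (\<Sum>y\<in>F. (cmod (d y))\<^sup>2 * (\<Sum>x\<in>F. g (int y - int x)))"
      unfolding sum_distrib_left by (rule sum.swap)
    also have "\<dots> \<le> (\<Sum>y\<in>F. (cmod (d y))\<^sup>2 * G)"
      by (intro sum_mono mult_left_mono le_G) (auto simp: inj_on_def)
    finally show "L2_set ?v (F \<times> F) \<le> sqrt G * L2_set (\<lambda>y. cmod (d y)) F"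
      unfolding L2_set_def real_sqrt_mult[symmetric] by (simp add: sum_distrib_left mult.commute)
    show "0 \<le> sqrt G * L2_set (\<lambda>x. cmod (c x)) F"
      using infsum_nonneg[of UNIV g] g(2) G by (simp add: L2_set_nonneg)
  qed (rule L2_set_nonneg)
  also have "\<dots> = G * L2_set (\<lambda>x. cmod (c x)) F * L2_set (\<lambda>y. cmod (d y)) F"
  proof -
    have "0 \<le> G" using infsum_nonneg[of UNIV g] g(2) G by simp
    then have "sqrt G * sqrt G = G" by simp
    then show ?thesis by (metis (no_types, lifting) mult.assoc mult.left_commute)
  qed
  finally show "cmod (\<Sum>x\<in>F. \<Sum>y\<in>F. cnj (c x) * M x y * d y)
      \<le> G * L2_set (\<lambda>x. cmod (c x)) F * L2_set (\<lambda>y. cmod (d y)) F" .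
qed

text \<open>Schur's test with a kernel at one point: for a matrix supported on a single diagonal a
  bound of the entries bounds the norm.\<close>

lemma opnorm_le_diagonal:
  assumes "\<And>x y. cmod (M x y) \<le> (if int y - int x = k then e else 0)"
  shows "opnorm_le M e"
proof (rule opnorm_le_convolution[of M "\<lambda>j. if j = k then e else 0"])
  \<comment> \<open>The entry at \<open>nat (- k)\<close>, \<open>nat k\<close> lies on the k-th
    diagonal for either sign of k, which forces the bound to be nonnegative.\<close>
  have e: "0 \<le> e"
    using order_trans[OF norm_ge_zero assms[of "nat (- k)" "nat k"]] by (simp split: if_splits)
  then show "0 \<le> (if j = k then e else 0)" for j by simp
  have "((\<lambda>j. if j = k then e else 0) has_sum e) UNIV"
    using has_sum_finite_neutralI[of "{k}" UNIV "\<lambda>j. if j = k then e else 0" e] by simp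
  then show "(\<lambda>j. if j = k then e else 0) summable_on UNIV" "(\<Sum>\<^sub>\<infinity>j. if j = k then e else 0) \<le> e"
    by (auto simp: has_sum_iff)
qed (rule assms)

section \<open>Stability of norm bounds and of the norm closure\<close>

lemma opnorm_le_mono: "opnorm_le M a \<Longrightarrow> a \<le> b \<Longrightarrow> opnorm_le M b"
  unfolding opnorm_le_def
  by (meson order_trans mult_right_mono L2_set_nonneg)

lemma opnorm_le_add:
  assumes "opnorm_le M a" "opnorm_le N b"
  shows "opnorm_le (\<lambda>x y. M x y + N x y) (a + b)"
  unfolding opnorm_le_def
proof (intro allI impI)
  fix F :: "nat set" and c d :: "nat \<Rightarrow> complex" assume F: "finite F"
  have "(\<Sum>x\<in>F. \<Sum>y\<in>F. cnj (c x) * (M x y + N x y) * d y)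
      = (\<Sum>x\<in>F. \<Sum>y\<in>F. cnj (c x) * M x y * d y) + (\<Sum>x\<in>F. \<Sum>y\<in>F. cnj (c x) * N x y * d y)"
    by (simp add: algebra_simps sum.distrib)
  then show "cmod (\<Sum>x\<in>F. \<Sum>y\<in>F. cnj (c x) * (M x y + N x y) * d y)
      \<le> (a + b) * L2_set (\<lambda>x. cmod (c x)) F * L2_set (\<lambda>y. cmod (d y)) F"
    using assms[unfolded opnorm_le_def, rule_format, OF F, of c d]
    by (simp add: ring_distribs) (meson add_mono norm_triangle_ineq order_trans)
qed

lemma opnorm_le_cmult:
  assumes "opnorm_le M a"
  shows "opnorm_le (\<lambda>x y. z * M x y) (cmod z * a)"
  unfolding opnorm_le_def
proof (intro allI impI)
  fix F :: "nat set" and c d :: "nat \<Rightarrow> complex" assume F: "finite F"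
  have "(\<Sum>x\<in>F. \<Sum>y\<in>F. cnj (c x) * (z * M x y) * d y)
      = z * (\<Sum>x\<in>F. \<Sum>y\<in>F. cnj (c x) * M x y * d y)"
    by (simp add: sum_distrib_left ac_simps)
  then show "cmod (\<Sum>x\<in>F. \<Sum>y\<in>F. cnj (c x) * (z * M x y) * d y)
      \<le> cmod z * a * L2_set (\<lambda>x. cmod (c x)) F * L2_set (\<lambda>y. cmod (d y)) F"
    using mult_left_mono[OF assms[unfolded opnorm_le_def, rule_format, OF F, of c d], of "cmod z"]
    by (simp add: norm_mult mult.assoc)
qed

lemma opnorm_le_adj:
  assumes "opnorm_le M a"
  shows "opnorm_le (mat_adj M) a"
  unfolding opnorm_le_def
proof (intro allI impI)
  fix F :: "nat set" and c d :: "nat \<Rightarrow> complex" assume F: "finite F"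
  have "(\<Sum>x\<in>F. \<Sum>y\<in>F. cnj (c x) * mat_adj M x y * d y)
      = cnj (\<Sum>x\<in>F. \<Sum>y\<in>F. cnj (d y) * M y x * c x)"
    by (simp add: mat_adj_def ac_simps)
  also have "(\<Sum>x\<in>F. \<Sum>y\<in>F. cnj (d y) * M y x * c x) = (\<Sum>y\<in>F. \<Sum>x\<in>F. cnj (d y) * M y x * c x)"
    by (rule sum.swap)
  finally show "cmod (\<Sum>x\<in>F. \<Sum>y\<in>F. cnj (c x) * mat_adj M x y * d y)
      \<le> a * L2_set (\<lambda>x. cmod (c x)) F * L2_set (\<lambda>y. cmod (d y)) F"
    using assms[unfolded opnorm_le_def, rule_format, OF F, of d c] by (simp only: complex_mod_cnj ac_simps)
qed

lemma opnorm_le_zero: "0 \<le> e \<Longrightarrow> opnorm_le (\<lambda>x y. 0) e"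
  by (rule opnorm_le_diagonal[of _ 0]) simp

text \<open>By definition the closure consists of limits of polynomials; here it is closed under
  limits of its own members. Approximations can therefore be stacked: matrix units, then shifts,
  then Toeplitz operators.\<close>

lemma cstar_limit:
  assumes "\<And>e. e > 0 \<Longrightarrow> \<exists>b\<in>SUq_cstar q. \<forall>\<phi>. opnorm_le (\<lambda>x y. a \<phi> x y - b \<phi> x y) e"
  shows "a \<in> SUq_cstar q"
  unfolding SUq_cstar_def
proof (intro CollectI allI impI)
  fix e :: real assume "e > 0"
  then have e: "e / 2 > 0" by simp
  obtain b where b: "b \<in> SUq_cstar q" "\<And>\<phi>. opnorm_le (\<lambda>x y. a \<phi> x y - b \<phi> x y) (e / 2)"
    using assms[OF e] by blast
  obtain p where p: "p \<in> SUq_poly q" "\<And>\<phi>. opnorm_le (\<lambda>x y. b \<phi> x y - p \<phi> x y) (e / 2)"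
    using b(1) e unfolding SUq_cstar_def by blast
  have "opnorm_le (\<lambda>x y. a \<phi> x y - p \<phi> x y) e" for \<phi>
    using opnorm_le_add[OF b(2) p(2), of \<phi> \<phi>] by simp
  then show "\<exists>p\<in>SUq_poly q. \<forall>\<phi>. opnorm_le (\<lambda>x y. a \<phi> x y - p \<phi> x y) e" using p(1) by blast
qed

lemma cstar_poly: "p \<in> SUq_poly q \<Longrightarrow> p \<in> SUq_cstar q"
  unfolding SUq_cstar_def by (auto intro!: bexI[of _ p] opnorm_le_zero)

lemma cstar_add:
  assumes "a \<in> SUq_cstar q" "b \<in> SUq_cstar q"
  shows "fadd a b \<in> SUq_cstar q"
  unfolding SUq_cstar_def
proof (intro CollectI allI impI)
  fix e :: real assume "e > 0"
  then have e: "e / 2 > 0" by simp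
  obtain p where p: "p \<in> SUq_poly q" "\<And>\<phi>. opnorm_le (\<lambda>x y. a \<phi> x y - p \<phi> x y) (e / 2)"
    using assms(1) e unfolding SUq_cstar_def by blast
  obtain r where r: "r \<in> SUq_poly q" "\<And>\<phi>. opnorm_le (\<lambda>x y. b \<phi> x y - r \<phi> x y) (e / 2)"
    using assms(2) e unfolding SUq_cstar_def by blast
  have "opnorm_le (\<lambda>x y. fadd a b \<phi> x y - fadd p r \<phi> x y) e" for \<phi>
    using opnorm_le_add[OF p(2) r(2), of \<phi> \<phi>] by (simp add: fadd_def algebra_simps)
  then show "\<exists>p\<in>SUq_poly q. \<forall>\<phi>. opnorm_le (\<lambda>x y. fadd a b \<phi> x y - p \<phi> x y) e"
    using SUq_poly.intros(6)[OF p(1) r(1)] by blast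
qed

lemma cstar_fscale:
  assumes "a \<in> SUq_cstar q"
  shows "fscale c a \<in> SUq_cstar q"
  unfolding SUq_cstar_def
proof (intro CollectI allI impI)
  fix e :: real assume "e > 0"
  \<comment> \<open>Adding 1 covers the scalar 0.\<close>
  then have e: "e / (cmod c + 1) > 0" by (simp add: add_nonneg_pos)
  obtain p where p: "p \<in> SUq_poly q" "\<And>\<phi>. opnorm_le (\<lambda>x y. a \<phi> x y - p \<phi> x y) (e / (cmod c + 1))"
    using assms e unfolding SUq_cstar_def by blast
  have "cmod c * (e / (cmod c + 1)) \<le> e"
  proof -
    have "0 < cmod c + 1" by (simp add: add_nonneg_pos)
    then show ?thesis using \<open>e > 0\<close> by (simp add: field_simps)
  qed
  then have "opnorm_le (\<lambda>x y. fscale c a \<phi> x y - fscale c p \<phi> x y) e" for \<phi>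
    using opnorm_le_mono[OF opnorm_le_cmult[OF p(2), of c \<phi>]] by (simp add: fscale_def right_diff_distrib)
  then show "\<exists>p\<in>SUq_poly q. \<forall>\<phi>. opnorm_le (\<lambda>x y. fscale c a \<phi> x y - p \<phi> x y) e"
    using SUq_poly.intros(5)[OF p(1)] by blast
qed

lemma cstar_adj:
  assumes "a \<in> SUq_cstar q"
  shows "fadj a \<in> SUq_cstar q"
  unfolding SUq_cstar_def
proof (intro CollectI allI impI)
  fix e :: real assume e: "e > 0"
  obtain p where p: "p \<in> SUq_poly q" "\<And>\<phi>. opnorm_le (\<lambda>x y. a \<phi> x y - p \<phi> x y) e"
    using assms e unfolding SUq_cstar_def by blast
  have "opnorm_le (\<lambda>x y. fadj a \<phi> x y - fadj p \<phi> x y) e" for \<phi>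
    using opnorm_le_adj[OF p(2), of \<phi>] by (simp add: fadj_def mat_adj_def)
  then show "\<exists>p\<in>SUq_poly q. \<forall>\<phi>. opnorm_le (\<lambda>x y. fadj a \<phi> x y - p \<phi> x y) e"
    using SUq_poly.intros(4)[OF p(1)] by blast
qed

lemma cstar_zero: "fzero \<in> SUq_cstar q"
  using cstar_fscale[OF cstar_poly[OF SUq_poly.intros(1)], of 0] by (simp add: fscale_def fzero_def)

lemma cstar_sum:
  assumes "finite I" "\<And>i. i \<in> I \<Longrightarrow> a i \<in> SUq_cstar q"
  shows "(\<lambda>\<phi> x y. \<Sum>i\<in>I. a i \<phi> x y) \<in> SUq_cstar q"
  using assms
proof (induction I)
  case empty
  then show ?case using cstar_zero by (simp add: fzero_def)
next
  case (insert i I)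
  then show ?case using cstar_add[of "a i" q "\<lambda>\<phi> x y. \<Sum>i\<in>I. a i \<phi> x y"] by (simp add: fadd_def)
qed

subsection \<open>Matrix units and shifts\<close>

text \<open>The coefficient of \<epsilon>_i in \<alpha>^k \<epsilon>_(i+k). The k annihilation steps
  pass through the levels i + 1 to i + k, hence \<open>Suc j\<close>.\<close>

definition shift_weight :: "real \<Rightarrow> nat \<Rightarrow> nat \<Rightarrow> real" where
  "shift_weight q i k = (\<Prod>j<k. sqrt (1 - q ^ (2 * (i + Suc j))))"

lemma shift_weight_bounds:
  assumes "0 < q" "q < 1"
  shows "0 < shift_weight q i k" "shift_weight q i k \<le> 1"
proof -
  have "q ^ (2 * (i + Suc j)) < 1" for j
    using assms by (intro power_less_one_iff[THEN iffD2]) auto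
  moreover have "0 \<le> q ^ (2 * (i + Suc j))" for j using assms by simp
  ultimately have s: "0 < sqrt (1 - q ^ (2 * (i + Suc j)))" "sqrt (1 - q ^ (2 * (i + Suc j))) \<le> 1" for j
    unfolding real_sqrt_gt_0_iff real_sqrt_le_1_iff diff_gt_0_iff_gt diff_le_eq by simp_all
  show "0 < shift_weight q i k" unfolding shift_weight_def by (intro prod_pos ballI s)
  show "shift_weight q i k \<le> 1"
    unfolding shift_weight_def by (intro prod_le_1 conjI less_imp_le[OF s(1)] s(2))
qed

lemma shift_weight_tendsto:
  assumes "0 < q" "q < 1"
  shows "(\<lambda>i. shift_weight q i k) \<longlonglongrightarrow> 1"
proof -
  have "(\<lambda>i. q ^ (2 * (i + Suc j))) \<longlonglongrightarrow> 0" for j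
  proof -
    have "(\<lambda>i. q ^ i) \<longlonglongrightarrow> 0" using assms by (intro LIMSEQ_realpow_zero) auto
    then show ?thesis
      by (rule filterlim_compose) (intro filterlim_subseq strict_monoI, simp)
  qed
  then have "(\<lambda>i. \<Prod>j<k. sqrt (1 - q ^ (2 * (i + Suc j)))) \<longlonglongrightarrow> (\<Prod>j<k. sqrt (1 - 0))"
    by (intro tendsto_prod tendsto_real_sqrt tendsto_diff tendsto_const)
  then show ?thesis by (simp add: shift_weight_def)
qed

lemma alpha_power:
  "(fmult (alpha q) ^^ k) fone \<phi> x y = (if y = x + k then of_real (shift_weight q x k) else 0)"
proof (induction k arbitrary: x)
  case 0
  show ?case by (auto simp: fone_def mat_one_def shift_weight_def)
next
  case (Suc k)
  then show ?case
    by (simp add: mult_alpha_left shift_weight_def prod.lessThan_Suc_shift del: mult_Suc_right prod.lessThan_Suc)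
qed

lemma adj_alpha_power:
  "(fmult (fadj (alpha q)) ^^ k) A \<phi> x y
    = (if x < k then 0 else of_real (shift_weight q (x - k) k) * A \<phi> (x - k) y)"
proof (induction k arbitrary: x)
  case 0
  show ?case by (auto simp: shift_weight_def)
next
  case (Suc k)
  have step: "(fmult (fadj (alpha q)) ^^ Suc k) A \<phi> x y = (if x = 0 then 0
      else of_real (sqrt (1 - q ^ (2 * x))) * (fmult (fadj (alpha q)) ^^ k) A \<phi> (x - 1) y)"
    unfolding funpow.simps(2) o_apply by (rule mult_adj_alpha_left)
  show ?case
  proof (cases "x < Suc k")
    case True
    then show ?thesis unfolding step Suc by auto
  next
    case False
    then obtain m where x: "x = m + Suc k" by (metis le_add_diff_inverse2 not_less)
    then show ?thesis unfolding step Suc by (simp add: shift_weight_def)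
  qed
qed

lemma beta_power:
  "(fmult (beta q) ^^ k) A \<phi> x y = of_real (q ^ (x * k)) * cis (of_nat k * \<phi>) * A \<phi> x y"
proof (induction k)
  case (Suc k)
  have "(fmult (beta q) ^^ Suc k) A \<phi> x y = of_real (q ^ x) * cis \<phi> * (fmult (beta q) ^^ k) A \<phi> x y"
    unfolding funpow.simps(2) o_apply by (rule mult_beta_left)
  also have "\<dots> = of_real (q ^ (x * Suc k)) * (cis \<phi> * cis (of_nat k * \<phi>)) * A \<phi> x y"
    unfolding Suc by (simp add: power_add)
  also have "cis \<phi> * cis (of_nat k * \<phi>) = cis (of_nat (Suc k) * \<phi>)"
    by (simp add: cis_mult ring_distribs)
  finally show ?case .
qed simp

lemma adj_beta_power:
  "(fmult (fadj (beta q)) ^^ k) A \<phi> x y = of_real (q ^ (x * k)) * cis (- (of_nat k * \<phi>)) * A \<phi> x y"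
proof (induction k)
  case (Suc k)
  have "(fmult (fadj (beta q)) ^^ Suc k) A \<phi> x y
      = of_real (q ^ x) * cis (- \<phi>) * (fmult (fadj (beta q)) ^^ k) A \<phi> x y"
    unfolding funpow.simps(2) o_apply by (rule mult_adj_beta_left)
  also have "\<dots> = of_real (q ^ (x * Suc k)) * (cis (- \<phi>) * cis (- (of_nat k * \<phi>))) * A \<phi> x y"
    unfolding Suc by (simp add: power_add)
  also have "cis (- \<phi>) * cis (- (of_nat k * \<phi>)) = cis (- (of_nat (Suc k) * \<phi>))"
    by (simp add: cis_mult ring_distribs)
  finally show ?case .
qed simp

lemma poly_power:
  assumes "p \<in> SUq_poly q" "A \<in> SUq_poly q"
  shows "(fmult p ^^ k) A \<in> SUq_poly q"
  by (induction k) (auto intro: assms SUq_poly.intros)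

definition unit_field :: "nat \<Rightarrow> nat \<Rightarrow> (real \<Rightarrow> complex) \<Rightarrow> opfield" where
  "unit_field x y h = (\<lambda>\<phi> i j. if i = x \<and> j = y then h \<phi> else 0)"

text \<open>\<alpha>^y sends \<epsilon>_(y+m) to a multiple of \<epsilon>_m, the powers of \<beta>
  and its adjoint damp \<epsilon>_m by q^(m(a+b)), and x factors of the adjoint of \<alpha> lift to
  \<epsilon>_(x+m). After normalisation only m = 0 survives for large n, and since the error lies on
  one diagonal, a bound of its entries suffices.\<close>

lemma cstar_unit_field_cis:
  assumes q: "0 < q" "q < 1"
  shows "unit_field x y (\<lambda>\<phi>. cis (of_int k * \<phi>)) \<in> SUq_cstar q"
proof (rule cstar_limit)
  fix e :: real assume e: "e > 0"
  let ?W = "shift_weight q"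
  \<comment> \<open>The modulus of the entry of \<open>?U\<close> at x, y, where m = 0 and the
    powers of \<beta> contribute only a phase.\<close>
  define c where "c = ?W 0 x * ?W 0 y"
  have c: "c > 0" unfolding c_def by (intro mult_pos_pos shift_weight_bounds q)
  obtain n where n: "q ^ n < e * c"
    using real_arch_pow_inv[of "e * c" q] q e c by auto
  \<comment> \<open>The difference a - b = k produces the phase e^(ik\<phi>), and a + b \<ge> n
    gives the factor q^n for m \<ge> 1.\<close>
  define a where "a = n + nat k"
  define b where "b = n + nat (- k)"
  let ?U = "(fmult (fadj (alpha q)) ^^ x) ((fmult (fadj (beta q)) ^^ b) ((fmult (beta q) ^^ a)
      ((fmult (alpha q) ^^ y) fone)))"
  have U: "?U \<in> SUq_poly q"
    by (intro poly_power SUq_poly.intros)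
  have "opnorm_le (\<lambda>i j. unit_field x y (\<lambda>\<phi>. cis (of_int k * \<phi>)) \<phi> i j - fscale (of_real (1 / c)) ?U \<phi> i j) e" for \<phi>
  proof (rule opnorm_le_diagonal[of _ "int y - int x"])
    fix i j
    have cis: "cis (- (of_nat b * \<phi>)) * cis (of_nat a * \<phi>) = cis (of_int k * \<phi>)"
    proof -
      have "real a - real b = of_int k" by (cases "k \<ge> 0") (auto simp: a_def b_def)
      then have "real a * \<phi> - real b * \<phi> = of_int k * \<phi>" by (metis left_diff_distrib)
      then show ?thesis by (simp add: cis_mult)
    qed
    have Ue: "?U \<phi> i j = (if x \<le> i \<and> j = i - x + y
        then of_real (?W (i - x) x * ?W (i - x) y * q ^ ((i - x) * (a + b))) * cis (of_int k * \<phi>) else 0)"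
      unfolding adj_alpha_power adj_beta_power beta_power alpha_power cis[symmetric]
      by (auto simp: power_add ring_distribs)
    show "cmod (unit_field x y (\<lambda>\<phi>. cis (of_int k * \<phi>)) \<phi> i j - fscale (of_real (1 / c)) ?U \<phi> i j)
        \<le> (if int j - int i = int y - int x then e else 0)"
    proof (cases "x \<le> i \<and> j = i - x + y")
      case False
      then show ?thesis using e by (auto simp: unit_field_def fscale_def Ue)
    next
      case True
      define m where "m = i - x"
      have ij: "i = x + m" "j = y + m" using True by (auto simp: m_def)
      show ?thesis
      proof (cases "m = 0")
        case True
        then show ?thesis
          using shift_weight_bounds(1)[OF q, of 0 x] shift_weight_bounds(1)[OF q, of 0 y] e
          unfolding fscale_def Ue by (simp add: ij unit_field_def c_def)
      next
        case False
        have "q ^ (m * (a + b)) \<le> q ^ n"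
          using q False by (intro power_decreasing) (auto simp: a_def b_def intro: order_trans[of _ "a + b"])
        then have "?W m x * ?W m y * q ^ (m * (a + b)) \<le> 1 * 1 * q ^ n"
          using q shift_weight_bounds[OF q] by (intro mult_mono) (auto intro: less_imp_le mult_nonneg_nonneg)
        also have "\<dots> \<le> e * c" using n by simp
        finally have "?W m x * ?W m y * q ^ (m * (a + b)) / c \<le> e" using c by (simp add: field_simps)
        moreover have "cmod (unit_field x y (\<lambda>\<phi>. cis (of_int k * \<phi>)) \<phi> i j - fscale (of_real (1 / c)) ?U \<phi> i j)
           = \<bar>?W m x * ?W m y * q ^ (m * (a + b)) / c\<bar>"
          using False unfolding fscale_def Ue by (simp add: ij unit_field_def norm_mult norm_divide norm_power abs_mult power_abs)
        moreover have "0 \<le> ?W m x * ?W m y * q ^ (m * (a + b)) / c"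
          using q c shift_weight_bounds(1)[OF q, THEN less_imp_le] by simp
        ultimately show ?thesis by (simp add: ij)
      qed
    qed
  qed
  then show "\<exists>b\<in>SUq_cstar q. \<forall>\<phi>. opnorm_le (\<lambda>i j. unit_field x y (\<lambda>\<phi>. cis (of_int k * \<phi>)) \<phi> i j - b \<phi> i j) e"
    using cstar_fscale[OF cstar_poly[OF U]] by blast
qed

text \<open>The Fourier series of h converges uniformly, and for fields with a single nonzero entry
  uniform distance controls the norm in every fibre.\<close>

lemma cstar_unit_field:
  assumes q: "0 < q" "q < 1" and h: "h \<in> smooth_circle"
  shows "unit_field x y h \<in> SUq_cstar q"
proof (rule cstar_limit)
  fix e :: real assume e: "e > 0"
  let ?t = "\<lambda>k \<theta>. fourier_coeff h k * cis (of_int k * \<theta>)"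
  have "uniform_limit UNIV (\<lambda>K \<theta>. \<Sum>k\<in>K. ?t k \<theta>) h (finite_subsets_at_top UNIV)"
    using fourier_inversion[OF h] fourier_coeff_summable[OF h]
    by (intro Weierstrass_m_test_general'[where M = "\<lambda>k. cmod (fourier_coeff h k)"]) (auto simp: norm_mult)
  then have "\<forall>\<^sub>F K in finite_subsets_at_top UNIV. \<forall>\<theta>\<in>UNIV. dist (\<Sum>k\<in>K. ?t k \<theta>) (h \<theta>) < e"
    using e by (rule uniform_limitD)
  then obtain K where "finite K" "\<forall>L. finite L \<and> K \<subseteq> L \<and> L \<subseteq> UNIV \<longrightarrow> (\<forall>\<theta>\<in>UNIV. dist (\<Sum>k\<in>L. ?t k \<theta>) (h \<theta>) < e)"
    unfolding eventually_finite_subsets_at_top by (elim exE conjE)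
  then have K: "finite K" "dist (\<Sum>k\<in>K. ?t k \<theta>) (h \<theta>) < e" for \<theta> by simp_all
  let ?b = "\<lambda>\<phi> i j. \<Sum>k\<in>K. fscale (fourier_coeff h k) (unit_field x y (\<lambda>\<phi>. cis (of_int k * \<phi>))) \<phi> i j"
  have "?b \<in> SUq_cstar q"
    by (intro cstar_sum K cstar_fscale cstar_unit_field_cis q)
  moreover have "opnorm_le (\<lambda>i j. unit_field x y h \<phi> i j - ?b \<phi> i j) e" for \<phi>
  proof (rule opnorm_le_diagonal[of _ "int y - int x"])
    fix i j
    show "cmod (unit_field x y h \<phi> i j - ?b \<phi> i j) \<le> (if int j - int i = int y - int x then e else 0)"
      using K(2)[of \<phi>] e by (auto simp: unit_field_def fscale_def dist_norm norm_minus_commute)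
  qed
  ultimately show "\<exists>b\<in>SUq_cstar q. \<forall>\<phi>. opnorm_le (\<lambda>i j. unit_field x y h \<phi> i j - b \<phi> i j) e"
    by (intro bexI[of _ ?b] allI)
qed

definition diagonal_field :: "int \<Rightarrow> opfield" where
  "diagonal_field k = (\<lambda>\<phi> x y. if int y - int x = k then 1 else 0)"

lemma cstar_diagonal_field:
  assumes q: "0 < q" "q < 1"
  shows "diagonal_field k \<in> SUq_cstar q"
proof -
  have pos: "diagonal_field (int n) \<in> SUq_cstar q" for n
  proof (rule cstar_limit)
    fix e :: real assume e: "e > 0"
    let ?W = "\<lambda>x. shift_weight q x n"
    \<comment> \<open>Beyond L the entries of \<alpha>^n on its diagonal are within e of 1. The
      finitely many before L are corrected exactly by matrix units with constant coefficients;
      negative k follows by taking adjoints.\<close>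
    obtain L where L: "\<And>x. x \<ge> L \<Longrightarrow> \<bar>?W x - 1\<bar> < e"
      using LIMSEQ_D[OF shift_weight_tendsto[OF q] e] by auto
    let ?s = "\<lambda>\<phi> i j. \<Sum>x<L. unit_field x (x + n) (\<lambda>\<phi>. of_real (1 - ?W x)) \<phi> i j"
    let ?b = "fadd ((fmult (alpha q) ^^ n) fone) ?s"
    have "?b \<in> SUq_cstar q"
      by (intro cstar_add cstar_poly poly_power SUq_poly.intros cstar_sum cstar_unit_field q smooth_circle_const) auto
    moreover have "opnorm_le (\<lambda>i j. diagonal_field (int n) \<phi> i j - ?b \<phi> i j) e" for \<phi>
    proof (rule opnorm_le_diagonal[of _ "int n"])
      fix i j
      have s: "?s \<phi> i j = (if i < L \<and> j = i + n then of_real (1 - ?W i) else 0)"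
      proof (cases "i < L \<and> j = i + n")
        case True
        then have "?s \<phi> i j = (\<Sum>x<L. if x = i then of_real (1 - ?W i) else 0)"
          by (intro sum.cong) (auto simp: unit_field_def)
        then show ?thesis using True by simp
      next
        case False
        then show ?thesis by (intro trans[OF sum.neutral]) (auto simp: unit_field_def)
      qed
      show "cmod (diagonal_field (int n) \<phi> i j - ?b \<phi> i j) \<le> (if int j - int i = int n then e else 0)"
      proof (cases "j = i + n")
        case True
        have "cmod (1 - of_real (?W i)) = \<bar>?W i - 1\<bar>"
          by (metis abs_minus_commute norm_of_real of_real_1 of_real_diff)
        then show ?thesis
          using True L[of i] e unfolding fadd_def s alpha_power by (auto simp: diagonal_field_def)
      next
        case False
        then show ?thesis unfolding fadd_def s alpha_power by (auto simp: diagonal_field_def)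
      qed
    qed
    ultimately show "\<exists>b\<in>SUq_cstar q. \<forall>\<phi>. opnorm_le (\<lambda>x y. diagonal_field (int n) \<phi> x y - b \<phi> x y) e"
    by (intro bexI[of _ ?b] allI)
  qed
  show ?thesis
  proof (cases "k \<ge> 0")
    case True
    then show ?thesis using pos[of "nat k"] by simp
  next
    case False
    have "fadj (diagonal_field (int (nat (- k)))) = diagonal_field k"
      using False by (intro ext) (auto simp: fadj_def mat_adj_def diagonal_field_def)
    then show ?thesis using cstar_adj[OF pos[of "nat (- k)"]] by simp
  qed
qed

text \<open>Finitely many diagonals are kept. By Schur's test the norm of the rest is at most the
  sum of the absolute values of the remaining Fourier coefficients.\<close>

lemma cstar_toeplitz:
  assumes q: "0 < q" "q < 1" and f: "f \<in> smooth_circle"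
  shows "(\<lambda>\<phi>. toeplitz f) \<in> SUq_cstar q"
proof (rule cstar_limit)
  fix e :: real assume e: "e > 0"
  let ?c = "\<lambda>k. cmod (fourier_coeff f k)"
  have s: "?c summable_on A" for A by (rule fourier_coeff_summable[OF f])
  obtain K where K: "finite K" "dist (sum ?c K) (infsum ?c UNIV) \<le> e"
    using infsum_finite_approximation[OF s e] by blast
  let ?g = "\<lambda>k. if k \<in> K then 0 else ?c k"
  have gs: "?g summable_on UNIV"
    by (rule summable_on_comparison_test[OF s]) auto
  have "infsum ?g UNIV = infsum ?c (UNIV - K)"
    by (rule infsum_cong_neutral) auto
  also have "\<dots> = infsum ?c UNIV - infsum ?c K"
    by (rule infsum_Diff[OF s s]) simp
  finally have g: "infsum ?g UNIV \<le> e" using K by (simp add: dist_real_def)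
  let ?b = "\<lambda>\<phi> x y. \<Sum>k\<in>K. fscale (fourier_coeff f k) (diagonal_field k) \<phi> x y"
  have "?b \<in> SUq_cstar q"
    by (intro cstar_sum K cstar_fscale cstar_diagonal_field q)
  moreover have "opnorm_le (\<lambda>x y. toeplitz f x y - ?b \<phi> x y) e" for \<phi>
  proof (rule opnorm_le_convolution[OF _ gs _ g])
    fix x y
    have "?b \<phi> x y = (\<Sum>k\<in>K. if k = int y - int x then fourier_coeff f (int y - int x) else 0)"
      by (intro sum.cong) (auto simp: fscale_def diagonal_field_def)
    then show "cmod (toeplitz f x y - ?b \<phi> x y) \<le> ?g (int y - int x)"
      using K(1) by (simp add: toeplitz_entry)
  qed simp
  ultimately show "\<exists>b\<in>SUq_cstar q. \<forall>\<phi>. opnorm_le (\<lambda>x y. toeplitz f x y - b \<phi> x y) e"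
    by (intro bexI[of _ ?b] allI)
qed

text \<open>Truncation to the corner of size L. Outside it the weight is at least L + 1, so of three
  powers one gives the factor 1/(L + 1) and two give \<open>inv_sq\<close> of x - y, to which
  Schur's test applies. The entries in the corner are smooth functions of the angle times matrix
  units.\<close>

lemma cstar_rapid:
  assumes q: "0 < q" "q < 1" and R: "smooth_field wt_sum R"
  shows "R \<in> SUq_cstar q"
proof (rule cstar_limit)
  fix e :: real assume e: "e > 0"
  obtain C where C: "\<And>\<phi> x y. wt_sum x y ^ 3 * cmod (R \<phi> x y) \<le> C"
    using smooth_field_decaying[OF R] unfolding decaying_def by meson
  have C0: "0 \<le> C" by (rule order_trans[OF _ C[of 0 0 0]]) (simp add: wt_sum_def)
  obtain L :: nat where L: "C * inv_sq_total / e < real L" using reals_Archimedean2 by blast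
  let ?b = "\<lambda>\<phi> i j. \<Sum>p\<in>{..<L} \<times> {..<L}. unit_field (fst p) (snd p) (\<lambda>\<phi>. R \<phi> (fst p) (snd p)) \<phi> i j"
  have "?b \<in> SUq_cstar q"
    by (intro cstar_sum cstar_unit_field q smooth_field_entry[OF R]) auto
  moreover have "opnorm_le (\<lambda>i j. R \<phi> i j - ?b \<phi> i j) e" for \<phi>
  proof (rule opnorm_le_convolution[where g = "\<lambda>k. C / real (Suc L) * inv_sq k"])
    show "(\<lambda>k. C / real (Suc L) * inv_sq k) summable_on UNIV"
      by (intro summable_on_cmult_right inv_sq_summable)
    show "0 \<le> C / real (Suc L) * inv_sq k" for k using C0 inv_sq_nonneg by simp
    have "C * inv_sq_total \<le> e * real L" using L e by (simp add: field_simps)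
    also have "\<dots> \<le> e * real (Suc L)" using e by simp
    finally have "C / real (Suc L) * inv_sq_total \<le> e" by (simp add: field_simps)
    then show "(\<Sum>\<^sub>\<infinity>k. C / real (Suc L) * inv_sq k) \<le> e"
      unfolding infsum_cmult_right' inv_sq_total_def .
    fix x y
    have b: "?b \<phi> x y = (if x < L \<and> y < L then R \<phi> x y else 0)"
    proof -
      have "?b \<phi> x y = (\<Sum>p\<in>{..<L} \<times> {..<L}. if p = (x, y) then R \<phi> x y else 0)"
        by (intro sum.cong) (auto simp: unit_field_def)
      then show ?thesis by simp
    qed
    show "cmod (R \<phi> x y - ?b \<phi> x y) \<le> C / real (Suc L) * inv_sq (int y - int x)"
    proof (cases "x < L \<and> y < L")
      case True
      then show ?thesis unfolding b using C0 inv_sq_nonneg by simp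
    next
      case False
      then have "real (Suc L) * (wt_diff x y)\<^sup>2 * cmod (R \<phi> x y) \<le> wt_sum x y * (wt_sum x y)\<^sup>2 * cmod (R \<phi> x y)"
        by (intro mult_right_mono mult_mono power_mono wt_diff_le_sum wt_diff_nonneg wt_sum_nonneg)
          (auto simp: wt_sum_def)
      also have "\<dots> \<le> C" using C[of x y \<phi>] by (simp add: power3_eq_cube power2_eq_square)
      finally have "real (Suc L) * (wt_diff x y)\<^sup>2 * cmod (R \<phi> x y) * inv_sq (int x - int y)
          \<le> C * inv_sq (int x - int y)"
        by (intro mult_right_mono inv_sq_nonneg)
      moreover have "real (Suc L) * (wt_diff x y)\<^sup>2 * cmod (R \<phi> x y) * inv_sq (int x - int y)
          = real (Suc L) * cmod (R \<phi> x y) * ((wt_diff x y)\<^sup>2 * inv_sq (int x - int y))"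
        by (simp only: ac_simps)
      ultimately have "real (Suc L) * cmod (R \<phi> x y) \<le> C * inv_sq (int x - int y)"
        by (simp only: wt_diff_inv_sq mult_1_right)
      then have "real (Suc L) * cmod (R \<phi> x y) \<le> C * inv_sq (int y - int x)"
        by (simp only: inv_sq_minus(2)[of "int y" "int x"])
      then show ?thesis unfolding b if_not_P[OF False] by (simp add: field_simps)
    qed
  qed
  ultimately show "\<exists>b\<in>SUq_cstar q. \<forall>\<phi>. opnorm_le (\<lambda>x y. R \<phi> x y - b \<phi> x y) e"
    by (intro bexI[of _ ?b] allI)
qed

text \<open>Removes the norm closure from the problem: with this equivalence the carrier no longer
  depends on q.\<close>

lemma SUq_smooth_iff:
  assumes "0 < q" "q < 1"
  shows "a \<in> SUq_smooth q \<longleftrightarrow> (\<exists>f. has_symbol a f)"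
proof
  assume "a \<in> SUq_smooth q"
  then show "\<exists>f. has_symbol a f"
    unfolding SUq_smooth_def has_symbol_def fadd_def smooth_circle_rapid_iff[symmetric] by blast
next
  assume "\<exists>f. has_symbol a f"
  then obtain f R where R: "f \<in> smooth_circle" "smooth_field wt_sum R" "a = fadd (\<lambda>\<phi>. toeplitz f) R"
    unfolding has_symbol_def by blast
  have "a \<in> SUq_cstar q"
    unfolding R(3) by (intro cstar_add cstar_toeplitz cstar_rapid assms R)
  then show "a \<in> SUq_smooth q"
    using R unfolding SUq_smooth_def fadd_def smooth_circle_rapid_iff[symmetric] by blast
qed

section \<open>The functional \<open>\<tau>\<close>\<close>

definition mat_trace :: "mat \<Rightarrow> complex" where
  "mat_trace M = (\<Sum>\<^sub>\<infinity>x. M x x)"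

text \<open>The fourth power of the weight dominates the product of the squares of 1 + x and 1 + y,
  so sums over both indices converge. The differences \<open>int 0 - int x\<close> fit
  \<open>infsum_le_inv_sq_total\<close> with its row index set to 0.\<close>

lemma rapid_decay_bound:
  assumes "\<And>x y. wt_sum x y ^ 4 * cmod (M x y) \<le> C"
  shows "cmod (M x y) \<le> C * inv_sq (int 0 - int x) * inv_sq (int 0 - int y)"
proof -
  have "(1 + real x)\<^sup>2 * (1 + real y)\<^sup>2 \<le> (wt_sum x y)\<^sup>2 * (wt_sum x y)\<^sup>2"
    by (intro mult_mono power_mono) (auto simp: wt_sum_def)
  also have "\<dots> = wt_sum x y ^ 4" by (simp flip: power_add)
  finally have "(1 + real x)\<^sup>2 * (1 + real y)\<^sup>2 * cmod (M x y) \<le> C"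
    using order_trans[OF mult_right_mono assms] norm_ge_zero by blast
  moreover have "0 < (1 + real x)\<^sup>2" "0 < (1 + real y)\<^sup>2" by (simp_all add: add_pos_nonneg)
  ultimately show ?thesis by (simp add: inv_sq_def field_simps)
qed

lemma rapid_decayE:
  assumes "M \<in> rapid_decay"
  obtains C where "0 \<le> C" "\<And>x y. cmod (M x y) \<le> C * inv_sq (int 0 - int x) * inv_sq (int 0 - int y)"
proof -
  obtain C where C: "\<And>x y. wt_sum x y ^ 4 * cmod (M x y) \<le> C"
    using assms unfolding rapid_decay_def wt_sum_def by blast
  have "0 \<le> C" by (rule order_trans[OF _ C[of 0 0]]) (simp add: wt_sum_def)
  then show ?thesis using that rapid_decay_bound[OF C] by blast
qed

lemma diagonal_bound:
  assumes "0 \<le> C" "cmod z \<le> C * inv_sq j * inv_sq j"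
  shows "cmod z \<le> C * inv_sq j"
  using order_trans[OF assms(2) mult_left_mono[OF inv_sq_le_1, of "C * inv_sq j"]] assms(1) inv_sq_nonneg[of j]
  by simp

lemma rapid_decay_diagonal_summable:
  assumes "M \<in> rapid_decay"
  shows "(\<lambda>x. M x x) summable_on UNIV"
proof -
  obtain C where "0 \<le> C" "\<And>x y. cmod (M x y) \<le> C * inv_sq (int 0 - int x) * inv_sq (int 0 - int y)"
    using rapid_decayE[OF assms] by metis
  from diagonal_bound[OF this] show ?thesis by (rule infsum_le_inv_sq_total(2))
qed

lemma rapid_decay_add:
  assumes "M \<in> rapid_decay" "N \<in> rapid_decay"
  shows "(\<lambda>x y. M x y + N x y) \<in> rapid_decay"
  unfolding rapid_decay_def
proof (intro CollectI allI)
  fix k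
  obtain C D where "\<And>x y. real (1 + x + y) ^ k * cmod (M x y) \<le> C" "\<And>x y. real (1 + x + y) ^ k * cmod (N x y) \<le> D"
    using assms unfolding rapid_decay_def by blast
  then have s: "real (1 + x + y) ^ k * (cmod (M x y) + cmod (N x y)) \<le> C + D" for x y
    unfolding distrib_left by (intro add_mono)
  have "real (1 + x + y) ^ k * cmod (M x y + N x y) \<le> C + D" for x y
    by (rule order_trans[OF mult_left_mono[OF norm_triangle_ineq] s]) simp
  then show "\<exists>C. \<forall>x y. real (1 + x + y) ^ k * cmod (M x y + N x y) \<le> C" by blast
qed

lemma mat_trace_add:
  assumes "M \<in> rapid_decay" "N \<in> rapid_decay"
  shows "mat_trace (\<lambda>x y. M x y + N x y) = mat_trace M + mat_trace N"
  unfolding mat_trace_def by (intro infsum_add rapid_decay_diagonal_summable assms)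

lemma mat_trace_cmult: "mat_trace (\<lambda>x y. c * M x y) = c * mat_trace M"
  unfolding mat_trace_def by (rule infsum_cmult_right')

lemma abs_summable_product:
  fixes f :: "nat \<times> nat \<Rightarrow> complex"
  assumes "\<And>x y. cmod (f (x, y)) \<le> C * inv_sq (int 0 - int x) * inv_sq (int 0 - int y)"
  shows "f summable_on UNIV \<times> UNIV"
proof (rule abs_summable_summable, rule iffD2[OF Infinite_Sum.abs_summable_on_Sigma_iff], intro conjI ballI)
  show "(\<lambda>y. norm (f (x, y))) summable_on UNIV" for x
    using infsum_le_inv_sq_total(1)[OF assms] .
  have "cmod (of_real (\<Sum>\<^sub>\<infinity>y. cmod (f (x, y)))) \<le> (C * inv_sq_total) * inv_sq (int 0 - int x)" for x
    using infsum_le_inv_sq_total(4)[OF assms, of x] infsum_nonneg[of UNIV "\<lambda>y. cmod (f (x, y))"]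
    by (simp add: ac_simps)
  from infsum_le_inv_sq_total(1)[OF this]
  show "(\<lambda>x. norm (\<Sum>\<^sub>\<infinity>y. norm (f (x, y)))) summable_on UNIV" by simp
qed

text \<open>Exchange of the two sums, justified by boundedness of M and decay of N in both
  indices.\<close>

lemma mat_trace_commute:
  assumes M: "banded M" and N: "N \<in> rapid_decay"
  shows "mat_trace (mat_mult M N) = mat_trace (mat_mult N M)"
proof -
  obtain D where D: "0 \<le> D" "\<And>x y. cmod (M x y) \<le> D" using bandedE[OF M] by metis
  obtain C where C: "0 \<le> C" "\<And>x y. cmod (N x y) \<le> C * inv_sq (int 0 - int x) * inv_sq (int 0 - int y)"
    using rapid_decayE[OF N] by metis
  have "cmod (M x z * N z x) \<le> (D * C) * inv_sq (int 0 - int x) * inv_sq (int 0 - int z)" for x z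
    using mult_mono[OF D(2)[of x z] C(2)[of z x] D(1) norm_ge_zero] by (simp add: norm_mult ac_simps)
  then have s: "(\<lambda>(x, z). M x z * N z x) summable_on UNIV \<times> UNIV"
    by (intro abs_summable_product[of _ "D * C"]) simp
  show ?thesis
    unfolding mat_trace_def mat_mult_def using infsum_swap_banach[OF s] by (simp add: mult.commute)
qed

text \<open>There are exactly k pairs (x, m) with x + m + 1 = k. This count is where the factor k,
  and with it a derivative of the symbol, enters the trace.\<close>

lemma infsum_antidiagonals:
  fixes p :: "nat \<Rightarrow> complex"
  assumes p: "\<And>k. real (1 + k) ^ 4 * cmod (p k) \<le> C"
  shows "(\<Sum>\<^sub>\<infinity>x. \<Sum>\<^sub>\<infinity>m. p (Suc (x + m))) = (\<Sum>\<^sub>\<infinity>k. of_nat k * p k)"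
proof -
  have "wt_sum x m ^ 4 * cmod (p (Suc (x + m))) \<le> C" for x m
    by (rule order_trans[OF mult_right_mono[OF power_mono] p[of "Suc (x + m)"]]) (auto simp: wt_sum_def)
  from rapid_decay_bound[of "\<lambda>x m. p (Suc (x + m))", OF this]
  have s: "(\<lambda>(x, m). p (Suc (x + m))) summable_on UNIV \<times> UNIV"
    by (intro abs_summable_product[of _ C]) simp
  have bij: "bij_betw (\<lambda>(x, m). (Suc (x + m), x)) (UNIV \<times> UNIV) (SIGMA k:UNIV. {..<k})"
    by (rule bij_betw_byWitness[of _ "\<lambda>(k, x). (x, k - Suc x)"]) auto
  have "(\<lambda>q. case q of (k, x) \<Rightarrow> p k) summable_on (SIGMA k:UNIV. {..<k})"
    using summable_on_reindex_bij_betw[OF bij, of "\<lambda>(k, x). p k"] s by (simp add: split_def)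
  then have s2: "(\<lambda>(k, x). p k) summable_on (SIGMA k:UNIV. {..<k})" .
  have "(\<Sum>\<^sub>\<infinity>x. \<Sum>\<^sub>\<infinity>m. p (Suc (x + m))) = infsum (\<lambda>(x, m). p (Suc (x + m))) (UNIV \<times> UNIV)"
    using infsum_Sigma_banach[OF s] by simp
  also have "\<dots> = infsum (\<lambda>(k, x). p k) (SIGMA k:UNIV. {..<k})"
    using infsum_reindex_bij_betw[OF bij, of "\<lambda>(k, x). p k"] by (simp add: split_def)
  also have "\<dots> = (\<Sum>\<^sub>\<infinity>k. \<Sum>\<^sub>\<infinity>x\<in>{..<k}. p k)"
    using infsum_Sigma_banach[OF s2] by simp
  finally show ?thesis by simp
qed

lemma fourier_product_decay:
  assumes f: "f \<in> smooth_circle" and g: "g \<in> smooth_circle"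
  obtains C where "\<And>k. (1 + \<bar>of_int k\<bar>) ^ n * cmod (fourier_coeff f k * fourier_coeff g (- k)) \<le> C"
proof -
  obtain C where C: "\<And>j. (1 + \<bar>of_int j\<bar>) ^ n * cmod (fourier_coeff f j) \<le> C"
    using fourier_coeff_decay[OF f] by blast
  obtain D where D: "\<And>j. (1 + \<bar>of_int j\<bar>) ^ 0 * cmod (fourier_coeff g j) \<le> D"
    using fourier_coeff_decay[OF g] by blast
  have "0 \<le> C" by (rule order_trans[OF _ C[of 0]]) simp
  have "(1 + \<bar>of_int k\<bar>) ^ n * cmod (fourier_coeff f k * fourier_coeff g (- k)) \<le> C * D" for k
    using mult_mono[OF C[of k] D[of "- k"] \<open>0 \<le> C\<close>] by (simp add: norm_mult mult.assoc)
  then show ?thesis by (rule that)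
qed

text \<open>The defect of g, f has trace minus the sum of k P(k) over k > 0. The defect of f, g
  supplies the terms k P(k) with k < 0. Their difference is the sum over all integers, identified by
  the convolution formula for f' g at index 0.\<close>

lemma toeplitz_defect_trace:
  assumes f: "f \<in> smooth_circle" and g: "g \<in> smooth_circle"
  shows "mat_trace (toeplitz_defect f g) - mat_trace (toeplitz_defect g f)
    = - \<i> * circle_mean (\<lambda>\<theta>. ddt f \<theta> * g \<theta>)"
proof -
  define P where "P = (\<lambda>k. fourier_coeff f k * fourier_coeff g (- k))"
  obtain C where C: "\<And>k. (1 + \<bar>of_int k\<bar>) ^ 4 * cmod (P k) \<le> C"
    unfolding P_def using fourier_product_decay[OF f g, of 4] by metis
  have "mat_trace (toeplitz_defect g f) = - (\<Sum>\<^sub>\<infinity>x. \<Sum>\<^sub>\<infinity>m. P (int (Suc (x + m))))"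
    unfolding mat_trace_def toeplitz_defect_def infsum_uminus P_def
    by (simp add: algebra_simps)
  also have "\<dots> = - (\<Sum>\<^sub>\<infinity>k. of_nat k * P (int k))"
    using infsum_antidiagonals[of "\<lambda>k. P (int k)" C] C[of "int _"] by simp
  finally have 1: "mat_trace (toeplitz_defect g f) = - (\<Sum>\<^sub>\<infinity>k. of_nat k * P (int k))" .
  have "mat_trace (toeplitz_defect f g) = - (\<Sum>\<^sub>\<infinity>x. \<Sum>\<^sub>\<infinity>m. P (- int (Suc (x + m))))"
    unfolding mat_trace_def toeplitz_defect_def infsum_uminus P_def
    by (simp add: algebra_simps)
  also have "\<dots> = - (\<Sum>\<^sub>\<infinity>k. of_nat k * P (- int k))"
    using infsum_antidiagonals[of "\<lambda>k. P (- int k)" C] C[of "- int _"] by simp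
  \<comment> \<open>The term k = 0 vanishes and is dropped, so that the remaining indices can be
    written as -1 - n, the form used in \<open>infsum_int_split\<close>.\<close>
  also have "(\<Sum>\<^sub>\<infinity>k. of_nat k * P (- int k)) = (\<Sum>\<^sub>\<infinity>k\<in>range Suc. of_nat k * P (- int k))"
  proof (rule infsum_cong_neutral)
    fix k :: nat assume "k \<in> UNIV - range Suc"
    then have "k = 0" by (cases k) auto
    then show "of_nat k * P (- int k) = 0" by simp
  qed auto
  also have "\<dots> = (\<Sum>\<^sub>\<infinity>n. of_nat (Suc n) * P (- int (Suc n)))"
    by (subst infsum_reindex) (auto simp: o_def)
  finally have 2: "mat_trace (toeplitz_defect f g) = (\<Sum>\<^sub>\<infinity>n. of_int (- 1 - int n) * P (- 1 - int n))"
    by (simp add: infsum_uminus[symmetric] algebra_simps)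
  have "((\<lambda>k. fourier_coeff (ddt f) k * fourier_coeff g (0 - k)) has_sum
      fourier_coeff (\<lambda>\<theta>. ddt f \<theta> * g \<theta>) 0) UNIV"
    by (rule fourier_coeff_mult[OF smooth_circle_ddt(2)[OF f] g])
  then have "((\<lambda>k. - \<i> * (fourier_coeff (ddt f) k * fourier_coeff g (0 - k))) has_sum
      - \<i> * circle_mean (\<lambda>\<theta>. ddt f \<theta> * g \<theta>)) UNIV"
    unfolding fourier_coeff_0 by (rule has_sum_cmult_right)
  moreover have "- \<i> * (fourier_coeff (ddt f) k * fourier_coeff g (0 - k)) = of_int k * P k" for k
    unfolding fourier_coeff_ddt[OF f] P_def by (simp add: mult.assoc)
  ultimately have hs: "((\<lambda>k. of_int k * P k) has_sum - \<i> * circle_mean (\<lambda>\<theta>. ddt f \<theta> * g \<theta>)) UNIV"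
    by simp
  then show ?thesis
    using infsum_int_split[OF has_sum_imp_summable[OF hs]] infsumI[OF hs] 1 2 by simp
qed

section \<open>Averages over the automorphism group and the values of \<tau>\<close>

lemma shift_continuous:
  assumes "smooth_field w A"
  shows "continuous_on UNIV (\<lambda>t. A (\<phi> + t) x y)"
  by (rule continuous_on_compose2[of UNIV "\<lambda>t. A t x y" UNIV "\<lambda>t. \<phi> + t"])
    (auto intro!: continuous_intros smooth_circle_continuous smooth_field_entry[OF assms])

text \<open>Averaging multiplies a constant matrix entrywise by the mean of e^(it(x-y)). Only the
  diagonal of a Toeplitz matrix survives, which is again Toeplitz, with constant symbol.\<close>

lemma degree0_split:
  assumes f: "f \<in> smooth_circle" and R: "smooth_field wt_sum R"
  shows "degree0 (fadd (\<lambda>\<phi>. toeplitz f) R) \<phi> = (\<lambda>x y. toeplitz (\<lambda>\<theta>. circle_mean f) x y + degree0 R \<phi> x y)"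
proof (intro ext)
  fix x y
  let ?e = "\<lambda>t. cis (t * (real x - real y))"
  have "degree0 (fadd (\<lambda>\<phi>. toeplitz f) R) \<phi> x y
      = circle_mean (\<lambda>t. toeplitz f x y * ?e t + ?e t * R (\<phi> + t) x y)"
    by (simp add: degree0_def nu_def fadd_def algebra_simps)
  also have "\<dots> = circle_mean (\<lambda>t. toeplitz f x y * ?e t) + circle_mean (\<lambda>t. ?e t * R (\<phi> + t) x y)"
    by (intro circle_mean_add continuous_intros shift_continuous[OF R])
  also have "circle_mean (\<lambda>t. toeplitz f x y * ?e t) = toeplitz (\<lambda>\<theta>. circle_mean f) x y"
    using circle_mean_cis[of "int x - int y"]
    by (auto simp: circle_mean_cmult toeplitz_const mult.commute toeplitz_entry fourier_coeff_0)
  finally show "degree0 (fadd (\<lambda>\<phi>. toeplitz f) R) \<phi> x y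
      = toeplitz (\<lambda>\<theta>. circle_mean f) x y + degree0 R \<phi> x y"
    by (simp add: degree0_def nu_def)
qed

lemma degree0_rapid:
  assumes R: "smooth_field wt_sum R"
  shows "degree0 R \<phi> \<in> rapid_decay"
  unfolding rapid_decay_def
proof (intro CollectI allI)
  fix k
  obtain C where C: "\<And>\<phi> x y. wt_sum x y ^ k * cmod (R \<phi> x y) \<le> C"
    using smooth_field_decaying[OF R] unfolding decaying_def by meson
  have "wt_sum x y ^ k * cmod (degree0 R \<phi> x y) \<le> C" for x y
  proof -
    have w: "0 < wt_sum x y ^ k" using wt_sum_ge_1[of x y] by simp
    have "cmod (degree0 R \<phi> x y) \<le> C / wt_sum x y ^ k"
      unfolding degree0_def nu_def
    proof (rule circle_mean_bound)
      show "continuous_on UNIV (\<lambda>t. cis (t * (real x - real y)) * R (\<phi> + t) x y)"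
        by (intro continuous_intros shift_continuous[OF R])
      show "cmod (cis (t * (real x - real y)) * R (\<phi> + t) x y) \<le> C / wt_sum x y ^ k" for t
        using C[of x y "\<phi> + t"] w by (simp add: norm_mult field_simps)
    qed
    then show ?thesis using w by (simp add: field_simps)
  qed
  then show "\<exists>C. \<forall>x y. real (1 + x + y) ^ k * cmod (degree0 R \<phi> x y) \<le> C"
    unfolding wt_sum_def by blast
qed

lemma mat_symbol_eq:
  assumes f: "f \<in> smooth_circle" and R: "R \<in> rapid_decay"
  shows "mat_symbol (\<lambda>x y. toeplitz f x y + R x y) = f"
  unfolding mat_symbol_def
proof (rule the_equality)
  show "f \<in> smooth_circle \<and> (\<exists>Q\<in>rapid_decay. (\<lambda>x y. toeplitz f x y + R x y) = (\<lambda>x y. toeplitz f x y + Q x y))"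
    using f R by blast
  fix g assume "g \<in> smooth_circle \<and> (\<exists>Q\<in>rapid_decay. (\<lambda>x y. toeplitz f x y + R x y) = (\<lambda>x y. toeplitz g x y + Q x y))"
  then obtain Q where g: "g \<in> smooth_circle" "Q \<in> rapid_decay"
      "(\<lambda>x y. toeplitz f x y + R x y) = (\<lambda>x y. toeplitz g x y + Q x y)" by blast
  show "g = f"
    by (rule toeplitz_unique[OF g(1) f g(2) R]) (use g(3) in metis)
qed

lemma tau_eq:
  assumes f: "f \<in> smooth_circle" and R: "smooth_field wt_sum R"
  shows "tau (fadd (\<lambda>\<phi>. toeplitz f) R) = circle_mean f + mat_trace (degree0 R pi)"
proof -
  let ?M = "r_minus (degree0 (fadd (\<lambda>\<phi>. toeplitz f) R))"
  have M: "?M = (\<lambda>x y. toeplitz (\<lambda>\<theta>. circle_mean f) x y + degree0 R pi x y)"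
    unfolding r_minus_def by (rule degree0_split[OF f R])
  have t1: "tau1 ?M = circle_mean f"
    unfolding tau1_def M mat_symbol_eq[OF smooth_circle_const degree0_rapid[OF R]] by simp
  \<comment> \<open>There are N + 1 diagonal entries, but only N copies of the mean are subtracted.
    The copy left over is the summand \<open>circle_mean f\<close> of \<tau>.\<close>
  have "(\<Sum>x\<le>N. ?M x x) - tau1 ?M * of_nat N = circle_mean f + (\<Sum>x\<le>N. degree0 R pi x x)" for N
    unfolding t1 by (simp add: M toeplitz_const sum.distrib algebra_simps)
  moreover have "(\<lambda>N. \<Sum>x\<le>N. degree0 R pi x x) \<longlonglongrightarrow> mat_trace (degree0 R pi)"
    using has_sum_imp_sums[OF has_sum_infsum[OF rapid_decay_diagonal_summable[OF degree0_rapid[OF R]]]]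
    unfolding sums_def_le mat_trace_def .
  ultimately have "(\<lambda>N. (\<Sum>x\<le>N. ?M x x) - tau1 ?M * of_nat N) \<longlonglongrightarrow> circle_mean f + mat_trace (degree0 R pi)"
    by (simp add: tendsto_add)
  then show ?thesis unfolding tau_def tau0_def by (rule limI)
qed

lemma degree0_fadd:
  assumes "smooth_field w A" "smooth_field w B"
  shows "degree0 (fadd A B) = fadd (degree0 A) (degree0 B)"
  unfolding degree0_def nu_def fadd_def ring_distribs
  by (intro ext circle_mean_add continuous_intros shift_continuous[OF assms(1)] shift_continuous[OF assms(2)])

lemma degree0_fscale: "degree0 (fscale c A) = fscale c (degree0 A)"
  unfolding degree0_def nu_fscale by (simp add: fscale_def circle_mean_cmult)

lemma tau_fadd:
  assumes "has_symbol a f" "has_symbol b g"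
  shows "tau (fadd a b) = tau a + tau b"
proof -
  obtain R Q where R: "f \<in> smooth_circle" "smooth_field wt_sum R" "a = fadd (\<lambda>\<phi>. toeplitz f) R"
      and Q: "g \<in> smooth_circle" "smooth_field wt_sum Q" "b = fadd (\<lambda>\<phi>. toeplitz g) Q"
    using assms unfolding has_symbol_def by blast
  have "fadd a b = fadd (\<lambda>\<phi>. toeplitz (\<lambda>\<theta>. f \<theta> + g \<theta>)) (fadd R Q)"
    unfolding R Q toeplitz_add[OF R(1) Q(1)] by (simp add: fadd_def algebra_simps)
  then have "tau (fadd a b) = circle_mean (\<lambda>\<theta>. f \<theta> + g \<theta>) + mat_trace (degree0 (fadd R Q) pi)"
    using tau_eq[OF smooth_circle_add[OF R(1) Q(1)] smooth_field_add[OF R(2) Q(2) wt_sum_nonneg]] by simp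
  also have "\<dots> = circle_mean f + circle_mean g + (mat_trace (degree0 R pi) + mat_trace (degree0 Q pi))"
    unfolding degree0_fadd[OF R(2) Q(2)]
    by (simp add: fadd_def mat_trace_add degree0_rapid R Q circle_mean_add smooth_circle_continuous)
  finally show ?thesis unfolding R(3) Q(3) tau_eq[OF R(1,2)] tau_eq[OF Q(1,2)] by simp
qed

lemma tau_fscale:
  assumes "has_symbol a f"
  shows "tau (fscale c a) = c * tau a"
proof -
  obtain R where R: "f \<in> smooth_circle" "smooth_field wt_sum R" "a = fadd (\<lambda>\<phi>. toeplitz f) R"
    using assms unfolding has_symbol_def by blast
  have "fscale c a = fadd (\<lambda>\<phi>. toeplitz (\<lambda>\<theta>. c * f \<theta>)) (fscale c R)"
    unfolding R toeplitz_cmult by (simp add: fadd_def fscale_def algebra_simps)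
  then have "tau (fscale c a) = circle_mean (\<lambda>\<theta>. c * f \<theta>) + mat_trace (degree0 (fscale c R) pi)"
    using tau_eq[OF smooth_circle_cmult[OF R(1)] smooth_field_fscale[OF R(2) wt_sum_ge_1]] by simp
  also have "\<dots> = c * (circle_mean f + mat_trace (degree0 R pi))"
    unfolding degree0_fscale by (simp add: fscale_def circle_mean_cmult mat_trace_cmult ring_distribs)
  finally show ?thesis unfolding R(3) tau_eq[OF R(1,2)] .
qed

text \<open>Up to the factor i, \<open>nu t (partial a)\<close> is the derivative of a
  2\<pi>-periodic function of t in every entry, so its mean vanishes.\<close>

lemma degree0_partial:
  assumes "has_symbol a f"
  shows "degree0 (partial a) = fzero"
proof (intro ext)
  fix \<phi> x y
  obtain a' where a': "entry_deriv a a'" using has_symbol_entry_deriv[OF assms] by metis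
  have "nu (2 * pi) a \<phi> x y = nu 0 a \<phi> x y"
  proof -
    have "cis (2 * pi * (real x - real y)) = 1"
      by (rule cis_multiple_2pi) (auto intro: Ints_diff)
    then show ?thesis
      using smooth_field_periodic[OF has_symbol_field[OF assms], of \<phi>] by (simp add: nu_def)
  qed
  then have "circle_mean (\<lambda>t. \<i> * nu t (partial a) \<phi> x y) = 0"
    by (rule circle_mean_deriv[OF nu_has_partial_derivative[OF a']])
  then show "degree0 (partial a) \<phi> x y = fzero \<phi> x y"
    unfolding circle_mean_cmult by (simp add: degree0_def fzero_def)
qed

lemma tau_partial:
  assumes "has_symbol a f"
  shows "tau (partial a) = 0"
proof -
  have "(\<lambda>x y. 0) \<in> rapid_decay" by (auto simp: rapid_decay_def)
  then have "mat_symbol (\<lambda>x y. 0) = (\<lambda>\<theta>. 0)"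
    using mat_symbol_eq[OF smooth_circle_const[of 0], of "\<lambda>x y. 0"] by (simp add: toeplitz_const)
  then have "tau1 (\<lambda>x y. 0) = 0" by (simp add: tau1_def)
  then show ?thesis
    unfolding tau_def degree0_partial[OF assms] r_minus_def fzero_def tau0_def by (simp add: limI)
qed

text \<open>The commutator has symbol 0, so it is itself a smooth field of rapid decay and \<tau> is
  the mean of its fibrewise traces. These can then be computed one fibre at a time.\<close>

lemma tau_commutator:
  assumes a: "has_symbol a f" and b: "has_symbol b g"
  shows "tau (fmult a b) - tau (fmult b a) = - \<i> * circle_mean (\<lambda>\<theta>. ddt f \<theta> * g \<theta>)"
proof -
  let ?L = "- \<i> * circle_mean (\<lambda>\<theta>. ddt f \<theta> * g \<theta>)"
  obtain R Q where R: "f \<in> smooth_circle" "smooth_field wt_sum R" "a = fadd (\<lambda>\<phi>. toeplitz f) R"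
      and Q: "g \<in> smooth_circle" "smooth_field wt_sum Q" "b = fadd (\<lambda>\<phi>. toeplitz g) Q"
    using a b unfolding has_symbol_def by blast
  define c where "c = fadd (fmult a b) (fscale (- 1) (fmult b a))"
  note ab = has_symbol_mult[OF a b] and ba = has_symbol_fscale[OF has_symbol_mult[OF b a], of "- 1"]
  have "has_symbol c (\<lambda>\<theta>. f \<theta> * g \<theta> + (- 1) * (g \<theta> * f \<theta>))"
    unfolding c_def by (rule has_symbol_add[OF ab ba])
  then have "has_symbol c (\<lambda>\<theta>. 0)" by (simp add: mult.commute)
  \<comment> \<open>The normal form with symbol 0 has no Toeplitz part, so the commutator is its own
    remainder.\<close>
  then have c: "smooth_field wt_sum c" "c = fadd (\<lambda>\<phi>. toeplitz (\<lambda>\<theta>. 0)) c"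
    unfolding has_symbol_def by (auto simp: fadd_def toeplitz_const)
  have "tau c = mat_trace (degree0 c pi)"
    using tau_eq[OF smooth_circle_const c(1), of 0] c(2) by simp
  moreover have "tau c = tau (fmult a b) - tau (fmult b a)"
    unfolding c_def tau_fadd[OF ab ba] tau_fscale[OF has_symbol_mult[OF b a]] by simp
  \<comment> \<open>On the diagonal the phase in \<open>nu\<close> is 1. The average therefore only
    moves the angle, and the base angle \<open>pi\<close> becomes one point of a full
    period.\<close>
  moreover have "mat_trace (degree0 c pi) = circle_mean (\<lambda>t. mat_trace (c (pi + t)))"
  proof -
    obtain C where C: "\<And>\<phi> x y. wt_sum x y ^ 4 * cmod (c \<phi> x y) \<le> C"
      using smooth_field_decaying[OF c(1)] unfolding decaying_def by meson
    have "0 \<le> C" by (rule order_trans[OF _ C[of 0 0 0]]) (simp add: wt_sum_def)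
    have b: "cmod (c \<phi> x x) \<le> C * inv_sq (int 0 - int x)" for \<phi> x
      by (rule diagonal_bound[OF \<open>0 \<le> C\<close> rapid_decay_bound[OF C]])
    have "((\<lambda>x. circle_mean (\<lambda>t. c (pi + t) x x)) has_sum
        circle_mean (\<lambda>t. \<Sum>\<^sub>\<infinity>x. c (pi + t) x x)) UNIV"
      by (rule circle_mean_infsum[OF shift_continuous[OF c(1)] b])
        (intro summable_on_cmult_right inv_sq_nat)
    then show ?thesis
      unfolding mat_trace_def degree0_def nu_def by (simp add: infsumI)
  qed
  \<comment> \<open>The trace is the same in every fibre: the brackets of T_f with Q and of R with b
    are traceless, and the two Toeplitz defects do not involve the angle.\<close>
  moreover have "mat_trace (c \<phi>) = ?L" for \<phi>
  proof -
    let ?F = "toeplitz f" and ?G = "toeplitz g" and ?A = "a \<phi>" and ?B = "b \<phi>" and ?R = "R \<phi>" and ?Q = "Q \<phi>"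
    note F = toeplitz_field[OF R(1)] and G = toeplitz_field[OF Q(1)]
    have band: "banded ?F" "banded ?G" "banded ?A" "banded ?B" "banded ?R" "banded ?Q"
      using smooth_field_banded[OF F] smooth_field_banded[OF G] has_symbol_banded[OF a] has_symbol_banded[OF b]
        smooth_field_banded[OF smooth_field_sum_imp_diff[OF R(2)]]
        smooth_field_banded[OF smooth_field_sum_imp_diff[OF Q(2)]] by blast+
    have A: "?A = (\<lambda>x y. ?F x y + ?R x y)" and B: "?B = (\<lambda>x y. ?G x y + ?Q x y)"
      by (simp_all add: R(3) Q(3) fadd_def)
    \<comment> \<open>R is kept next to the whole of b here and in \<open>BA\<close>, so the terms
      pair off into two commutators, each with a factor of rapid decay.\<close>
    have AB: "mat_mult ?A ?B = (\<lambda>x y. mat_mult ?F ?G x y + mat_mult ?F ?Q x y + mat_mult ?R ?B x y)"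
      by (subst A, subst mat_mult_add_left[OF band(1,5,4)], subst B, subst mat_mult_add_right[OF band(1,2,6)]) simp
    have BA: "mat_mult ?B ?A = (\<lambda>x y. mat_mult ?G ?F x y + mat_mult ?Q ?F x y + mat_mult ?B ?R x y)"
      by (subst A, subst mat_mult_add_right[OF band(4,1,5)], subst B, subst mat_mult_add_left[OF band(2,6,1)]) simp
    have comm: "toeplitz (\<lambda>\<theta>. g \<theta> * f \<theta>) = toeplitz (\<lambda>\<theta>. f \<theta> * g \<theta>)"
      by (simp add: mult.commute)
    have c\<phi>: "c \<phi> = (\<lambda>x y. (toeplitz_defect f g x y + (- 1) * toeplitz_defect g f x y)
        + ((mat_mult ?F ?Q x y + (- 1) * mat_mult ?Q ?F x y) + (mat_mult ?R ?B x y + (- 1) * mat_mult ?B ?R x y)))"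
      unfolding c_def fadd_def fscale_def fmult_def AB BA toeplitz_mult[OF R(1) Q(1)] toeplitz_mult[OF Q(1) R(1)] comm
      by (simp add: algebra_simps)
    have rd: "mat_mult ?F ?Q \<in> rapid_decay" "mat_mult ?Q ?F \<in> rapid_decay"
        "mat_mult ?R ?B \<in> rapid_decay" "mat_mult ?B ?R \<in> rapid_decay"
      using smooth_field_mult_sum[OF F Q(2)] smooth_field_mult_sum[OF has_symbol_field[OF b] R(2)]
      by (auto dest: smooth_field_rapid_decay[of _ \<phi>] simp: fmult_def)
    have dd: "toeplitz_defect f g \<in> rapid_decay" "toeplitz_defect g f \<in> rapid_decay"
      using toeplitz_defect_field[OF R(1) Q(1)] toeplitz_defect_field[OF Q(1) R(1)]
      by (auto dest: smooth_field_rapid_decay)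
    have neg: "(\<lambda>x y. (- 1) * M x y) \<in> rapid_decay" if "M \<in> rapid_decay" for M
      using that by (simp add: rapid_decay_def)
    have "mat_trace (c \<phi>) = (mat_trace (toeplitz_defect f g) + (- 1) * mat_trace (toeplitz_defect g f))
       + ((mat_trace (mat_mult ?F ?Q) + (- 1) * mat_trace (mat_mult ?Q ?F))
         + (mat_trace (mat_mult ?R ?B) + (- 1) * mat_trace (mat_mult ?B ?R)))"
    proof -
      note n = neg[OF dd(2)] neg[OF rd(2)] neg[OF rd(4)]
      note s = rapid_decay_add[OF dd(1) n(1)] rapid_decay_add[OF rd(1) n(2)] rapid_decay_add[OF rd(3) n(3)]
      show ?thesis
        unfolding c\<phi> mat_trace_add[OF s(1) rapid_decay_add[OF s(2,3)]] mat_trace_add[OF s(2,3)]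
          mat_trace_add[OF dd(1) n(1)] mat_trace_add[OF rd(1) n(2)] mat_trace_add[OF rd(3) n(3)]
          mat_trace_cmult ..
    qed
    moreover have "mat_trace (mat_mult ?F ?Q) = mat_trace (mat_mult ?Q ?F)"
      by (rule mat_trace_commute[OF band(1) smooth_field_rapid_decay[OF Q(2)]])
    moreover have "mat_trace (mat_mult ?B ?R) = mat_trace (mat_mult ?R ?B)"
      by (rule mat_trace_commute[OF band(4) smooth_field_rapid_decay[OF R(2)]])
    ultimately show ?thesis using toeplitz_defect_trace[OF R(1) Q(1)] by simp
  qed
  ultimately show ?thesis by simp
qed

section \<open>The cycle\<close>

text \<open>Hides the symbol behind plain membership, so that the closure properties can act as
  simplification rules; \<open>symbol\<close> recovers it.\<close>

definition toeplitz_algebra :: "opfield set" where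
  "toeplitz_algebra = {a. \<exists>f. has_symbol a f}"

lemma toeplitz_algebraI: "has_symbol a f \<Longrightarrow> a \<in> toeplitz_algebra"
  unfolding toeplitz_algebra_def by blast

lemma toeplitz_algebra_symbol: "a \<in> toeplitz_algebra \<Longrightarrow> has_symbol a (symbol a)"
  unfolding toeplitz_algebra_def using symbol_eq by auto

lemma toeplitz_algebra_closed:
  assumes "a \<in> toeplitz_algebra"
  shows "b \<in> toeplitz_algebra \<Longrightarrow> fadd a b \<in> toeplitz_algebra"
    "b \<in> toeplitz_algebra \<Longrightarrow> fmult a b \<in> toeplitz_algebra"
    "fscale c a \<in> toeplitz_algebra" "partial a \<in> toeplitz_algebra"
  by (rule toeplitz_algebraI[OF has_symbol_add[OF toeplitz_algebra_symbol[OF assms] toeplitz_algebra_symbol]], assumption)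
    (rule toeplitz_algebraI[OF has_symbol_mult[OF toeplitz_algebra_symbol[OF assms] toeplitz_algebra_symbol]], assumption,
     rule toeplitz_algebraI[OF has_symbol_fscale[OF toeplitz_algebra_symbol[OF assms]]],
     rule toeplitz_algebraI[OF has_symbol_partial[OF toeplitz_algebra_symbol[OF assms]]])

lemma toeplitz_algebra_consts: "fone \<in> toeplitz_algebra" "fzero \<in> toeplitz_algebra"
  by (rule toeplitz_algebraI, rule has_symbol_one has_symbol_zero)+

lemma symbol_simps:
  assumes "a \<in> toeplitz_algebra"
  shows "b \<in> toeplitz_algebra \<Longrightarrow> symbol (fadd a b) = (\<lambda>\<theta>. symbol a \<theta> + symbol b \<theta>)"
    "b \<in> toeplitz_algebra \<Longrightarrow> symbol (fmult a b) = (\<lambda>\<theta>. symbol a \<theta> * symbol b \<theta>)"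
    "symbol (fscale c a) = (\<lambda>\<theta>. c * symbol a \<theta>)"
    "symbol (partial a) = (\<lambda>\<theta>. \<i> * ddt (symbol a) \<theta>)"
  using toeplitz_algebra_symbol[OF assms]
  by (simp_all add: symbol_eq[OF has_symbol_add] symbol_eq[OF has_symbol_mult]
      symbol_eq[OF has_symbol_fscale] symbol_eq[OF has_symbol_partial] toeplitz_algebra_symbol)

lemma symbol_consts: "symbol fone = (\<lambda>\<theta>. 1)" "symbol fzero = (\<lambda>\<theta>. 0)"
  by (rule symbol_eq has_symbol_one has_symbol_zero)+

lemma symbol_smooth: "a \<in> toeplitz_algebra \<Longrightarrow> symbol a \<in> smooth_circle"
  by (rule has_symbol_smooth[OF toeplitz_algebra_symbol])

lemma fmult_algebra:
  assumes "a \<in> toeplitz_algebra" "b \<in> toeplitz_algebra" "c \<in> toeplitz_algebra"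
  shows "fmult (fmult a b) c = fmult a (fmult b c)"
    "fmult (fadd a b) c = fadd (fmult a c) (fmult b c)"
    "fmult a (fadd b c) = fadd (fmult a b) (fmult a c)"
  by (rule fmult_assoc fmult_fadd_left fmult_fadd_right;
      rule assms[THEN toeplitz_algebra_symbol, THEN has_symbol_banded])+

lemma partial_algebra:
  assumes "a \<in> toeplitz_algebra"
  shows "b \<in> toeplitz_algebra \<Longrightarrow> partial (fadd a b) = fadd (partial a) (partial b)"
    "b \<in> toeplitz_algebra \<Longrightarrow> partial (fmult a b) = fadd (fmult (partial a) b) (fmult a (partial b))"
    "partial (fscale c a) = fscale c (partial a)"
  by (rule partial_fadd[OF toeplitz_algebra_symbol[OF assms] toeplitz_algebra_symbol], assumption)
    (rule partial_fmult[OF toeplitz_algebra_symbol[OF assms] toeplitz_algebra_symbol], assumption,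
     rule partial_fscale[OF toeplitz_algebra_symbol[OF assms]])

lemma tau_algebra:
  assumes "a \<in> toeplitz_algebra"
  shows "b \<in> toeplitz_algebra \<Longrightarrow> tau (fadd a b) = tau a + tau b"
    "tau (fscale c a) = c * tau a" "tau (partial a) = 0"
    "b \<in> toeplitz_algebra \<Longrightarrow>
      tau (fmult a b) - tau (fmult b a) = - \<i> * circle_mean (\<lambda>\<theta>. ddt (symbol a) \<theta> * symbol b \<theta>)"
  by (rule tau_fadd[OF toeplitz_algebra_symbol[OF assms] toeplitz_algebra_symbol], assumption)
    (rule tau_fscale[OF toeplitz_algebra_symbol[OF assms]],
     rule tau_partial[OF toeplitz_algebra_symbol[OF assms]],
     rule tau_commutator[OF toeplitz_algebra_symbol[OF assms] toeplitz_algebra_symbol], assumption)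

section \<open>Computation rules for forms as triples\<close>

lemma fadd_simps:
  "fadd a b = fadd b a" "fadd (fadd a b) c = fadd a (fadd b c)" "fadd fzero a = a" "fadd a fzero = a"
  "fadd (fscale (- 1) a) a = fzero" "fscale s (fadd a b) = fadd (fscale s a) (fscale s b)"
  "fscale (s + t) a = fadd (fscale s a) (fscale t a)" "fscale (s * t) a = fscale s (fscale t a)"
  "fscale 1 a = a" "fscale s fzero = fzero"
  by (auto simp: fadd_def fscale_def fzero_def fun_eq_iff algebra_simps)

lemma fadd_left_commute: "fadd a (fadd b c) = fadd b (fadd a c)"
  by (auto simp: fadd_def fun_eq_iff)

lemma Omega_simps:
  "\<one>\<^bsub>Omega q\<^esub> = (fone, fzero, \<lambda>\<theta>. 0)" "\<zero>\<^bsub>Omega q\<^esub> = (fzero, fzero, \<lambda>\<theta>. 0)"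
  "(a, \<xi>, f) \<oplus>\<^bsub>Omega q\<^esub> (b, \<eta>, g) = (fadd a b, fadd \<xi> \<eta>, \<lambda>\<theta>. f \<theta> + g \<theta>)"
  "c \<odot>\<^bsub>Omega q\<^esub> (a, \<xi>, f) = (fscale c a, fscale c \<xi>, \<lambda>\<theta>. c * f \<theta>)"
  "(a, \<xi>, f) \<otimes>\<^bsub>Omega q\<^esub> (b, \<eta>, g) = (fmult a b, fadd (fmult a \<eta>) (fmult \<xi> b),
     \<lambda>\<theta>. symbol a \<theta> * g \<theta> + (- \<i> * symbol \<xi> \<theta> * ddt (symbol b) \<theta> + f \<theta> * symbol b \<theta>))"
  by (simp_all add: Omega_def oneform_zero_def oneform_add_def oneform_scale_def left_act_def right_act_def)

lemma d_Omega_simps: "d_Omega (a, \<xi>, f) = (fzero, partial a, \<lambda>\<theta>. 1 / 2 * ddt (ddt (symbol a)) \<theta>)"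
  by (simp add: d_Omega_def)

lemma form_integral_simps: "form_integral (a, \<xi>, f) = tau \<xi> + circle_mean f"
  by (simp add: form_integral_def)

section \<open>Verification of the axioms of a cycle\<close>

context
  fixes q :: real
  assumes q: "0 < q" "q < 1"
begin

lemma SUq_smooth_eq: "SUq_smooth q = toeplitz_algebra"
  using SUq_smooth_iff[OF q] unfolding toeplitz_algebra_def by blast

lemma carrier_Omega: "carrier (Omega q) = toeplitz_algebra \<times> toeplitz_algebra \<times> smooth_circle"
  by (simp add: Omega_def Omega1_def SUq_smooth_eq)

lemmas Omega_closed = toeplitz_algebra_closed toeplitz_algebra_consts symbol_smooth smooth_circle_add
  smooth_circle_cmult smooth_circle_const smooth_circle_mult smooth_circle_ddt(2)

lemma right_component_smooth:
  assumes "a \<in> toeplitz_algebra" "\<xi> \<in> toeplitz_algebra" "b \<in> toeplitz_algebra" "f \<in> smooth_circle" "g \<in> smooth_circle"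
  shows "(\<lambda>\<theta>. symbol a \<theta> * g \<theta> + (- \<i> * symbol \<xi> \<theta> * ddt (symbol b) \<theta> + f \<theta> * symbol b \<theta>)) \<in> smooth_circle"
  using assms by (intro Omega_closed)

lemma Omega_negative:
  assumes "a \<in> toeplitz_algebra" "\<xi> \<in> toeplitz_algebra" "f \<in> smooth_circle"
  shows "(fscale (- 1) a, fscale (- 1) \<xi>, \<lambda>\<theta>. (- 1) * f \<theta>) \<in> carrier (Omega q)"
    and "(fscale (- 1) a, fscale (- 1) \<xi>, \<lambda>\<theta>. (- 1) * f \<theta>) \<oplus>\<^bsub>Omega q\<^esub> (a, \<xi>, f) = \<zero>\<^bsub>Omega q\<^esub>"
  unfolding carrier_Omega Omega_simps
  by (intro SigmaI Omega_closed assms) (simp add: fadd_simps(5))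

lemma abelian_group_Omega: "abelian_group (Omega q)"
proof (rule abelian_groupI)
  fix x assume "x \<in> carrier (Omega q)"
  then obtain a \<xi> f where x: "x = (a, \<xi>, f)" "a \<in> toeplitz_algebra" "\<xi> \<in> toeplitz_algebra" "f \<in> smooth_circle"
    by (auto simp: carrier_Omega)
  show "\<exists>y\<in>carrier (Omega q). y \<oplus>\<^bsub>Omega q\<^esub> x = \<zero>\<^bsub>Omega q\<^esub>"
    unfolding x(1) using Omega_negative[OF x(2-4)] by (intro bexI)
qed (auto simp: carrier_Omega Omega_simps fadd_simps fadd_left_commute ac_simps intro!: Omega_closed)

lemma Omega_uminus:
  assumes "a \<in> toeplitz_algebra" "\<xi> \<in> toeplitz_algebra" "f \<in> smooth_circle"
  shows "\<ominus>\<^bsub>Omega q\<^esub> (a, \<xi>, f) = (fscale (- 1) a, fscale (- 1) \<xi>, \<lambda>\<theta>. (- 1) * f \<theta>)"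
  by (rule abelian_group.minus_equality[OF abelian_group_Omega Omega_negative(2)[OF assms] _ Omega_negative(1)[OF assms]])
    (use assms in \<open>simp add: carrier_Omega\<close>)

lemma ring_Omega: "Ring.ring (Omega q)"
proof (rule ringI)
  show "abelian_group (Omega q)" by (rule abelian_group_Omega)
  show "monoid (Omega q)"
  proof (rule monoidI)
    fix x y assume "x \<in> carrier (Omega q)" "y \<in> carrier (Omega q)"
    then obtain a \<xi> f b \<eta> g where x: "x = (a, \<xi>, f)" "y = (b, \<eta>, g)"
        and mem: "a \<in> toeplitz_algebra" "\<xi> \<in> toeplitz_algebra" "f \<in> smooth_circle"
          "b \<in> toeplitz_algebra" "\<eta> \<in> toeplitz_algebra" "g \<in> smooth_circle"
      by (auto simp: carrier_Omega)
    show "x \<otimes>\<^bsub>Omega q\<^esub> y \<in> carrier (Omega q)"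
      unfolding x Omega_simps carrier_Omega by (intro SigmaI right_component_smooth Omega_closed mem)
    fix z assume "z \<in> carrier (Omega q)"
    then obtain c \<zeta> h where z: "z = (c, \<zeta>, h)"
        and mem': "c \<in> toeplitz_algebra" "\<zeta> \<in> toeplitz_algebra" "h \<in> smooth_circle"
      by (auto simp: carrier_Omega)
    \<comment> \<open>In the last component the twist by -i \<sigma>(\<xi>) \<sigma>(b)' is
      associative by the Leibniz rule for (\<sigma>(b) \<sigma>(c))': one summand arises from acting
      by b and then c, the other from the symbol of \<xi> b.\<close>
    show "x \<otimes>\<^bsub>Omega q\<^esub> y \<otimes>\<^bsub>Omega q\<^esub> z = x \<otimes>\<^bsub>Omega q\<^esub> (y \<otimes>\<^bsub>Omega q\<^esub> z)"
      unfolding x z Omega_simps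
      by (simp add: mem mem' Omega_closed fmult_algebra symbol_simps ddt_mult fadd_simps(2) algebra_simps)
  qed (auto simp: carrier_Omega Omega_simps fmult_fone fmult_fzero fadd_simps symbol_consts ddt_const
      intro!: Omega_closed)
qed (auto simp: carrier_Omega Omega_simps fmult_algebra symbol_simps Omega_closed ddt_add fadd_simps(2)
    fadd_left_commute algebra_simps)

lemma cring_complex: "cring complex_ring"
proof (rule cringI)
  show "abelian_group complex_ring"
  proof (rule abelian_groupI)
    show "\<exists>y\<in>carrier complex_ring. y \<oplus>\<^bsub>complex_ring\<^esub> x = \<zero>\<^bsub>complex_ring\<^esub>" for x
      by (rule bexI[of _ "- x"]) (simp_all add: complex_ring_def)
  qed (auto simp: complex_ring_def)
  show "comm_monoid complex_ring"
    by (rule comm_monoidI) (auto simp: complex_ring_def)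
qed (auto simp: complex_ring_def ring_distribs)

lemma complex_algebra_Omega: "complex_algebra (Omega q)"
proof -
  interpret Ring.ring "Omega q" by (rule ring_Omega)
  have "Module.module complex_ring (Omega q)"
    by (rule moduleI[OF cring_complex abelian_group_Omega])
      (auto simp: carrier_Omega Omega_simps complex_ring_def fadd_simps(6-9) Omega_closed algebra_simps)
  moreover have "complex_algebra_axioms (Omega q)"
    by unfold_locales
      (auto simp: carrier_Omega Omega_simps fmult_fscale fadd_simps(6) symbol_simps Omega_closed ddt_cmult algebra_simps)
  ultimately show ?thesis by (intro complex_algebra.intro ring_Omega)
qed

lemma Omega_degree_eq:
  "Omega_degree q 0 = toeplitz_algebra \<times> {(fzero, \<lambda>\<theta>. 0)}"
  "Omega_degree q (Suc 0) = {fzero} \<times> toeplitz_algebra \<times> smooth_circle"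
  "j > 1 \<Longrightarrow> Omega_degree q j = {(fzero, fzero, \<lambda>\<theta>. 0)}"
proof -
  show "j > 1 \<Longrightarrow> Omega_degree q j = {(fzero, fzero, \<lambda>\<theta>. 0)}"
    by (cases "(q, j)" rule: Omega_degree.cases) (auto simp: oneform_zero_def)
qed (simp_all add: oneform_zero_def Omega1_def SUq_smooth_eq)

lemma Omega_degree_cases:
  assumes "x \<in> Omega_degree q j"
  obtains (zero) a where "j = 0" "x = (a, fzero, \<lambda>\<theta>. 0)" "a \<in> toeplitz_algebra"
    | (one) \<xi> f where "j = 1" "x = (fzero, \<xi>, f)" "\<xi> \<in> toeplitz_algebra" "f \<in> smooth_circle"
    | (above) "j > 1" "x = (fzero, fzero, \<lambda>\<theta>. 0)"
proof -
  consider "j = 0" | "j = Suc 0" | "j > 1" by linarith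
  then show ?thesis
    by cases (use assms that in \<open>auto simp: Omega_degree_eq simp del: Omega_degree.simps\<close>)
qed

lemma graded_algebra_Omega: "graded_algebra 1 (Omega q) (Omega_degree q)"
proof -
  interpret complex_algebra "Omega q" by (rule complex_algebra_Omega)
  note [simp del] = Omega_degree.simps
  have neg: "(\<lambda>\<theta>. - f \<theta>) \<in> smooth_circle" if "f \<in> smooth_circle" for f
    using smooth_circle_cmult[OF that, of "- 1"] by simp
  have rc: "(\<lambda>\<theta>. f \<theta> * symbol a \<theta> - \<i> * symbol \<xi> \<theta> * ddt (symbol a) \<theta>) \<in> smooth_circle"
    if "a \<in> toeplitz_algebra" "\<xi> \<in> toeplitz_algebra" "f \<in> smooth_circle" for a \<xi> f
    using right_component_smooth[of fzero \<xi> a f "\<lambda>\<theta>. 0"] that by (simp add: Omega_closed symbol_consts)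
  have sub: "submodule (Omega_degree q j) complex_ring (Omega q)" for j
  proof (rule submoduleI)
    show "Omega_degree q j \<subseteq> carrier (Omega q)"
      by (auto elim!: Omega_degree_cases simp: carrier_Omega intro!: Omega_closed)
    show "\<zero>\<^bsub>Omega q\<^esub> \<in> Omega_degree q j"
      by (cases j; cases "j > 1") (auto simp: Omega_simps Omega_degree_eq Omega_closed)
  next
    fix x assume x: "x \<in> Omega_degree q j"
    then show "\<ominus>\<^bsub>Omega q\<^esub> x \<in> Omega_degree q j"
      by (elim Omega_degree_cases)
        (auto simp: Omega_uminus Omega_degree_eq fadd_simps(10) Omega_closed neg)
  next
    fix c x assume x: "x \<in> Omega_degree q j"
    then show "c \<odot>\<^bsub>Omega q\<^esub> x \<in> Omega_degree q j"
      by (elim Omega_degree_cases) (auto simp: Omega_simps Omega_degree_eq fadd_simps(10) Omega_closed)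
  next
    fix x y assume "x \<in> Omega_degree q j" "y \<in> Omega_degree q j"
    then show "x \<oplus>\<^bsub>Omega q\<^esub> y \<in> Omega_degree q j"
      by (elim Omega_degree_cases) (auto simp: Omega_simps Omega_degree_eq fadd_simps(3) Omega_closed)
  qed
  have "graded_algebra_axioms 1 (Omega q) (Omega_degree q)"
  proof (rule graded_algebra_axioms.intro)
    show "submodule (Omega_degree q j) complex_ring (Omega q)" for j by (rule sub)
    show "Omega_degree q j = {\<zero>\<^bsub>Omega q\<^esub>}" if "1 < j" for j
      using that by (simp add: Omega_degree_eq Omega_simps)
    show "\<one>\<^bsub>Omega q\<^esub> \<in> Omega_degree q 0"
      by (simp add: Omega_degree_eq Omega_simps Omega_closed)
    \<comment> \<open>The product formula pairs one-forms only with elements of degree 0, so for two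
      one-forms every term contains \<open>fzero\<close> or its symbol.\<close>
    show "x \<otimes>\<^bsub>Omega q\<^esub> y \<in> Omega_degree q (i + j)" if "x \<in> Omega_degree q i" "y \<in> Omega_degree q j" for x y i j
      using that by (elim Omega_degree_cases)
        (simp_all add: Omega_simps Omega_degree_eq fmult_fzero fadd_simps(3,4) symbol_consts ddt_const Omega_closed rc)
    show "\<exists>!c. c \<in> (\<Pi>\<^sub>E j\<in>{..1}. Omega_degree q j) \<and> x = finsum (Omega q) c {..1}"
      if x: "x \<in> carrier (Omega q)" for x
    proof -
      obtain a \<xi> f where xe: "x = (a, \<xi>, f)" and mem: "a \<in> toeplitz_algebra" "\<xi> \<in> toeplitz_algebra" "f \<in> smooth_circle"
        using x by (auto simp: carrier_Omega)
      have fs: "finsum (Omega q) c {..1} = c 0 \<oplus>\<^bsub>Omega q\<^esub> c (Suc 0)"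
        if "c \<in> (\<Pi>\<^sub>E j\<in>{..1}. Omega_degree q j)" for c
      proof -
        have "c 0 \<in> Omega_degree q 0" "c (Suc 0) \<in> Omega_degree q (Suc 0)"
          using PiE_mem[OF that, of 0] PiE_mem[OF that, of "Suc 0"] by simp_all
        then have m: "c 0 \<in> carrier (Omega q)" "c (Suc 0) \<in> carrier (Omega q)"
          by (auto simp: Omega_degree_eq carrier_Omega Omega_closed)
        have "{..1} = insert 0 {Suc 0}" by auto
        then have "finsum (Omega q) c {..1} = finsum (Omega q) c (insert 0 {Suc 0})" by simp
        also have "\<dots> = c 0 \<oplus>\<^bsub>Omega q\<^esub> finsum (Omega q) c {Suc 0}"
          by (rule finsum_insert) (use m in auto)
        also have "finsum (Omega q) c {Suc 0} = c (Suc 0)"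
          using m finsum_insert[of "{}" "Suc 0" c] by simp
        finally show ?thesis .
      qed
      show ?thesis
      proof (rule ex1I)
        let ?c = "\<lambda>j::nat\<in>{..1}. if j = 0 then (a, fzero, \<lambda>\<theta>. 0) else (fzero, \<xi>, f)"
        have c: "?c \<in> (\<Pi>\<^sub>E j\<in>{..1}. Omega_degree q j)"
        proof (rule restrict_PiE_iff[THEN iffD2], rule ballI)
          fix j :: nat assume "j \<in> {..1}"
          then have "j = 0 \<or> j = Suc 0" by auto
          then show "(if j = 0 then (a, fzero, \<lambda>\<theta>. 0) else (fzero, \<xi>, f)) \<in> Omega_degree q j"
            using mem by (auto simp: Omega_degree_eq)
        qed
        show "?c \<in> (\<Pi>\<^sub>E j\<in>{..1}. Omega_degree q j) \<and> x = finsum (Omega q) ?c {..1}"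
        proof (rule conjI[OF c])
          have "finsum (Omega q) ?c {..1} = ?c 0 \<oplus>\<^bsub>Omega q\<^esub> ?c (Suc 0)" by (rule fs[OF c])
          also have "\<dots> = x" by (simp add: xe Omega_simps fadd_simps(3,4))
          finally show "x = finsum (Omega q) ?c {..1}" by (rule sym)
        qed
      next
        let ?c = "\<lambda>j::nat\<in>{..1}. if j = 0 then (a, fzero, \<lambda>\<theta>. 0) else (fzero, \<xi>, f)"
        fix c assume c: "c \<in> (\<Pi>\<^sub>E j\<in>{..1}. Omega_degree q j) \<and> x = finsum (Omega q) c {..1}"
        then have "c 0 \<in> Omega_degree q 0" "c (Suc 0) \<in> Omega_degree q (Suc 0)"
          using PiE_mem[of c "{..1}" "Omega_degree q" 0] PiE_mem[of c "{..1}" "Omega_degree q" "Suc 0"] by simp_all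
        then obtain a' \<xi>' f' where c01: "c 0 = (a', fzero, \<lambda>\<theta>. 0)" "c (Suc 0) = (fzero, \<xi>', f')"
          by (auto simp: Omega_degree_eq)
        have "x = c 0 \<oplus>\<^bsub>Omega q\<^esub> c (Suc 0)" using c fs by metis
        then have "a' = a" "\<xi>' = \<xi>" "f' = f"
          unfolding c01 xe Omega_simps by (simp_all add: fadd_simps(3,4))
        then have c01: "c 0 = (a, fzero, \<lambda>\<theta>. 0)" "c (Suc 0) = (fzero, \<xi>, f)" using c01 by simp_all
        show "c = ?c"
        proof
          fix j
          consider "j = 0" | "j = Suc 0" | "j \<notin> {..1::nat}" by fastforce
          then show "c j = ?c j"
            by cases (use c01 c in \<open>auto dest: PiE_arb\<close>)
        qed
      qed
    qed
  qed
  then show ?thesis by (intro graded_algebra.intro complex_algebra_Omega)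
qed

lemma graded_differential_algebra_Omega:
  "graded_differential_algebra 1 (Omega q) (Omega_degree q) d_Omega"
proof -
  note [simp del] = Omega_degree.simps
  have half: "(\<lambda>\<theta>. ddt (ddt (symbol a)) \<theta> / 2) \<in> smooth_circle" if "a \<in> toeplitz_algebra" for a
    using smooth_circle_cmult[of "ddt (ddt (symbol a))" "1 / 2"] that by (simp add: Omega_closed)
  have pz: "partial fzero = fzero"
    by (simp add: partial_def fzero_def nu_def)
  have "graded_differential_algebra_axioms (Omega q) (Omega_degree q) d_Omega"
  proof (unfold_locales)
    fix x y c assume x: "x \<in> carrier (Omega q)"
    show "d_Omega (c \<odot>\<^bsub>Omega q\<^esub> x) = c \<odot>\<^bsub>Omega q\<^esub> d_Omega x"
      using x by (auto simp: carrier_Omega Omega_simps d_Omega_simps partial_algebra symbol_simps ddt_cmult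
          Omega_closed fadd_simps(10))
    show "d_Omega (d_Omega x) = \<zero>\<^bsub>Omega q\<^esub>"
      using x by (auto simp: carrier_Omega Omega_simps d_Omega_simps pz symbol_consts ddt_const)
    assume y: "y \<in> carrier (Omega q)"
    show "d_Omega (x \<oplus>\<^bsub>Omega q\<^esub> y) = d_Omega x \<oplus>\<^bsub>Omega q\<^esub> d_Omega y"
      using x y by (auto simp: carrier_Omega Omega_simps d_Omega_simps partial_algebra symbol_simps ddt_add
          Omega_closed fadd_simps(3) algebra_simps)
  next
    fix x j assume "x \<in> Omega_degree q j"
    then show "d_Omega x \<in> Omega_degree q (Suc j)"
      by (elim Omega_degree_cases)
        (auto simp: Omega_degree_eq d_Omega_simps pz symbol_consts ddt_const half intro!: Omega_closed)
  next
    fix x y j assume x: "x \<in> Omega_degree q j" and "y \<in> carrier (Omega q)"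
    then obtain b \<eta> g where y: "y = (b, \<eta>, g)" "b \<in> toeplitz_algebra" "\<eta> \<in> toeplitz_algebra" "g \<in> smooth_circle"
      by (auto simp: carrier_Omega)
    show "d_Omega (x \<otimes>\<^bsub>Omega q\<^esub> y)
        = d_Omega x \<otimes>\<^bsub>Omega q\<^esub> y \<oplus>\<^bsub>Omega q\<^esub> ((- 1) ^ j \<odot>\<^bsub>Omega q\<^esub> (x \<otimes>\<^bsub>Omega q\<^esub> d_Omega y))"
      using x
    proof (cases rule: Omega_degree_cases)
      \<comment> \<open>The only degree in which the Leibniz rule has content. The cross term of
        (\<sigma>(a) \<sigma>(b))'' comes from the twist in the right action on d a, because
        \<partial>a has symbol i \<sigma>(a)'. In the other two cases all three terms
        vanish.\<close>
      case (zero a)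
      then show ?thesis
        unfolding zero y(1) Omega_simps d_Omega_simps
        by (simp add: y Omega_closed partial_algebra symbol_simps ddt_add ddt_mult symbol_consts ddt_const fmult_fzero
            fadd_simps(3,4,9) algebra_simps)
    next
      case (one \<xi> f)
      then show ?thesis
        unfolding one y(1) Omega_simps d_Omega_simps
        by (simp add: pz symbol_consts ddt_const fmult_fzero fadd_simps(3,4,10))
    next
      case above
      then show ?thesis
        unfolding above(2) y(1) Omega_simps d_Omega_simps
        by (simp add: pz symbol_consts ddt_const fmult_fzero fadd_simps(3,4,10))
    qed
  qed
  then show ?thesis by (intro graded_differential_algebra.intro graded_algebra_Omega)
qed

text \<open>The commutator defect of \<tau> and the twist of the right action are the same number,
  -i times the mean of \<sigma>(a)' \<sigma>(\<xi>), appearing on opposite sides of the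
  identity.\<close>

lemma form_integral_commute:
  assumes "a \<in> toeplitz_algebra" "\<xi> \<in> toeplitz_algebra" "f \<in> smooth_circle"
  shows "form_integral ((a, fzero, \<lambda>\<theta>. 0) \<otimes>\<^bsub>Omega q\<^esub> (fzero, \<xi>, f))
    = form_integral ((fzero, \<xi>, f) \<otimes>\<^bsub>Omega q\<^esub> (a, fzero, \<lambda>\<theta>. 0))"
proof -
  let ?u = "\<lambda>\<theta>. ddt (symbol a) \<theta> * symbol \<xi> \<theta>"
  let ?v = "\<lambda>\<theta>. symbol a \<theta> * f \<theta>"
  have cont: "continuous_on UNIV ?u" "continuous_on UNIV ?v"
    by (intro smooth_circle_continuous Omega_closed assms)+
  have "(\<lambda>\<theta>. - \<i> * symbol \<xi> \<theta> * ddt (symbol a) \<theta> + f \<theta> * symbol a \<theta>) = (\<lambda>\<theta>. - \<i> * ?u \<theta> + ?v \<theta>)"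
    by (simp add: ac_simps)
  then have "circle_mean (\<lambda>\<theta>. - \<i> * symbol \<xi> \<theta> * ddt (symbol a) \<theta> + f \<theta> * symbol a \<theta>)
      = - \<i> * circle_mean ?u + circle_mean ?v"
    using circle_mean_add[of "\<lambda>\<theta>. - \<i> * ?u \<theta>" ?v] cont circle_mean_cmult[of "- \<i>" ?u]
    by (simp add: continuous_intros)
  moreover have "tau (fmult a \<xi>) = - \<i> * circle_mean ?u + tau (fmult \<xi> a)"
    using tau_algebra(4)[OF assms(1,2)] unfolding diff_eq_eq .
  ultimately show ?thesis
    by (simp add: Omega_simps form_integral_simps fmult_fzero fadd_simps(3,4) symbol_consts ddt_const)
qed

lemma cycle_Omega: "cycle 1 (Omega q) (Omega_degree q) d_Omega form_integral"
proof -
  note [simp del] = Omega_degree.simps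
  have "cycle_axioms 1 (Omega q) (Omega_degree q) d_Omega form_integral"
  proof (unfold_locales)
    fix x y assume "x \<in> Omega_degree q 1" "y \<in> Omega_degree q 1"
    then show "form_integral (x \<oplus>\<^bsub>Omega q\<^esub> y) = form_integral x + form_integral y"
      by (auto simp: Omega_degree_eq Omega_simps form_integral_simps tau_algebra circle_mean_add smooth_circle_continuous)
  next
    fix x c assume "x \<in> Omega_degree q 1"
    then show "form_integral (c \<odot>\<^bsub>Omega q\<^esub> x) = c * form_integral x"
      by (auto simp: Omega_degree_eq Omega_simps form_integral_simps tau_algebra circle_mean_cmult ring_distribs)
  next
    fix x j assume "x \<in> Omega_degree q j" "Suc j = 1"
    then obtain a where a: "a \<in> toeplitz_algebra" "x = (a, fzero, \<lambda>\<theta>. 0)"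
      by (auto simp: Omega_degree_eq)
    \<comment> \<open>The weight two component of an exact form is a total derivative of a periodic
      function; the other component is annihilated by \<tau>.\<close>
    have "circle_mean (ddt (ddt (symbol a))) = 0"
      using smooth_circle_periodic[of "ddt (symbol a)" 0]
      by (intro circle_mean_deriv[of "ddt (symbol a)"]) (simp_all add: smooth_circle_ddt Omega_closed a)
    then show "form_integral (d_Omega x) = 0"
      by (simp only: a(2) d_Omega_simps form_integral_simps tau_algebra(3)[OF a(1)] circle_mean_cmult) simp
  next
    fix x y i j assume xy: "x \<in> Omega_degree q i" "y \<in> Omega_degree q j" and ij: "i + j = 1"
    \<comment> \<open>One of the degrees is 0, so the graded sign is 1 and both cases are the same
      identity read in opposite directions.\<close>
    from ij consider "i = 0" "j = Suc 0" | "i = Suc 0" "j = 0" by linarith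
    then show "form_integral (x \<otimes>\<^bsub>Omega q\<^esub> y) = (- 1) ^ (i * j) * form_integral (y \<otimes>\<^bsub>Omega q\<^esub> x)"
      by cases (use xy in \<open>auto simp: Omega_degree_eq form_integral_commute\<close>)
  qed
  then show ?thesis by (intro cycle.intro graded_differential_algebra_Omega)
qed

end

theorem proposition5:
  fixes q :: real
  assumes "0 < q" and "q < 1"
  shows "cycle 1 (Omega q) (Omega_degree q) d_Omega form_integral"
  using assms by (rule cycle_Omega)

end
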